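(* Let $L$ be a lattice, $L_{\mathbb R}=L\otimes_{\mathbb Z}\mathbb R$, $L_{\mathbb C}=L\otimes_{\mathbb Z}\mathbb C$, and let $\mathcal A=\{H_\alpha\subset L_{\mathbb R}\}$ be a locally finite (affine) hyperplane arrangement invariant under translation by $L$. The equivalence $\Phi\colon\Gamma(L_{\mathbb R},\mathcal A)\to\Pi_1(L_{\mathbb C}\setminus\bigcup_\alpha H_\alpha\otimes\mathbb C)$ extends to an equivalence of groupoids $$\tilde\Phi\colon\tilde\Gamma(L,\mathcal A)\to\Pi_1\Big(\big(L_{\mathbb C}\setminus\textstyle\bigcup_\alpha H_\alpha\otimes\mathbb C\big)/L\Big)$$ compatible with the canonical faithful functor $\Pi_1(L_{\mathbb C}\setminus\bigcup_\alpha H_\alpha\otimes\mathbb C)\to\Pi_1\big((L_{\mathbb C}\setminus\bigcup_\alpha H_\alpha\otimes\mathbb C)/L\big)$ induced by the quotient map.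
   Context: $\Pi_1$ denotes the fundamental groupoid. Let $V=L_{\mathbb R}$. For an affine hyperplane $H\subset V$, $H\otimes\mathbb C\subset V\otimes_{\mathbb R}\mathbb C$ is its complexification. Fix a subset $V_{\rm gen}\subset V$, symmetric about the origin, such that for any finite collection of hyperplanes $H_{\alpha_0},\dots,H_{\alpha_n}\in\mathcal A$, with translates $H'_{\alpha_j}$ through the origin, every connected component of $V\setminus(H'_{\alpha_0}\cup\dots\cup H'_{\alpha_n})$ contains an element of $V_{\rm gen}$. Directed graph: one vertex $[\delta]$ for each $\delta\in V$ not lying on any hyperplane of $\mathcal A$; one edge $[\delta]\xrightarrow{\ell}[\delta']$ for each $\ell\in V_{\rm gen}$ that is not parallel to any of the hyperplanes meeting the segment $\{(1-t)\delta+t\delta' : t\in[0,1]\}$ (such an arrow is called valid). The groupoid $\Gamma(V,\mathcal A)$ is the free groupoid on this directed graph modulo the congruence generated by: (1) $[\delta]\xrightarrow{\ell}[\delta]$ is the identity for any $\ell$; (2) $[\delta]\xrightarrow{\ell}[\delta'']$ is congruent to the composition of $[\delta]\xrightarrow{\ell}[\delta']$ and $[\delta']\xrightarrow{\ell}[\delta'']$ whenever all three are valid; (3) $[\delta]\xrightarrow{\ell}[\delta']$ is congruent to $[\delta]\xrightarrow{\ell'}[\delta']$ whenever $\ell$ and $\ell'$ have the same orientation relative to each hyperplane meeting the segment from $\delta$ to $\delta'$. The functor $\Phi$ sends $[\delta]$ to the point $\delta+0i$, and sends $[\delta]\xrightarrow{\ell}[\delta']$ to the homotopy class of the path which goes in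 a straight line from $\delta$ to $\delta+\ell i$, then in a straight line from $\delta+\ell i$ to $\delta'+\ell i$, then in a straight line from $\delta'+\ell i$ to $\delta'$. The groupoid $\tilde\Gamma(L,\mathcal A)$ is obtained from $\Gamma(L_{\mathbb R},\mathcal A)$ by formally adding an arrow $[\delta]\leadsto[\delta+m]$ for every $\delta$ in the complement of the $H_\alpha$ and every $m\in L$, with the additional relations: (1) the compositions $[\delta]\xrightarrow{\ell}[\delta']\leadsto[\delta'+m]$ and $[\delta]\leadsto[\delta+m]\xrightarrow{\ell}[\delta'+m]$ agree whenever the arrow labeled $\ell$ is valid; (2) $[\delta]\leadsto[\delta+m]$ and $[\delta+m]\leadsto[\delta+m+m']$ compose to $[\delta]\leadsto[\delta+m+m']$. The arrows $[\delta]\leadsto[\delta+m]$ correspond to deck transformations of the covering by $L$-translation. *)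

theory Defs
  imports "HOL-Analysis.Analysis" "Graph_Theory.Digraph"
begin

section \<open>Groupoids, functors and equivalences\<close>

text \<open>Composition is written in diagrammatic order: \<open>Comp C f g\<close> is "first \<open>f\<close>, then \<open>g\<close>".\<close>

record ('o, 'm) gpd =
  Obj :: "'o set"
  Arr :: "'m set"
  Dom :: "'m \<Rightarrow> 'o"
  Cod :: "'m \<Rightarrow> 'o"
  Comp :: "'m \<Rightarrow> 'm \<Rightarrow> 'm"
  Ident :: "'o \<Rightarrow> 'm"

definition is_inverse :: "('o, 'm) gpd \<Rightarrow> 'm \<Rightarrow> 'm \<Rightarrow> bool" where
  "is_inverse C f g \<longleftrightarrow> g \<in> Arr C \<and> Dom C g = Cod C f \<and> Cod C g = Dom C f \<and>
     Comp C f g = Ident C (Dom C f) \<and> Comp C g f = Ident C (Cod C f)"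

definition Inv :: "('o, 'm) gpd \<Rightarrow> 'm \<Rightarrow> 'm" where
  "Inv C f = (THE g. is_inverse C f g)"

locale groupoid =
  fixes C :: "('o, 'm) gpd"
  assumes dom_in_obj: "f \<in> Arr C \<Longrightarrow> Dom C f \<in> Obj C"
    and cod_in_obj: "f \<in> Arr C \<Longrightarrow> Cod C f \<in> Obj C"
    and ident_arr: "a \<in> Obj C \<Longrightarrow> Ident C a \<in> Arr C"
    and ident_dom: "a \<in> Obj C \<Longrightarrow> Dom C (Ident C a) = a"
    and ident_cod: "a \<in> Obj C \<Longrightarrow> Cod C (Ident C a) = a"
    and comp_arr: "\<lbrakk>f \<in> Arr C; g \<in> Arr C; Cod C f = Dom C g\<rbrakk> \<Longrightarrow> Comp C f g \<in> Arr C"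
    and comp_dom: "\<lbrakk>f \<in> Arr C; g \<in> Arr C; Cod C f = Dom C g\<rbrakk> \<Longrightarrow> Dom C (Comp C f g) = Dom C f"
    and comp_cod: "\<lbrakk>f \<in> Arr C; g \<in> Arr C; Cod C f = Dom C g\<rbrakk> \<Longrightarrow> Cod C (Comp C f g) = Cod C g"
    and ident_left: "f \<in> Arr C \<Longrightarrow> Comp C (Ident C (Dom C f)) f = f"
    and ident_right: "f \<in> Arr C \<Longrightarrow> Comp C f (Ident C (Cod C f)) = f"
    and comp_assoc: "\<lbrakk>f \<in> Arr C; g \<in> Arr C; h \<in> Arr C; Cod C f = Dom C g; Cod C g = Dom C h\<rbrakk>
        \<Longrightarrow> Comp C (Comp C f g) h = Comp C f (Comp C g h)"
    and inverse_exists: "f \<in> Arr C \<Longrightarrow> \<exists>g. is_inverse C f g"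

record ('o, 'm, 'p, 'n) gpd_map =
  onObj :: "'o \<Rightarrow> 'p"
  onArr :: "'m \<Rightarrow> 'n"

locale groupoid_functor = C: groupoid C + D: groupoid D
  for C :: "('o, 'm) gpd" and D :: "('p, 'n) gpd" +
  fixes F :: "('o, 'm, 'p, 'n) gpd_map"
  assumes map_obj: "a \<in> Obj C \<Longrightarrow> onObj F a \<in> Obj D"
    and map_arr: "f \<in> Arr C \<Longrightarrow> onArr F f \<in> Arr D"
    and map_dom: "f \<in> Arr C \<Longrightarrow> Dom D (onArr F f) = onObj F (Dom C f)"
    and map_cod: "f \<in> Arr C \<Longrightarrow> Cod D (onArr F f) = onObj F (Cod C f)"
    and map_ident: "a \<in> Obj C \<Longrightarrow> onArr F (Ident C a) = Ident D (onObj F a)"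
    and map_comp: "\<lbrakk>f \<in> Arr C; g \<in> Arr C; Cod C f = Dom C g\<rbrakk>
        \<Longrightarrow> onArr F (Comp C f g) = Comp D (onArr F f) (onArr F g)"

locale faithful_functor = groupoid_functor C D F
  for C :: "('o, 'm) gpd" and D :: "('p, 'n) gpd" and F +
  assumes faithful: "\<lbrakk>f \<in> Arr C; g \<in> Arr C; Dom C f = Dom C g; Cod C f = Cod C g;
      onArr F f = onArr F g\<rbrakk> \<Longrightarrow> f = g"

definition functor_id :: "('o, 'm, 'o, 'm) gpd_map" where
  "functor_id = \<lparr>onObj = id, onArr = id\<rparr>"

definition functor_comp ::
  "('p, 'n, 'q, 'k) gpd_map \<Rightarrow> ('o, 'm, 'p, 'n) gpd_map \<Rightarrow> ('o, 'm, 'q, 'k) gpd_map" where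
  "functor_comp G F = \<lparr>onObj = onObj G \<circ> onObj F, onArr = onArr G \<circ> onArr F\<rparr>"

definition functor_eq ::
  "('o, 'm) gpd \<Rightarrow> ('o, 'm, 'p, 'n) gpd_map \<Rightarrow> ('o, 'm, 'p, 'n) gpd_map \<Rightarrow> bool" where
  "functor_eq C F G \<longleftrightarrow> (\<forall>a \<in> Obj C. onObj F a = onObj G a) \<and> (\<forall>f \<in> Arr C. onArr F f = onArr G f)"

text \<open>The components need not be required to be invertible: the target is a groupoid.\<close>

definition natural_iso :: "('o, 'm) gpd \<Rightarrow> ('p, 'n) gpd \<Rightarrow> ('o, 'm, 'p, 'n) gpd_map \<Rightarrow>
    ('o, 'm, 'p, 'n) gpd_map \<Rightarrow> ('o \<Rightarrow> 'n) \<Rightarrow> bool" where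
  "natural_iso C D F G \<eta> \<longleftrightarrow>
     (\<forall>a \<in> Obj C. \<eta> a \<in> Arr D \<and> Dom D (\<eta> a) = onObj F a \<and> Cod D (\<eta> a) = onObj G a) \<and>
     (\<forall>f \<in> Arr C. Comp D (onArr F f) (\<eta> (Cod C f)) = Comp D (\<eta> (Dom C f)) (onArr G f))"

definition groupoid_equivalence ::
  "('o, 'm) gpd \<Rightarrow> ('p, 'n) gpd \<Rightarrow> ('o, 'm, 'p, 'n) gpd_map \<Rightarrow> bool" where
  "groupoid_equivalence C D F \<longleftrightarrow> groupoid_functor C D F \<and>
     (\<exists>G. groupoid_functor D C G \<and>
        (\<exists>\<eta>. natural_iso C C functor_id (functor_comp G F) \<eta>) \<and>
        (\<exists>\<epsilon>. natural_iso D D (functor_comp F G) functor_id \<epsilon>))"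


section \<open>The free groupoid on a directed graph modulo a congruence\<close>

text \<open>A letter \<open>(e, True)\<close> is the edge \<open>e\<close>, and \<open>(e, False)\<close> is its formal inverse.\<close>

type_synonym 'e word = "('e \<times> bool) list"

definition letter_src :: "('v, 'e) pre_digraph \<Rightarrow> 'e \<times> bool \<Rightarrow> 'v" where
  "letter_src G x = (if snd x then tail G (fst x) else head G (fst x))"

definition letter_tgt :: "('v, 'e) pre_digraph \<Rightarrow> 'e \<times> bool \<Rightarrow> 'v" where
  "letter_tgt G x = (if snd x then head G (fst x) else tail G (fst x))"

primrec word_from_to :: "('v, 'e) pre_digraph \<Rightarrow> 'v \<Rightarrow> 'e word \<Rightarrow> 'v \<Rightarrow> bool" where
  "word_from_to G a [] b \<longleftrightarrow> a \<in> verts G \<and> b = a"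
| "word_from_to G a (x # w) b \<longleftrightarrow>
     fst x \<in> arcs G \<and> letter_src G x = a \<and> a \<in> verts G \<and> word_from_to G (letter_tgt G x) w b"

text \<open>The congruence on words from \<open>a\<close> to \<open>b\<close> generated by free cancellation and the relations
  \<open>R\<close>; instances of \<open>R\<close> which are not parallel words of the graph are ignored.\<close>

inductive word_cong :: "('v, 'e) pre_digraph \<Rightarrow> ('e word \<Rightarrow> 'e word \<Rightarrow> bool) \<Rightarrow>
    'v \<Rightarrow> 'e word \<Rightarrow> 'e word \<Rightarrow> 'v \<Rightarrow> bool"
  for G R where
  cong_rel: "\<lbrakk>R w w'; word_from_to G a w b; word_from_to G a w' b\<rbrakk> \<Longrightarrow> word_cong G R a w w' b"
| cong_cancel: "word_from_to G a [(e, s)] b \<Longrightarrow> word_cong G R a [(e, s), (e, \<not> s)] [] a"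
| cong_refl: "word_from_to G a w b \<Longrightarrow> word_cong G R a w w b"
| cong_sym: "word_cong G R a w w' b \<Longrightarrow> word_cong G R a w' w b"
| cong_trans: "\<lbrakk>word_cong G R a w w' b; word_cong G R a w' w'' b\<rbrakk> \<Longrightarrow> word_cong G R a w w'' b"
| cong_append: "\<lbrakk>word_cong G R a u u' b; word_cong G R b w w' c\<rbrakk>
    \<Longrightarrow> word_cong G R a (u @ w) (u' @ w') c"

type_synonym ('v, 'e) word_arrow = "'v \<times> 'e word set \<times> 'v"

definition word_class :: "('v, 'e) pre_digraph \<Rightarrow> ('e word \<Rightarrow> 'e word \<Rightarrow> bool) \<Rightarrow>
    'v \<Rightarrow> 'e word \<Rightarrow> 'v \<Rightarrow> ('v, 'e) word_arrow" where
  "word_class G R a w b = (a, {u. word_cong G R a w u b}, b)"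

definition presented_groupoid :: "('v, 'e) pre_digraph \<Rightarrow> ('e word \<Rightarrow> 'e word \<Rightarrow> bool) \<Rightarrow>
    ('v, ('v, 'e) word_arrow) gpd" where
  "presented_groupoid G R =
     \<lparr>Obj = verts G,
      Arr = {word_class G R a w b | a w b. word_from_to G a w b},
      Dom = (\<lambda>(a, _, _). a),
      Cod = (\<lambda>(_, _, b). b),
      Comp = (\<lambda>(a, c, _) (_, d, b). (a, {u. \<exists>w \<in> c. \<exists>w' \<in> d. word_cong G R a (w @ w') u b}, b)),
      Ident = (\<lambda>a. word_class G R a [] a)\<rparr>"

definition edge_arrow :: "('v, 'e) pre_digraph \<Rightarrow> ('e word \<Rightarrow> 'e word \<Rightarrow> bool) \<Rightarrow>
    'e \<Rightarrow> ('v, 'e) word_arrow" where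
  "edge_arrow G R e = word_class G R (tail G e) [(e, True)] (head G e)"

primrec eval_word :: "('o, 'm) gpd \<Rightarrow> ('v \<Rightarrow> 'o) \<Rightarrow> ('e \<Rightarrow> 'm) \<Rightarrow> 'v \<Rightarrow>
    ('v, 'e) pre_digraph \<Rightarrow> 'e word \<Rightarrow> 'm" where
  "eval_word D \<phi> \<psi> a G [] = Ident D (\<phi> a)"
| "eval_word D \<phi> \<psi> a G (x # w) =
     Comp D (if snd x then \<psi> (fst x) else Inv D (\<psi> (fst x))) (eval_word D \<phi> \<psi> (letter_tgt G x) G w)"

text \<open>The functor out of a presented groupoid determined by its values \<open>\<phi>\<close> on vertices and \<open>\<psi>\<close>
  on edges. The choice of representative is immaterial as soon as \<open>\<psi>\<close> respects the relations.\<close>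

definition functor_from_edges :: "('v, 'e) pre_digraph \<Rightarrow> ('o, 'm) gpd \<Rightarrow>
    ('v \<Rightarrow> 'o) \<Rightarrow> ('e \<Rightarrow> 'm) \<Rightarrow> ('v, ('v, 'e) word_arrow, 'o, 'm) gpd_map" where
  "functor_from_edges G D \<phi> \<psi> =
     \<lparr>onObj = \<phi>, onArr = (\<lambda>(a, c, _). eval_word D \<phi> \<psi> a G (SOME w. w \<in> c))\<rparr>"


section \<open>The fundamental groupoid\<close>

text \<open>This is done for abstract topologies, since the quotient space is not a type. As in
  \<^const>\<open>homotopic_paths\<close>, paths are functions on all of \<open>real\<close>
  of which only the restriction to \<open>{0..1}\<close> matters, and homotopies fix end points.\<close>

definition path_homotopic :: "'a topology \<Rightarrow> (real \<Rightarrow> 'a) \<Rightarrow> (real \<Rightarrow> 'a) \<Rightarrow> bool" where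
  "path_homotopic X p q \<longleftrightarrow>
     homotopic_with (\<lambda>r. r 0 = p 0 \<and> r 1 = p 1) (top_of_set {0..1}) X p q"

type_synonym 'a path_arrow = "'a \<times> (real \<Rightarrow> 'a) set \<times> 'a"

definition path_class :: "'a topology \<Rightarrow> (real \<Rightarrow> 'a) \<Rightarrow> 'a path_arrow" where
  "path_class X p = (p 0, {q. path_homotopic X p q}, p 1)"

definition path_join :: "(real \<Rightarrow> 'a) \<Rightarrow> (real \<Rightarrow> 'a) \<Rightarrow> real \<Rightarrow> 'a" where
  "path_join p q = (\<lambda>t. if t \<le> 1/2 then p (2 * t) else q (2 * t - 1))"

definition fundamental_groupoid :: "'a topology \<Rightarrow> ('a, 'a path_arrow) gpd" where
  "fundamental_groupoid X =
     \<lparr>Obj = topspace X,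
      Arr = {path_class X p | p. pathin X p},
      Dom = (\<lambda>(a, _, _). a),
      Cod = (\<lambda>(_, _, b). b),
      Comp = (\<lambda>(a, c, _) (_, d, b). (a, {r. \<exists>p \<in> c. \<exists>q \<in> d. path_homotopic X (path_join p q) r}, b)),
      Ident = (\<lambda>a. path_class X (\<lambda>_. a))\<rparr>"

definition induced_functor :: "'b topology \<Rightarrow> ('a \<Rightarrow> 'b) \<Rightarrow>
    ('a, 'a path_arrow, 'b, 'b path_arrow) gpd_map" where
  "induced_functor Y f =
     \<lparr>onObj = f,
      onArr = (\<lambda>(a, c, b). (f a, {q. \<exists>p \<in> c. path_homotopic Y (f \<circ> p) q}, f b))\<rparr>"

definition quotient_topology :: "'a topology \<Rightarrow> ('a \<Rightarrow> 'b) \<Rightarrow> 'b topology" where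
  "quotient_topology X f =
     topology (\<lambda>U. U \<subseteq> f ` topspace X \<and> openin X {x \<in> topspace X. f x \<in> U})"

lemma openin_quotient_topology:
  "openin (quotient_topology X f) U \<longleftrightarrow>
     U \<subseteq> f ` topspace X \<and> openin X {x \<in> topspace X. f x \<in> U}"
proof -
  have "istopology (\<lambda>U. U \<subseteq> f ` topspace X \<and> openin X {x \<in> topspace X. f x \<in> U})"
    unfolding istopology_def
  proof (intro conjI allI impI)
    fix S T
    assume S: "S \<subseteq> f ` topspace X \<and> openin X {x \<in> topspace X. f x \<in> S}"
      and T: "T \<subseteq> f ` topspace X \<and> openin X {x \<in> topspace X. f x \<in> T}"
    show "S \<inter> T \<subseteq> f ` topspace X" using S by blast
    have "{x \<in> topspace X. f x \<in> S \<inter> T}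
        = {x \<in> topspace X. f x \<in> S} \<inter> {x \<in> topspace X. f x \<in> T}" by blast
    then show "openin X {x \<in> topspace X. f x \<in> S \<inter> T}" using S T by (simp add: openin_Int)
  next
    fix \<K>
    assume K: "\<forall>U\<in>\<K>. U \<subseteq> f ` topspace X \<and> openin X {x \<in> topspace X. f x \<in> U}"
    show "\<Union> \<K> \<subseteq> f ` topspace X" using K by blast
    have "{x \<in> topspace X. f x \<in> \<Union> \<K>} = (\<Union>U\<in>\<K>. {x \<in> topspace X. f x \<in> U})" by blast
    then show "openin X {x \<in> topspace X. f x \<in> \<Union> \<K>}" using K by (simp add: openin_clauses(3))
  qed
  then show ?thesis by (simp add: quotient_topology_def topology_inverse')
qed

lemma topspace_quotient_topology: "topspace (quotient_topology X f) = f ` topspace X"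
proof
  show "topspace (quotient_topology X f) \<subseteq> f ` topspace X"
    using openin_quotient_topology openin_topspace by metis
  have "{x \<in> topspace X. f x \<in> f ` topspace X} = topspace X" by blast
  then have "openin (quotient_topology X f) (f ` topspace X)"
    by (simp add: openin_quotient_topology)
  then show "f ` topspace X \<subseteq> topspace (quotient_topology X f)"
    by (rule openin_subset)
qed

lemma quotient_map_quotient_topology: "quotient_map X (quotient_topology X f) f"
  by (auto simp: quotient_map_def topspace_quotient_topology openin_quotient_topology)


section \<open>Lattices and hyperplane arrangements\<close>

text \<open>A lattice \<open>L\<close> together with \<open>V = L \<otimes> \<real>\<close>: the integer span of a finite real basis of \<open>V\<close>.
  The topology of \<open>V\<close> is that of a norm; as \<open>V\<close> is finite-dimensional, the norm is irrelevant.
  Working with \<^class>\<open>real_normed_vector\<close> admits the lattice of rank 0.\<close>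

definition is_lattice :: "'v::real_normed_vector set \<Rightarrow> bool" where
  "is_lattice L \<longleftrightarrow> (\<exists>B. finite B \<and> independent B \<and> span B = UNIV \<and>
     L = {(\<Sum>b\<in>B. of_int (k b) *\<^sub>R b) | k :: 'v \<Rightarrow> int. True})"

definition defines_hyperplane :: "('v::real_normed_vector \<Rightarrow> real) \<Rightarrow> real \<Rightarrow> 'v set \<Rightarrow> bool" where
  "defines_hyperplane f c H \<longleftrightarrow> linear f \<and> (\<exists>x. f x \<noteq> 0) \<and> H = {x. f x = c}"

definition is_hyperplane :: "'v::real_normed_vector set \<Rightarrow> bool" where
  "is_hyperplane H \<longleftrightarrow> (\<exists>f c. defines_hyperplane f c H)"

definition invariant_arrangement ::
  "'v::real_normed_vector set \<Rightarrow> 'v set set \<Rightarrow> bool" where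
  "invariant_arrangement L \<A> \<longleftrightarrow> (\<forall>H \<in> \<A>. is_hyperplane H) \<and> locally_finite_in euclidean \<A> \<and>
     (\<forall>m \<in> L. \<forall>H \<in> \<A>. (+) m ` H \<in> \<A>)"

text \<open>The translate of \<open>H\<close> through the origin.\<close>

definition direction :: "'v::real_normed_vector set \<Rightarrow> 'v set" where
  "direction H = {x - y | x y. x \<in> H \<and> y \<in> H}"

text \<open>The empty collection of hyperplanes is included: this only adds that \<open>V\<^sub>g\<^sub>e\<^sub>n\<close> is nonempty,
  which is otherwise not implied for the empty arrangement.\<close>

definition generic_directions :: "'v::real_normed_vector set set \<Rightarrow> 'v set \<Rightarrow> bool" where
  "generic_directions \<A> Vgen \<longleftrightarrow> (\<forall>l \<in> Vgen. - l \<in> Vgen) \<and>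
     (\<forall>\<F>. finite \<F> \<and> \<F> \<subseteq> \<A> \<longrightarrow>
        (\<forall>K \<in> components (UNIV - \<Union> (direction ` \<F>)). K \<inter> Vgen \<noteq> {}))"

definition same_orientation :: "'v::real_normed_vector set \<Rightarrow> 'v \<Rightarrow> 'v \<Rightarrow> bool" where
  "same_orientation H l l' \<longleftrightarrow> (\<forall>f c. defines_hyperplane f c H \<longrightarrow> sgn (f l) = sgn (f l'))"

text \<open>\<open>V \<otimes> \<complex>\<close> is modelled as \<open>V \<times> V\<close>, with \<open>(x, y)\<close> standing for \<open>x + i y\<close>. Hence the
  complexification of \<open>{x. f x = c}\<close> is \<open>{(x, y). f x = c \<and> f y = 0}\<close>.\<close>

definition complexify :: "'v::real_normed_vector set \<Rightarrow> ('v \<times> 'v) set" where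
  "complexify H = H \<times> direction H"

definition arr_complement :: "'v::real_normed_vector set set \<Rightarrow> ('v \<times> 'v) topology" where
  "arr_complement \<A> = top_of_set (UNIV - (\<Union>H \<in> \<A>. complexify H))"

text \<open>\<open>L\<close> acts on \<open>V \<otimes> \<complex>\<close> by translation of the real part.\<close>

definition orbit :: "'v::real_normed_vector set \<Rightarrow> 'v \<times> 'v \<Rightarrow> ('v \<times> 'v) set" where
  "orbit L z = {z + (m, 0) | m. m \<in> L}"

definition arr_quotient ::
  "'v::real_normed_vector set \<Rightarrow> 'v set set \<Rightarrow> ('v \<times> 'v) set topology" where
  "arr_quotient L \<A> = quotient_topology (arr_complement \<A>) (orbit L)"


section \<open>The groupoids \<open>\<Gamma>\<close> and \<open>\<Gamma>~\<close>, and the functor \<open>\<Phi>\<close>\<close>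

text \<open>\<open>Move \<delta> l \<delta>'\<close> is the edge from \<open>\<delta>\<close> to \<open>\<delta>'\<close> labelled \<open>l\<close>, and \<open>Deck \<delta> m\<close> is the
  additional arrow from \<open>\<delta>\<close> to \<open>\<delta> + m\<close>.\<close>

datatype 'v edge = Move 'v 'v 'v | Deck 'v 'v

primrec edge_tail :: "'v edge \<Rightarrow> 'v" where
  "edge_tail (Move \<delta> l \<delta>') = \<delta>"
| "edge_tail (Deck \<delta> m) = \<delta>"

primrec edge_head :: "'v::real_normed_vector edge \<Rightarrow> 'v" where
  "edge_head (Move \<delta> l \<delta>') = \<delta>'"
| "edge_head (Deck \<delta> m) = \<delta> + m"

definition valid_move :: "'v::real_normed_vector set set \<Rightarrow> 'v set \<Rightarrow> 'v \<Rightarrow> 'v \<Rightarrow> 'v \<Rightarrow> bool" where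
  "valid_move \<A> Vgen \<delta> l \<delta>' \<longleftrightarrow> \<delta> \<notin> \<Union>\<A> \<and> \<delta>' \<notin> \<Union>\<A> \<and> l \<in> Vgen \<and>
     (\<forall>H \<in> \<A>. H \<inter> closed_segment \<delta> \<delta>' \<noteq> {} \<longrightarrow> l \<notin> direction H)"

definition \<Gamma>_graph :: "'v::real_normed_vector set set \<Rightarrow> 'v set \<Rightarrow> ('v, 'v edge) pre_digraph" where
  "\<Gamma>_graph \<A> Vgen =
     \<lparr>verts = UNIV - \<Union>\<A>,
      arcs = {Move \<delta> l \<delta>' | \<delta> l \<delta>'. valid_move \<A> Vgen \<delta> l \<delta>'},
      tail = edge_tail, head = edge_head\<rparr>"

text \<open>Validity of the edges which occur is enforced by \<^const>\<open>word_cong\<close>.\<close>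

inductive \<Gamma>_rel :: "'v::real_normed_vector set set \<Rightarrow> 'v edge word \<Rightarrow> 'v edge word \<Rightarrow> bool"
  for \<A> where
  stay: "\<Gamma>_rel \<A> [(Move \<delta> l \<delta>, True)] []"
| subdivide: "\<Gamma>_rel \<A> [(Move \<delta> l \<delta>'', True)] [(Move \<delta> l \<delta>', True), (Move \<delta>' l \<delta>'', True)]"
| relabel: "(\<And>H. \<lbrakk>H \<in> \<A>; H \<inter> closed_segment \<delta> \<delta>' \<noteq> {}\<rbrakk> \<Longrightarrow> same_orientation H l l')
    \<Longrightarrow> \<Gamma>_rel \<A> [(Move \<delta> l \<delta>', True)] [(Move \<delta> l' \<delta>', True)]"

definition \<Gamma> :: "'v::real_normed_vector set set \<Rightarrow> 'v set \<Rightarrow>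
    ('v, ('v, 'v edge) word_arrow) gpd" where
  "\<Gamma> \<A> Vgen = presented_groupoid (\<Gamma>_graph \<A> Vgen) (\<Gamma>_rel \<A>)"

definition \<Gamma>t_graph :: "'v::real_normed_vector set \<Rightarrow> 'v set set \<Rightarrow> 'v set \<Rightarrow>
    ('v, 'v edge) pre_digraph" where
  "\<Gamma>t_graph L \<A> Vgen =
     \<lparr>verts = UNIV - \<Union>\<A>,
      arcs = arcs (\<Gamma>_graph \<A> Vgen) \<union> {Deck \<delta> m | \<delta> m. \<delta> \<notin> \<Union>\<A> \<and> m \<in> L},
      tail = edge_tail, head = edge_head\<rparr>"

inductive \<Gamma>t_rel :: "'v::real_normed_vector set set \<Rightarrow> 'v edge word \<Rightarrow> 'v edge word \<Rightarrow> bool"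
  for \<A> where
  old: "\<Gamma>_rel \<A> w w' \<Longrightarrow> \<Gamma>t_rel \<A> w w'"
| deck_move: "\<Gamma>t_rel \<A> [(Move \<delta> l \<delta>', True), (Deck \<delta>' m, True)]
    [(Deck \<delta> m, True), (Move (\<delta> + m) l (\<delta>' + m), True)]"
| deck_deck: "\<Gamma>t_rel \<A> [(Deck \<delta> m, True), (Deck (\<delta> + m) m', True)] [(Deck \<delta> (m + m'), True)]"

definition \<Gamma>t :: "'v::real_normed_vector set \<Rightarrow> 'v set set \<Rightarrow> 'v set \<Rightarrow>
    ('v, ('v, 'v edge) word_arrow) gpd" where
  "\<Gamma>t L \<A> Vgen = presented_groupoid (\<Gamma>t_graph L \<A> Vgen) (\<Gamma>t_rel \<A>)"

definition \<Gamma>_to_\<Gamma>t :: "'v::real_normed_vector set \<Rightarrow> 'v set set \<Rightarrow> 'v set \<Rightarrow>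
    ('v, ('v, 'v edge) word_arrow, 'v, ('v, 'v edge) word_arrow) gpd_map" where
  "\<Gamma>_to_\<Gamma>t L \<A> Vgen = functor_from_edges (\<Gamma>_graph \<A> Vgen) (\<Gamma>t L \<A> Vgen)
     id (edge_arrow (\<Gamma>t_graph L \<A> Vgen) (\<Gamma>t_rel \<A>))"

definition deck_arrow :: "'v::real_normed_vector set \<Rightarrow> 'v set set \<Rightarrow> 'v set \<Rightarrow> 'v \<Rightarrow> 'v \<Rightarrow>
    ('v, 'v edge) word_arrow" where
  "deck_arrow L \<A> Vgen \<delta> m = edge_arrow (\<Gamma>t_graph L \<A> Vgen) (\<Gamma>t_rel \<A>) (Deck \<delta> m)"

text \<open>The second clause is never used: \<open>\<Gamma>\<close> has no edges \<open>Deck \<delta> m\<close>.\<close>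

primrec \<Phi>_path :: "'v::real_normed_vector edge \<Rightarrow> real \<Rightarrow> 'v \<times> 'v" where
  "\<Phi>_path (Move \<delta> l \<delta>') =
     linepath (\<delta>, 0) (\<delta>, l) +++ linepath (\<delta>, l) (\<delta>', l) +++ linepath (\<delta>', l) (\<delta>', 0)"
| "\<Phi>_path (Deck \<delta> m) = undefined"

definition \<Phi> :: "'v::real_normed_vector set set \<Rightarrow> 'v set \<Rightarrow>
    ('v, ('v, 'v edge) word_arrow, 'v \<times> 'v, ('v \<times> 'v) path_arrow) gpd_map" where
  "\<Phi> \<A> Vgen = functor_from_edges (\<Gamma>_graph \<A> Vgen) (fundamental_groupoid (arr_complement \<A>))
     (\<lambda>\<delta>. (\<delta>, 0)) (\<lambda>e. path_class (arr_complement \<A>) (\<Phi>_path e))"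

end

theory Submission
  imports Defs
begin

text \<open>
  A point \<open>(x, y)\<close> of \<open>V \<times> V\<close>, standing for \<open>x + i y\<close>, lies in the complement \<open>M\<close> of the
  complexified arrangement iff \<open>y\<close> is not parallel to any hyperplane through \<open>x\<close>. Near such a
  point \<open>M\<close> contains a convex chart \<open>B \<times> C\<close>: here \<open>B\<close> is a small convex neighbourhood of \<open>x\<close>, and
  \<open>C\<close> is the set of the imaginary parts which lie on the same side as \<open>y\<close> of every hyperplane
  meeting \<open>B\<close> (translated to the origin).

  The groupoid \<open>\<Gamma>\<close> contains exactly the local data needed to transport along paths in these charts.
  Two vertices of \<open>B\<close> are connected by a move labelled by any generic \<open>l\<close> in \<open>C\<close>. The third relation
  says that this arrow does not depend on \<open>l\<close>, the second one that these arrows compose, and two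
  charts with a common point give the same arrow between their common vertices. Cutting paths
  and homotopies into pieces lying in charts turns these arrows into a functor \<open>\<Psi>\<close> from the
  fundamental groupoid of \<open>M\<close> to \<open>\<Gamma>\<close>. This is done abstractly in the locale \<open>local_transport\<close> and
  applied in \<open>local_transport_charts\<close>.

  The path assigned to a move consists of two vertical pieces, along which transport is trivial,
  and a horizontal piece inside one chart, along which transport is that move. Hence \<open>\<Psi> \<circ> \<Phi>\<close>
  is the identity (\<open>transport_\<Phi>\<close>) and \<open>\<Phi>\<close> is faithful. Conversely every point of \<open>M\<close> can be moved
  horizontally to a nearby real part off the arrangement and then down to imaginary part \<open>0\<close>. These
  paths form a natural transformation from the identity to \<open>\<Phi> \<circ> \<Psi>\<close>: by subdivision this has to be
  checked only for paths within a chart, where convexity decides (\<open>natural_at_chart\<close>). So \<open>\<Phi>\<close> is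
  full and essentially surjective.

  The lattice is discrete, so a point of \<open>M / L\<close> near the image of \<open>z\<close> has exactly one preimage near
  \<open>z\<close>. Iterating this along rays lifts maps from compact convex sets (\<open>lift_exists\<close>), in particular
  paths and homotopies, and lifts are determined by one value. Therefore the functor induced by
  the quotient map is faithful and every path in the quotient comes from \<open>M\<close>. In \<open>\<Gamma>~\<close> a deck arrow
  can be pushed past any move, hence every arrow is an arrow of \<open>\<Gamma>\<close> followed by a single deck arrow
  (\<open>normal_form\<close>). The extended functor sends such a composite to the image of a path in \<open>M\<close>; lifting
  that path back recovers the arrow of \<open>\<Gamma>\<close>, and its end point recovers the deck transformation.
\<close>

section \<open>Groupoids, and fully faithful essentially surjective functors\<close>

context groupoid
begin

lemma is_inverse_unique:
  assumes "f \<in> Arr C" "is_inverse C f g" "is_inverse C f h"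
  shows "g = h"
proof -
  have "g = Comp C g (Comp C f h)"
    using assms unfolding is_inverse_def by (metis ident_right)
  also have "\<dots> = Comp C (Comp C g f) h"
    using assms unfolding is_inverse_def by (metis comp_assoc)
  also have "\<dots> = h"
    using assms unfolding is_inverse_def by (metis ident_left)
  finally show ?thesis .
qed

lemma is_inverse_Inv: "f \<in> Arr C \<Longrightarrow> is_inverse C f (Inv C f)"
  unfolding Inv_def by (metis inverse_exists is_inverse_unique theI)

lemma Inv_eqI: "f \<in> Arr C \<Longrightarrow> is_inverse C f g \<Longrightarrow> Inv C f = g"
  using is_inverse_Inv is_inverse_unique by blast

lemma Inv_simps [simp]:
  assumes "f \<in> Arr C"
  shows "Inv C f \<in> Arr C" "Dom C (Inv C f) = Cod C f" "Cod C (Inv C f) = Dom C f"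
    "Comp C f (Inv C f) = Ident C (Dom C f)" "Comp C (Inv C f) f = Ident C (Cod C f)"
  using is_inverse_Inv[OF assms] unfolding is_inverse_def by auto

lemmas basic_simps [simp] = dom_in_obj cod_in_obj ident_arr ident_dom ident_cod comp_arr comp_dom
  comp_cod ident_left ident_right

lemma comp_ident_left [simp]: "f \<in> Arr C \<Longrightarrow> Dom C f = a \<Longrightarrow> Comp C (Ident C a) f = f"
  by auto

lemma comp_ident_right [simp]: "f \<in> Arr C \<Longrightarrow> Cod C f = a \<Longrightarrow> Comp C f (Ident C a) = f"
  by auto

lemma comp_Inv_cancel [simp]:
  assumes "f \<in> Arr C" "g \<in> Arr C" "Dom C f = Dom C g"
  shows "Comp C f (Comp C (Inv C f) g) = g"
  using assms by (subst comp_assoc[symmetric]) auto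

lemma Inv_comp_cancel [simp]:
  assumes "f \<in> Arr C" "g \<in> Arr C" "Cod C f = Dom C g"
  shows "Comp C (Inv C f) (Comp C f g) = g"
  using assms by (subst comp_assoc[symmetric]) auto

lemma cancel_left:
  assumes "f \<in> Arr C" "g \<in> Arr C" "h \<in> Arr C" "Cod C f = Dom C g" "Cod C f = Dom C h"
    "Comp C f g = Comp C f h"
  shows "g = h"
  by (metis Inv_comp_cancel assms)

lemma idempotent_is_Ident:
  assumes "f \<in> Arr C" "Cod C f = Dom C f" "Comp C f f = f"
  shows "f = Ident C (Dom C f)"
  by (rule cancel_left[of f]) (use assms in auto)

end

context groupoid_functor
begin

lemma map_Inv: "f \<in> Arr C \<Longrightarrow> onArr F (Inv C f) = Inv D (onArr F f)"
  by (rule D.Inv_eqI[symmetric])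
    (auto simp: is_inverse_def map_arr map_dom map_cod map_comp[symmetric] map_ident)

lemmas map_simps [simp] = map_obj map_arr map_dom map_cod map_ident map_comp map_Inv

end

lemma groupoid_functor_comp:
  assumes "groupoid_functor C D F" "groupoid_functor D E G"
  shows "groupoid_functor C E (functor_comp G F)"
proof -
  interpret F: groupoid_functor C D F by fact
  interpret G: groupoid_functor D E G by fact
  show ?thesis by unfold_locales (auto simp: functor_comp_def)
qed

text \<open>The inverse functor is obtained by choice: every object \<open>d\<close> of the target is connected by some
  \<open>e d\<close> to the image of an object \<open>s d\<close>, and an arrow goes to the only preimage of its conjugate by
  these connecting arrows.\<close>

lemma groupoid_equivalenceI:
  assumes "groupoid_functor C D F"
    and faithful: "\<And>f g. \<lbrakk>f \<in> Arr C; g \<in> Arr C; Dom C f = Dom C g; Cod C f = Cod C g;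
      onArr F f = onArr F g\<rbrakk> \<Longrightarrow> f = g"
    and full: "\<And>a b g. \<lbrakk>a \<in> Obj C; b \<in> Obj C; g \<in> Arr D; Dom D g = onObj F a; Cod D g = onObj F b\<rbrakk>
      \<Longrightarrow> \<exists>f \<in> Arr C. Dom C f = a \<and> Cod C f = b \<and> onArr F f = g"
    and ess: "\<And>d. d \<in> Obj D \<Longrightarrow> \<exists>a \<in> Obj C. \<exists>e \<in> Arr D. Dom D e = d \<and> Cod D e = onObj F a"
  shows "groupoid_equivalence C D F"
proof -
  interpret F: groupoid_functor C D F by fact
  obtain s where s: "\<And>d. d \<in> Obj D \<Longrightarrow> s d \<in> Obj C"
    and ex: "\<And>d. d \<in> Obj D \<Longrightarrow> \<exists>e \<in> Arr D. Dom D e = d \<and> Cod D e = onObj F (s d)"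
    using ess by metis
  obtain e where e: "\<And>d. d \<in> Obj D \<Longrightarrow> e d \<in> Arr D"
      "\<And>d. d \<in> Obj D \<Longrightarrow> Dom D (e d) = d" "\<And>d. d \<in> Obj D \<Longrightarrow> Cod D (e d) = onObj F (s d)"
    using ex by metis
  let ?conj = "\<lambda>g. Comp D (Comp D (Inv D (e (Dom D g))) g) (e (Cod D g))"
  have "\<exists>f \<in> Arr C. Dom C f = s (Dom D g) \<and> Cod C f = s (Cod D g) \<and> onArr F f = ?conj g"
    if "g \<in> Arr D" for g
    using that by (intro full) (auto simp: e s)
  then obtain t where t: "\<And>g. g \<in> Arr D \<Longrightarrow> t g \<in> Arr C"
    "\<And>g. g \<in> Arr D \<Longrightarrow> Dom C (t g) = s (Dom D g)" "\<And>g. g \<in> Arr D \<Longrightarrow> Cod C (t g) = s (Cod D g)"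
    "\<And>g. g \<in> Arr D \<Longrightarrow> onArr F (t g) = ?conj g"
    by metis
  have "\<exists>f \<in> Arr C. Dom C f = a \<and> Cod C f = s (onObj F a) \<and> onArr F f = e (onObj F a)"
    if "a \<in> Obj C" for a
    using that by (intro full) (auto simp: e s)
  then obtain h where h: "\<And>a. a \<in> Obj C \<Longrightarrow> h a \<in> Arr C" "\<And>a. a \<in> Obj C \<Longrightarrow> Dom C (h a) = a"
      "\<And>a. a \<in> Obj C \<Longrightarrow> Cod C (h a) = s (onObj F a)" "\<And>a. a \<in> Obj C \<Longrightarrow> onArr F (h a) = e (onObj F a)"
    by metis
  let ?G = "\<lparr>onObj = s, onArr = t\<rparr>"
  have G: "groupoid_functor D C ?G"
  proof
    fix a assume "a \<in> Obj D"
    then show "onArr ?G (Ident D a) = Ident C (onObj ?G a)"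
      by (intro faithful) (auto simp: s t e)
  next
    fix f g assume "f \<in> Arr D" "g \<in> Arr D" "Cod D f = Dom D g"
    then show "onArr ?G (Comp D f g) = Comp C (onArr ?G f) (onArr ?G g)"
      by (intro faithful) (auto simp: s t e F.D.comp_assoc)
  qed (auto simp: s t)
  have "natural_iso C C functor_id (functor_comp ?G F) h"
    unfolding natural_iso_def functor_id_def functor_comp_def
    by (auto simp: h intro!: faithful) (auto simp: h t s e F.D.comp_assoc)
  moreover have "natural_iso D D (functor_comp F ?G) functor_id (\<lambda>d. Inv D (e d))"
    unfolding natural_iso_def functor_id_def functor_comp_def
    by (auto simp: t s e F.D.comp_assoc)
  ultimately show ?thesis
    unfolding groupoid_equivalence_def using assms(1) G by blast
qed

section \<open>Groupoids presented by generators and relations\<close>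

lemma letter_simps [simp]:
  "letter_src G (e, True) = tail G e" "letter_src G (e, False) = head G e"
  "letter_tgt G (e, True) = head G e" "letter_tgt G (e, False) = tail G e"
  by (auto simp: letter_src_def letter_tgt_def)

lemma letter_flip:
  "letter_src G (e, \<not> s) = letter_tgt G (e, s)" "letter_tgt G (e, \<not> s) = letter_src G (e, s)"
  by (auto simp: letter_src_def letter_tgt_def)

lemma word_from_to_verts: "word_from_to G a w b \<Longrightarrow> a \<in> verts G \<and> b \<in> verts G"
  by (induction w arbitrary: a) auto

lemma word_from_to_append:
  "word_from_to G a (u @ w) c \<longleftrightarrow> (\<exists>b. word_from_to G a u b \<and> word_from_to G b w c)"
  by (induction u arbitrary: a) (auto dest: word_from_to_verts)

lemma word_from_to_appendI:
  "word_from_to G a u b \<Longrightarrow> word_from_to G b w c \<Longrightarrow> word_from_to G a (u @ w) c"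
  by (auto simp: word_from_to_append)

lemma word_cong_from_to: "word_cong G R a w w' b \<Longrightarrow> word_from_to G a w b \<and> word_from_to G a w' b"
proof (induction rule: word_cong.induct)
  case (cong_cancel a e s b)
  then show ?case by (auto simp: letter_flip)
qed (auto simp: word_from_to_append)

lemma word_class_eq_iff:
  assumes "word_from_to G a w b"
  shows "word_class G R a w b = word_class G R a w' b \<longleftrightarrow> word_cong G R a w w' b"
  using assms by (auto simp: word_class_def intro: cong_refl cong_sym cong_trans)

lemma word_class_eqI: "word_cong G R a w w' b \<Longrightarrow> word_class G R a w b = word_class G R a w' b"
  using word_class_eq_iff word_cong_from_to by metis

definition inverse_word :: "'e word \<Rightarrow> 'e word" where
  "inverse_word w = rev (map (\<lambda>(e, s). (e, \<not> s)) w)"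

lemma inverse_word_from_to: "word_from_to G a w b \<Longrightarrow> word_from_to G b (inverse_word w) a"
proof (induction w arbitrary: a)
  case (Cons x w)
  then show ?case
    by (cases x) (auto simp: inverse_word_def word_from_to_append letter_flip dest: word_from_to_verts)
qed (auto simp: inverse_word_def)

text \<open>The letters cancel from the middle outwards.\<close>

lemma word_cong_inverse_right:
  "word_from_to G a w b \<Longrightarrow> word_cong G R a (w @ inverse_word w) [] a"
proof (induction w arbitrary: a)
  case (Cons x w)
  obtain e s where x: "x = (e, s)" by (cases x)
  define c where "c = letter_tgt G x"
  have w: "word_from_to G c w b" and xc: "word_from_to G a [x] c" and xi: "word_from_to G c [(e, \<not> s)] a"
    using Cons.prems word_from_to_verts[of G c w b] by (auto simp: c_def x letter_flip)
  have "word_cong G R a ([x] @ (w @ inverse_word w) @ [(e, \<not> s)]) ([x] @ [] @ [(e, \<not> s)]) a"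
    by (intro cong_append[OF cong_refl[OF xc] cong_append[OF Cons.IH[OF w] cong_refl[OF xi]]])
  moreover have "word_cong G R a ([x] @ [] @ [(e, \<not> s)]) [] a"
    using cong_cancel xc x by fastforce
  moreover have "[x] @ (w @ inverse_word w) @ [(e, \<not> s)] = (x # w) @ inverse_word (x # w)"
    by (simp add: inverse_word_def x)
  ultimately show ?case by (metis cong_trans)
qed (auto simp: inverse_word_def intro: cong_refl)

lemma inverse_word_inverse_word [simp]: "inverse_word (inverse_word w) = w"
  by (induction w) (auto simp: inverse_word_def)

lemma word_cong_inverse_left:
  "word_from_to G a w b \<Longrightarrow> word_cong G R b (inverse_word w @ w) [] b"
  using word_cong_inverse_right[OF inverse_word_from_to, of G a w b R] by simp

lemma presented_groupoid_simps [simp]: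
  "Obj (presented_groupoid G R) = verts G"
  "Dom (presented_groupoid G R) (word_class G R a w b) = a"
  "Cod (presented_groupoid G R) (word_class G R a w b) = b"
  "Ident (presented_groupoid G R) a = word_class G R a [] a"
  "word_from_to G a w b \<Longrightarrow> word_class G R a w b \<in> Arr (presented_groupoid G R)"
  by (auto simp: presented_groupoid_def word_class_def)

lemma presented_groupoid_ArrE:
  assumes "f \<in> Arr (presented_groupoid G R)"
  obtains a w b where "word_from_to G a w b" "f = word_class G R a w b"
  using assms by (auto simp: presented_groupoid_def)

lemma presented_groupoid_Comp [simp]:
  assumes "word_from_to G a w b" "word_from_to G b u c"
  shows "Comp (presented_groupoid G R) (word_class G R a w b) (word_class G R b u c)
    = word_class G R a (w @ u) c"
proof -
  have "(\<exists>w'\<in>{w'. word_cong G R a w w' b}. \<exists>u'\<in>{u'. word_cong G R b u u' c}. word_cong G R a (w' @ u') v c)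
     \<longleftrightarrow> word_cong G R a (w @ u) v c" for v
    using assms by (auto intro: cong_refl cong_append cong_trans)
  then show ?thesis by (simp add: presented_groupoid_def word_class_def)
qed

lemma groupoid_presented: "groupoid (presented_groupoid G R)"
proof
  let ?C = "presented_groupoid G R"
  fix f assume "f \<in> Arr ?C"
  then obtain a w b where w: "word_from_to G a w b" and f: "f = word_class G R a w b"
    by (rule presented_groupoid_ArrE)
  have "is_inverse ?C f (word_class G R b (inverse_word w) a)"
    using inverse_word_from_to[OF w] w word_from_to_verts[OF w]
    by (auto simp: is_inverse_def f intro!: word_class_eqI
        word_cong_inverse_left[OF w] word_cong_inverse_right[OF w])
  then show "\<exists>g. is_inverse ?C f g" by blast
next
  fix f g h
  let ?C = "presented_groupoid G R"
  assume "f \<in> Arr ?C" "g \<in> Arr ?C" "h \<in> Arr ?C" "Cod ?C f = Dom ?C g" "Cod ?C g = Dom ?C h"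
  then obtain a w b u c v d where "word_from_to G a w b" "f = word_class G R a w b"
      "word_from_to G b u c" "g = word_class G R b u c" "word_from_to G c v d" "h = word_class G R c v d"
    by (elim presented_groupoid_ArrE) auto
  then show "Comp ?C (Comp ?C f g) h = Comp ?C f (Comp ?C g h)"
    using word_from_to_appendI[of G a w b u c] word_from_to_appendI[of G b u c v d] by simp
next
  fix f g
  let ?C = "presented_groupoid G R"
  assume "f \<in> Arr ?C" "g \<in> Arr ?C" "Cod ?C f = Dom ?C g"
  then obtain a w b u c where w: "word_from_to G a w b" "f = word_class G R a w b"
      "word_from_to G b u c" "g = word_class G R b u c"
    by (elim presented_groupoid_ArrE) auto
  then show "Comp ?C f g \<in> Arr ?C" "Dom ?C (Comp ?C f g) = Dom ?C f" "Cod ?C (Comp ?C f g) = Cod ?C g"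
    using word_from_to_appendI[of G a w b u c] by simp_all
next
  fix f
  let ?C = "presented_groupoid G R"
  assume "f \<in> Arr ?C"
  then obtain a w b where w: "word_from_to G a w b" "f = word_class G R a w b"
    by (elim presented_groupoid_ArrE) auto
  moreover have "word_from_to G a [] a" "word_from_to G b [] b"
    using word_from_to_verts[OF w(1)] by auto
  ultimately show "Comp ?C (Ident ?C (Dom ?C f)) f = f" "Comp ?C f (Ident ?C (Cod ?C f)) = f"
    "Dom ?C f \<in> Obj ?C" "Cod ?C f \<in> Obj ?C"
    by auto
qed auto

lemma edge_arrow_simps [simp]:
  "Dom (presented_groupoid G R) (edge_arrow G R e) = tail G e"
  "Cod (presented_groupoid G R) (edge_arrow G R e) = head G e"
  "\<lbrakk>e \<in> arcs G; tail G e \<in> verts G; head G e \<in> verts G\<rbrakk>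
    \<Longrightarrow> edge_arrow G R e \<in> Arr (presented_groupoid G R)"
  by (auto simp: edge_arrow_def)

lemma Inv_edge_arrow:
  assumes "e \<in> arcs G" "tail G e \<in> verts G" "head G e \<in> verts G"
  shows "Inv (presented_groupoid G R) (edge_arrow G R e)
    = word_class G R (head G e) [(e, False)] (tail G e)"
proof -
  interpret groupoid "presented_groupoid G R" by (rule groupoid_presented)
  have w: "word_from_to G (tail G e) [(e, True)] (head G e)" using assms by simp
  have i: "inverse_word [(e, True)] = [(e, False)]" by (simp add: inverse_word_def)
  show ?thesis
    using word_cong_inverse_right[OF w, of R] word_cong_inverse_left[OF w, of R] assms
    by (intro Inv_eqI) (auto simp: is_inverse_def i edge_arrow_def word_class_eq_iff)
qed

text \<open>This is induction on a representing word, from its right end. Being stated for arrows, it allows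
  later arguments to compute in the groupoid instead of with words.\<close>

lemma presented_arrow_induct [consumes 1, case_names Ident edge inverse_edge]:
  assumes "f \<in> Arr (presented_groupoid G R)"
    and "\<And>a. a \<in> verts G \<Longrightarrow> P (Ident (presented_groupoid G R) a)"
    and "\<And>f e. \<lbrakk>f \<in> Arr (presented_groupoid G R); P f; e \<in> arcs G; tail G e \<in> verts G; head G e \<in> verts G;
      Cod (presented_groupoid G R) f = tail G e\<rbrakk>
      \<Longrightarrow> P (Comp (presented_groupoid G R) f (edge_arrow G R e))"
    and "\<And>f e. \<lbrakk>f \<in> Arr (presented_groupoid G R); P f; e \<in> arcs G; tail G e \<in> verts G; head G e \<in> verts G;
      Cod (presented_groupoid G R) f = head G e\<rbrakk>
      \<Longrightarrow> P (Comp (presented_groupoid G R) f (Inv (presented_groupoid G R) (edge_arrow G R e)))"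
  shows "P f"
proof -
  obtain a w b where w: "word_from_to G a w b" and f: "f = word_class G R a w b"
    using assms(1) by (rule presented_groupoid_ArrE)
  have "P (word_class G R a w b)" using w
  proof (induction w arbitrary: b rule: rev_induct)
    case Nil
    then show ?case using assms(2)[of a] by auto
  next
    case (snoc x w)
    obtain e s where x: "x = (e, s)" by (cases x)
    obtain c where c: "word_from_to G a w c" "word_from_to G c [x] b"
      using snoc.prems by (auto simp only: word_from_to_append)
    have e: "e \<in> arcs G" "tail G e \<in> verts G" "head G e \<in> verts G"
      using c by (cases s; auto simp: x)+
    show ?case
    proof (cases s)
      case True
      then have "c = tail G e" "b = head G e" using c by (auto simp: x)
      then show ?thesis
        using assms(3)[OF presented_groupoid_simps(5)[OF c(1)] snoc.IH[OF c(1)] e] c x True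
        by (simp add: edge_arrow_def)
    next
      case False
      then have "c = head G e" "b = tail G e" using c by (auto simp: x)
      then show ?thesis
        using assms(4)[OF presented_groupoid_simps(5)[OF c(1)] snoc.IH[OF c(1)] e] c x False e
        by (simp add: Inv_edge_arrow)
    qed
  qed
  then show ?thesis by (simp add: f)
qed

text \<open>A functor is determined by its values on the generators.\<close>

lemma presented_functors_agree:
  assumes "groupoid_functor (presented_groupoid G R) D F" "groupoid_functor (presented_groupoid G R) D F'"
    and "\<And>a. a \<in> verts G \<Longrightarrow> onObj F a = onObj F' a"
    and "\<And>e. \<lbrakk>e \<in> arcs G; tail G e \<in> verts G; head G e \<in> verts G\<rbrakk>
      \<Longrightarrow> onArr F (edge_arrow G R e) = onArr F' (edge_arrow G R e)"
  shows "functor_eq (presented_groupoid G R) F F'"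
proof -
  interpret F: groupoid_functor "presented_groupoid G R" D F by fact
  interpret F': groupoid_functor "presented_groupoid G R" D F' by fact
  have "onArr F f = onArr F' f" if "f \<in> Arr (presented_groupoid G R)" for f
    using that
  proof (induction rule: presented_arrow_induct)
    case (Ident a)
    then show ?case
      using F.map_ident[of a] F'.map_ident[of a] assms(3)
      by (simp del: presented_groupoid_simps(4) F.map_ident F'.map_ident)
  next
    case (edge f e)
    then show ?case using assms(4) by simp
  next
    case (inverse_edge f e)
    then show ?case using assms(4) by simp
  qed
  then show ?thesis using assms(3) by (auto simp: functor_eq_def)
qed

text \<open>The universal property: images of the generators that satisfy the relations
  extend to a functor.\<close>

locale edge_assignment = D: groupoid D
  for G :: "('v, 'e) pre_digraph" and R and D :: "('o, 'm) gpd" and \<phi> :: "'v \<Rightarrow> 'o" and \<psi> :: "'e \<Rightarrow> 'm" +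
  assumes vertex_image: "a \<in> verts G \<Longrightarrow> \<phi> a \<in> Obj D"
    and edge_image: "\<lbrakk>e \<in> arcs G; tail G e \<in> verts G; head G e \<in> verts G\<rbrakk>
      \<Longrightarrow> \<psi> e \<in> Arr D \<and> Dom D (\<psi> e) = \<phi> (tail G e) \<and> Cod D (\<psi> e) = \<phi> (head G e)"
    and relation_image: "\<lbrakk>R w w'; word_from_to G a w b; word_from_to G a w' b\<rbrakk>
      \<Longrightarrow> eval_word D \<phi> \<psi> a G w = eval_word D \<phi> \<psi> a G w'"
begin

lemma eval_word_arrow:
  assumes "word_from_to G a w b"
  shows "eval_word D \<phi> \<psi> a G w \<in> Arr D \<and> Dom D (eval_word D \<phi> \<psi> a G w) = \<phi> a \<and>
    Cod D (eval_word D \<phi> \<psi> a G w) = \<phi> b"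
  using assms
proof (induction w arbitrary: a)
  case Nil
  then show ?case by (auto simp: vertex_image)
next
  case (Cons x w)
  obtain e s where x: "x = (e, s)" by (cases x)
  have w: "word_from_to G (letter_tgt G x) w b" using Cons.prems by simp
  have "tail G e \<in> verts G" "head G e \<in> verts G" "e \<in> arcs G"
    using Cons.prems word_from_to_verts[OF w] by (cases s; auto simp: x)+
  then show ?case using Cons.IH[OF w] edge_image[of e] Cons.prems by (cases s) (auto simp: x)
qed

lemma eval_word_append:
  assumes "word_from_to G a u b" "word_from_to G b w c"
  shows "eval_word D \<phi> \<psi> a G (u @ w) = Comp D (eval_word D \<phi> \<psi> a G u) (eval_word D \<phi> \<psi> b G w)"
  using assms(1)
proof (induction u arbitrary: a)
  case Nil
  then show ?case using eval_word_arrow[OF assms(2)] by auto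
next
  case (Cons x u)
  obtain e s where x: "x = (e, s)" by (cases x)
  have w: "word_from_to G (letter_tgt G x) u b" using Cons.prems by simp
  have "tail G e \<in> verts G" "head G e \<in> verts G" "e \<in> arcs G"
    using Cons.prems word_from_to_verts[OF w] by (cases s; auto simp: x)+
  then show ?case
    using Cons.IH[OF w] edge_image[of e] Cons.prems eval_word_arrow[OF w] eval_word_arrow[OF assms(2)]
    by (cases s) (auto simp: x D.comp_assoc)
qed

lemma eval_word_cong: "word_cong G R a w w' b \<Longrightarrow> eval_word D \<phi> \<psi> a G w = eval_word D \<phi> \<psi> a G w'"
proof (induction rule: word_cong.induct)
  case (cong_cancel a e s b)
  then have "tail G e \<in> verts G" "head G e \<in> verts G" "e \<in> arcs G"
    by (cases s; auto)+
  with cong_cancel show ?case using edge_image[of e] by (cases s) (auto simp: vertex_image)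
next
  case (cong_append a u u' b w w' c)
  then show ?case using word_cong_from_to[of G R] by (metis eval_word_append)
qed (auto intro: relation_image)

lemma functor_from_edges_word_class:
  assumes "word_from_to G a w b"
  shows "onArr (functor_from_edges G D \<phi> \<psi>) (word_class G R a w b) = eval_word D \<phi> \<psi> a G w"
proof -
  have "word_cong G R a w (SOME u. word_cong G R a w u b) b"
    by (rule someI) (use assms in \<open>rule cong_refl\<close>)
  then show ?thesis
    by (simp add: functor_from_edges_def word_class_def eval_word_cong)
qed

lemma onObj_functor_from_edges [simp]: "onObj (functor_from_edges G D \<phi> \<psi>) = \<phi>"
  by (simp add: functor_from_edges_def)

lemma functor_from_edges_edge_arrow [simp]:
  assumes "e \<in> arcs G" "tail G e \<in> verts G" "head G e \<in> verts G"
  shows "onArr (functor_from_edges G D \<phi> \<psi>) (edge_arrow G R e) = \<psi> e"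
  using assms edge_image[of e]
  by (simp add: edge_arrow_def functor_from_edges_word_class)

lemma groupoid_functor_from_edges: "groupoid_functor (presented_groupoid G R) D (functor_from_edges G D \<phi> \<psi>)"
proof -
  interpret C: groupoid "presented_groupoid G R" by (rule groupoid_presented)
  show ?thesis
  proof
    fix f g let ?C = "presented_groupoid G R"
    assume "f \<in> Arr ?C" "g \<in> Arr ?C" "Cod ?C f = Dom ?C g"
    then obtain a w b u c where w: "word_from_to G a w b" "f = word_class G R a w b"
      "word_from_to G b u c" "g = word_class G R b u c"
      by (elim presented_groupoid_ArrE) auto
    then show "onArr (functor_from_edges G D \<phi> \<psi>) (Comp ?C f g) =
      Comp D (onArr (functor_from_edges G D \<phi> \<psi>) f) (onArr (functor_from_edges G D \<phi> \<psi>) g)"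
      using word_from_to_appendI[OF w(1,3)]
      by (simp add: functor_from_edges_word_class eval_word_append[OF w(1,3)])
  qed (auto simp: vertex_image functor_from_edges_word_class eval_word_arrow elim!: presented_groupoid_ArrE)
qed

end

section \<open>The fundamental groupoid of a topological space\<close>

lemma path_homotopicD:
  assumes "path_homotopic X p q"
  shows "pathin X p" "pathin X q" "q 0 = p 0" "q 1 = p 1"
  using homotopic_with_imp_continuous_maps[OF assms[unfolded path_homotopic_def]]
    homotopic_with_imp_property[OF assms[unfolded path_homotopic_def]]
  by (auto simp: pathin_def)

lemma path_homotopic_refl: "pathin X p \<Longrightarrow> path_homotopic X p p"
  unfolding path_homotopic_def pathin_def by (simp add: homotopic_with_refl)

lemma path_homotopic_sym: "path_homotopic X p q \<Longrightarrow> path_homotopic X q p"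
  using path_homotopicD[of X p q] unfolding path_homotopic_def
  by (subst homotopic_with_sym) simp

lemma path_homotopic_trans:
  "path_homotopic X p q \<Longrightarrow> path_homotopic X q r \<Longrightarrow> path_homotopic X p r"
  using path_homotopicD[of X p q] unfolding path_homotopic_def
  by (auto intro: homotopic_with_trans)

lemma path_homotopic_iff:
  "path_homotopic X p q \<longleftrightarrow> (\<exists>h. continuous_map (top_of_set ({0..1::real} \<times> {0..1::real})) X h \<and>
     (\<forall>t\<in>{0..1}. h (0, t) = p t \<and> h (1, t) = q t) \<and> (\<forall>s\<in>{0..1}. h (s, 0) = p 0 \<and> h (s, 1) = p 1))"
  unfolding path_homotopic_def by (subst homotopic_with) (simp_all add: prod_topology_subtopology_eu ball_conj_distrib conj_assoc)

lemma path_homotopic_cong: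
  assumes "pathin X p" "\<And>t. t \<in> {0..1} \<Longrightarrow> p t = q t"
  shows "path_homotopic X p q"
  unfolding path_homotopic_def
  by (rule homotopic_with_equal) (use assms in \<open>auto simp: pathin_def\<close>)

lemma path_homotopic_compose:
  assumes "path_homotopic X p q" "continuous_map X Y f"
  shows "path_homotopic Y (f \<circ> p) (f \<circ> q)"
proof -
  obtain h where h: "continuous_map (top_of_set ({0..1::real} \<times> {0..1::real})) X h"
     "\<forall>t\<in>{0..1}. h (0, t) = p t \<and> h (1, t) = q t" "\<forall>s\<in>{0..1}. h (s, 0) = p 0 \<and> h (s, 1) = p 1"
    using assms(1) unfolding path_homotopic_iff by blast
  show ?thesis unfolding path_homotopic_iff
    by (rule exI[of _ "f \<circ> h"]) (use h assms(2) in \<open>auto intro: continuous_map_compose\<close>)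
qed

lemma pathin_reparam:
  assumes "pathin X p" "continuous_on {0..1} f" "f ` {0..1} \<subseteq> {0..1}"
  shows "pathin X (p \<circ> f)"
  unfolding pathin_def
  by (rule continuous_map_compose[of _ "top_of_set {0..1}"]) (use assms in \<open>auto simp: pathin_def\<close>)

text \<open>Straight-line homotopies. This covers the reparametrizations behind the groupoid laws
  (with \<open>K = {0..1}\<close>) as well as the uniqueness of paths inside a convex chart.\<close>

lemma path_homotopic_through_convex:
  fixes K :: "'k::real_normed_vector set"
  assumes "convex K" "continuous_map (top_of_set K) X h"
    and f: "continuous_on {0..1} f" "f ` {0..1} \<subseteq> K"
    and g: "continuous_on {0..1} g" "g ` {0..1} \<subseteq> K"
    and ends: "f 0 = g 0" "f 1 = g (1::real)"
  shows "path_homotopic X (h \<circ> f) (h \<circ> g)"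
proof -
  let ?k = "\<lambda>z::real\<times>real. (1 - fst z) *\<^sub>R f (snd z) + fst z *\<^sub>R g (snd z)"
  have "continuous_on ({0..1::real} \<times> {0..1::real}) ?k"
    by (intro continuous_intros continuous_on_compose2[OF f(1)] continuous_on_compose2[OF g(1)]) auto
  moreover have "?k z \<in> K" if "z \<in> {0..1} \<times> {0..1}" for z
    using that f(2) g(2) by (intro convexD[OF assms(1)]) auto
  ultimately have "continuous_map (top_of_set ({0..1::real} \<times> {0..1::real})) (top_of_set K) ?k"
    by auto
  then have "continuous_map (top_of_set ({0..1::real} \<times> {0..1::real})) X (h \<circ> ?k)"
    using assms(2) by (rule continuous_map_compose)
  then show ?thesis unfolding path_homotopic_iff
    by (intro exI[of _ "h \<circ> ?k"]) (auto simp: ends scaleR_add_left[symmetric])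
qed

lemma pathin_path_join:
  assumes "pathin X p" "pathin X q" "p 1 = q 0"
  shows "pathin X (path_join p q)"
proof -
  have eq: "subtopology (top_of_set {0..1}) {t \<in> topspace (top_of_set {0..1}). t \<le> 1/2} = top_of_set {0..1/2::real}"
    "subtopology (top_of_set {0..1}) {t \<in> topspace (top_of_set {0..1}). 1/2 \<le> t} = top_of_set {1/2..1::real}"
    unfolding subtopology_subtopology by (rule arg_cong[of _ _ top_of_set], force)+
  have "continuous_map (top_of_set {0..1/2}) X (p \<circ> (\<lambda>t. 2 * t))"
    by (rule continuous_map_compose[of _ "top_of_set {0..1}"])
      (use assms(1) in \<open>auto simp: pathin_def intro!: continuous_intros\<close>)
  moreover have "continuous_map (top_of_set {1/2..1}) X (q \<circ> (\<lambda>t. 2 * t - 1))"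
    by (rule continuous_map_compose[of _ "top_of_set {0..1}"])
      (use assms(2) in \<open>auto simp: pathin_def intro!: continuous_intros\<close>)
  moreover have "continuous_map (top_of_set {0..1}) euclideanreal (\<lambda>t::real. t)"
    by auto
  ultimately show ?thesis
    unfolding pathin_def path_join_def
    by (intro continuous_map_cases_le) (simp_all only: eq, auto simp: assms(3) comp_def)
qed

lemma path_homotopic_path_join:
  assumes "path_homotopic X p p'" "path_homotopic X q q'" "p 1 = q 0"
  shows "path_homotopic X (path_join p q) (path_join p' q')"
proof -
  let ?I = "{0..1::real}"
  obtain h where h: "continuous_map (top_of_set (?I \<times> ?I)) X h"
     "\<forall>t\<in>?I. h (0, t) = p t \<and> h (1, t) = p' t" "\<forall>s\<in>?I. h (s, 0) = p 0 \<and> h (s, 1) = p 1"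
    using assms(1) unfolding path_homotopic_iff by blast
  obtain k where k: "continuous_map (top_of_set (?I \<times> ?I)) X k"
     "\<forall>t\<in>?I. k (0, t) = q t \<and> k (1, t) = q' t" "\<forall>s\<in>?I. k (s, 0) = q 0 \<and> k (s, 1) = q 1"
    using assms(2) unfolding path_homotopic_iff by blast
  let ?m = "\<lambda>z. if snd z \<le> 1/2 then h (fst z, 2 * snd z) else k (fst z, 2 * snd z - 1)"
  have eq: "subtopology (top_of_set (?I \<times> ?I)) {z \<in> topspace (top_of_set (?I \<times> ?I)). snd z \<le> 1/2} = top_of_set (?I \<times> {0..1/2})"
    "subtopology (top_of_set (?I \<times> ?I)) {z \<in> topspace (top_of_set (?I \<times> ?I)). 1/2 \<le> snd z} = top_of_set (?I \<times> {1/2..1})"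
    unfolding subtopology_subtopology by (rule arg_cong[of _ _ top_of_set], force)+
  have "continuous_map (top_of_set (?I \<times> {0..1/2})) X (h \<circ> (\<lambda>z. (fst z, 2 * snd z)))"
    by (rule continuous_map_compose[OF _ h(1)]) (auto intro!: continuous_intros)
  moreover have "continuous_map (top_of_set (?I \<times> {1/2..1})) X (k \<circ> (\<lambda>z. (fst z, 2 * snd z - 1)))"
    by (rule continuous_map_compose[OF _ k(1)]) (auto intro!: continuous_intros)
  moreover have "continuous_map (top_of_set (?I \<times> ?I)) euclideanreal snd"
    by (auto intro!: continuous_intros)
  moreover have "h (fst z, 2 * snd z) = k (fst z, 2 * snd z - 1)" if "z \<in> ?I \<times> ?I" "snd z = 1/2" for z
  proof -
    have "2 * snd z = 1" "2 * snd z - 1 = 0" "fst z \<in> ?I" using that by auto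
    then show ?thesis using h k assms(3) by simp
  qed
  ultimately have "continuous_map (top_of_set (?I \<times> ?I)) X ?m"
    by (intro continuous_map_cases_le) (simp_all only: eq, auto simp: comp_def)
  then show ?thesis unfolding path_homotopic_iff
    by (intro exI[of _ ?m]) (use h k in \<open>auto simp: path_join_def\<close>)
qed

lemma path_class_eq_iff:
  assumes "pathin X p"
  shows "path_class X p = path_class X q \<longleftrightarrow> path_homotopic X p q"
proof
  assume "path_class X p = path_class X q"
  then have "p \<in> {r. path_homotopic X q r}"
    using path_homotopic_refl[OF assms] by (auto simp: path_class_def)
  then show "path_homotopic X p q" by (simp add: path_homotopic_sym)
next
  assume pq: "path_homotopic X p q"
  have "path_homotopic X p r \<longleftrightarrow> path_homotopic X q r" for r
    using path_homotopic_trans[OF pq, of r] path_homotopic_trans[OF path_homotopic_sym[OF pq], of r] by blast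
  then show "path_class X p = path_class X q"
    using path_homotopicD[OF pq] by (simp add: path_class_def)
qed

lemma path_class_eqI: "path_homotopic X p q \<Longrightarrow> path_class X p = path_class X q"
  using path_class_eq_iff path_homotopicD(1) by metis

lemma fundamental_groupoid_simps [simp]:
  "Obj (fundamental_groupoid X) = topspace X"
  "Dom (fundamental_groupoid X) (path_class X p) = p 0"
  "Cod (fundamental_groupoid X) (path_class X p) = p 1"
  "Ident (fundamental_groupoid X) a = path_class X (\<lambda>_. a)"
  "pathin X p \<Longrightarrow> path_class X p \<in> Arr (fundamental_groupoid X)"
  by (simp_all add: fundamental_groupoid_def path_class_def[of X p]) (auto simp: path_class_def[of X p, symmetric])

lemma fundamental_groupoid_ArrE:
  assumes "f \<in> Arr (fundamental_groupoid X)"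
  obtains p where "pathin X p" "f = path_class X p"
  using assms by (auto simp: fundamental_groupoid_def)

lemma path_join_ends [simp]: "path_join p q 0 = p 0" "path_join p q 1 = q 1"
  by (auto simp: path_join_def)

lemma fundamental_groupoid_Comp [simp]:
  assumes "pathin X p" "pathin X q" "p 1 = q 0"
  shows "Comp (fundamental_groupoid X) (path_class X p) (path_class X q) = path_class X (path_join p q)"
proof -
  have "(\<exists>p'\<in>{p'. path_homotopic X p p'}. \<exists>q'\<in>{q'. path_homotopic X q q'}. path_homotopic X (path_join p' q') r)
     \<longleftrightarrow> path_homotopic X (path_join p q) r"
    (is "?L \<longleftrightarrow> ?R") for r
  proof
    assume ?L
    then obtain p' q' where "path_homotopic X p p'" "path_homotopic X q q'" "path_homotopic X (path_join p' q') r"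
      by blast
    then show ?R using path_homotopic_path_join path_homotopic_trans assms(3) by metis
  next
    assume ?R
    then show ?L using assms path_homotopic_refl by blast
  qed
  then show ?thesis by (simp add: fundamental_groupoid_def path_class_def)
qed

lemma path_class_reparam_eq:
  assumes "pathin X p" "continuous_on {0..1} f" "f ` {0..1} \<subseteq> {0..1}"
    "continuous_on {0..1} g" "g ` {0..1} \<subseteq> {0..1}" "f 0 = g 0" "f 1 = g 1"
    "\<And>t. t \<in> {0..1} \<Longrightarrow> q t = p (f t)" "\<And>t. t \<in> {0..1} \<Longrightarrow> r t = p (g t)"
  shows "path_class X q = path_class X r"
proof -
  have h: "path_homotopic X (p \<circ> f) (p \<circ> g)"
    by (rule path_homotopic_through_convex[of "{0..1}"]) (use assms in \<open>auto simp: pathin_def\<close>)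
  have "path_homotopic X (p \<circ> f) q" "path_homotopic X (p \<circ> g) r"
    using path_homotopicD[OF h] assms by (auto intro!: path_homotopic_cong)
  then show ?thesis using h path_class_eqI by metis
qed

text \<open>In each law both sides are one path precomposed with two maps of the unit interval which have the
  same end points, so that \<open>path_class_reparam_eq\<close> applies.\<close>

lemma groupoid_fundamental: "groupoid (fundamental_groupoid X)"
proof
  let ?C = "fundamental_groupoid X"
  fix f assume "f \<in> Arr ?C"
  then obtain p where p: "pathin X p" "f = path_class X p" by (rule fundamental_groupoid_ArrE)
  have p': "pathin X (\<lambda>t. p (1 - t))"
    unfolding pathin_def
    by (rule continuous_map_compose[where g = p, unfolded o_def, of _ "top_of_set {0..1}"])
      (use p in \<open>auto simp: pathin_def intro!: continuous_intros\<close>)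
  \<comment> \<open>out and back along the same path\<close>
  have "path_class X (path_join p (\<lambda>t. p (1 - t))) = path_class X (\<lambda>_. p 0)"
    by (rule path_class_reparam_eq[of X p "\<lambda>t. min (2*t) (2 - 2*t)" "\<lambda>_. 0"])
      ((rule p | (intro continuous_intros; fail) | (simp add: path_join_def min_def image_subset_iff field_simps; fail))+)
  moreover have "path_class X (path_join (\<lambda>t. p (1 - t)) p) = path_class X (\<lambda>_. p 1)"
    by (rule path_class_reparam_eq[of X p "\<lambda>t. max (1 - 2*t) (2*t - 1)" "\<lambda>_. 1"])
      ((rule p | (intro continuous_intros; fail) | (simp add: path_join_def max_def image_subset_iff field_simps; fail))+)
  ultimately have "is_inverse ?C f (path_class X (\<lambda>t. p (1 - t)))"
    using p p' by (auto simp: is_inverse_def)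
  then show "\<exists>g. is_inverse ?C f g" by blast
  have "path_class X (path_join (\<lambda>_. p 0) p) = path_class X p"
    by (rule path_class_reparam_eq[of X p "\<lambda>t. max 0 (2*t - 1)" "\<lambda>t. t"])
      ((rule p | (intro continuous_intros; fail) | (simp add: path_join_def max_def image_subset_iff field_simps; fail))+)
  then show "Comp ?C (Ident ?C (Dom ?C f)) f = f"
    using p path_start_in_topspace[OF p(1)] by simp
  have "path_class X (path_join p (\<lambda>_. p 1)) = path_class X p"
    by (rule path_class_reparam_eq[of X p "\<lambda>t. min (2*t) 1" "\<lambda>t. t"])
      ((rule p | (intro continuous_intros; fail) | (simp add: path_join_def min_def image_subset_iff field_simps; fail))+)
  then show "Comp ?C f (Ident ?C (Cod ?C f)) = f"
    using p path_finish_in_topspace[OF p(1)] by simp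
next
  let ?C = "fundamental_groupoid X"
  fix f g h
  assume "f \<in> Arr ?C" "g \<in> Arr ?C" "h \<in> Arr ?C" "Cod ?C f = Dom ?C g" "Cod ?C g = Dom ?C h"
  then obtain p q r where p: "pathin X p" "f = path_class X p" "pathin X q" "g = path_class X q"
    "pathin X r" "h = path_class X r" "p 1 = q 0" "q 1 = r 0"
    by (elim fundamental_groupoid_ArrE) auto
  have pqr: "pathin X (path_join p (path_join q r))"
    using p by (simp add: pathin_path_join)
  \<comment> \<open>the piecewise linear map which sends the break points 1/4 and 1/2 to 1/2 and 3/4; it is concave, hence a minimum\<close>
  have assoc: "path_join (path_join p q) r t =
      path_join p (path_join q r) (min (2*t) (min (t + 1/4) (t * (1/2) + 1/2)))" for t
  proof -
    consider "t \<le> 1/4" | "1/4 < t" "t \<le> 1/2" | "1/2 < t" by linarith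
    then show ?thesis
    proof cases
      case 1
      then have "min (2*t) (min (t + 1/4) (t * (1/2) + 1/2)) = 2 * t" by (simp add: min_def)
      then show ?thesis using 1 by (simp only:) (simp add: path_join_def)
    next
      case 2
      then have "min (2*t) (min (t + 1/4) (t * (1/2) + 1/2)) = t + 1/4" by (simp add: min_def)
      then show ?thesis using 2 by (simp only:) (simp add: path_join_def algebra_simps)
    next
      case 3
      then have "min (2*t) (min (t + 1/4) (t * (1/2) + 1/2)) = t * (1/2) + 1/2" by (simp add: min_def)
      then show ?thesis using 3 by (simp only:) (simp add: path_join_def algebra_simps)
    qed
  qed
  have "path_class X (path_join (path_join p q) r) = path_class X (path_join p (path_join q r))"
    by (rule path_class_reparam_eq[of X "path_join p (path_join q r)"
          "\<lambda>t. min (2*t) (min (t + 1/4) (t * (1/2) + 1/2))" "\<lambda>t. t"])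
      ((rule pqr | (intro continuous_intros; fail) |
        (simp add: image_subset_iff min_def; fail) | (rule assoc; assumption) | rule refl)+)
  then show "Comp ?C (Comp ?C f g) h = Comp ?C f (Comp ?C g h)"
    using p by (simp add: pathin_path_join)
qed (auto elim!: fundamental_groupoid_ArrE simp: pathin_path_join
      path_start_in_topspace path_finish_in_topspace)

lemma Comp_path_class_reparam:
  assumes "pathin X p" "continuous_on {0..1} f" "f ` {0..1} \<subseteq> {0..1}"
    "continuous_on {0..1} g" "g ` {0..1} \<subseteq> {0..1}" "f 1 = g (0::real)"
    "continuous_on {0..1} h" "h ` {0..1} \<subseteq> {0..1}" "h 0 = f 0" "h 1 = g (1::real)"
  shows "Comp (fundamental_groupoid X) (path_class X (p \<circ> f)) (path_class X (p \<circ> g)) = path_class X (p \<circ> h)"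
proof -
  have j: "pathin (top_of_set {0..1}) (path_join f g)"
    by (rule pathin_path_join) (use assms in \<open>auto simp: pathin_def\<close>)
  have "path_class X (path_join (p \<circ> f) (p \<circ> g)) = path_class X (p \<circ> h)"
    by (rule path_class_reparam_eq[of X p "path_join f g" h])
      (use assms j in \<open>auto simp: pathin_def image_subset_iff\<close>,
        use assms in \<open>auto simp: path_join_def\<close>)
  moreover have "pathin X (p \<circ> f)" "pathin X (p \<circ> g)"
    using assms by (auto intro: pathin_reparam)
  ultimately show ?thesis using assms by simp
qed

lemma induced_functor_path_class:
  assumes "continuous_map X Y f" "pathin X p"
  shows "onArr (induced_functor Y f) (path_class X p) = path_class Y (f \<circ> p)"
proof -
  have "(\<exists>p'\<in>{p'. path_homotopic X p p'}. path_homotopic Y (f \<circ> p') q) \<longleftrightarrow> path_homotopic Y (f \<circ> p) q"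
    (is "?L \<longleftrightarrow> ?R") for q
  proof
    assume ?L
    then obtain p' where "path_homotopic X p p'" "path_homotopic Y (f \<circ> p') q" by blast
    then show ?R using path_homotopic_compose[OF _ assms(1)] path_homotopic_trans by metis
  next
    assume ?R
    then show ?L using assms path_homotopic_refl by blast
  qed
  then show ?thesis by (simp add: induced_functor_def path_class_def)
qed

lemma onObj_induced_functor [simp]: "onObj (induced_functor Y f) = f"
  by (simp add: induced_functor_def)

lemma groupoid_functor_induced:
  assumes f: "continuous_map X Y f"
  shows "groupoid_functor (fundamental_groupoid X) (fundamental_groupoid Y) (induced_functor Y f)"
proof -
  interpret C: groupoid "fundamental_groupoid X" by (rule groupoid_fundamental)
  interpret D: groupoid "fundamental_groupoid Y" by (rule groupoid_fundamental)
  have o: "f \<circ> path_join p q = path_join (f \<circ> p) (f \<circ> q)" for p q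
    by (auto simp: path_join_def)
  show ?thesis
  proof
    fix g assume "g \<in> Arr (fundamental_groupoid X)"
    then obtain p where "pathin X p" "g = path_class X p" by (rule fundamental_groupoid_ArrE)
    then show "onArr (induced_functor Y f) g \<in> Arr (fundamental_groupoid Y)"
      "Dom (fundamental_groupoid Y) (onArr (induced_functor Y f) g)
        = onObj (induced_functor Y f) (Dom (fundamental_groupoid X) g)"
      "Cod (fundamental_groupoid Y) (onArr (induced_functor Y f) g)
        = onObj (induced_functor Y f) (Cod (fundamental_groupoid X) g)"
      using f by (simp_all add: induced_functor_path_class pathin_compose)
  next
    fix g h let ?C = "fundamental_groupoid X"
    assume "g \<in> Arr ?C" "h \<in> Arr ?C" "Cod ?C g = Dom ?C h"
    then obtain p q where "pathin X p" "g = path_class X p" "pathin X q" "h = path_class X q" "p 1 = q 0"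
      by (elim fundamental_groupoid_ArrE) auto
    then show "onArr (induced_functor Y f) (Comp ?C g h)
      = Comp (fundamental_groupoid Y) (onArr (induced_functor Y f) g) (onArr (induced_functor Y f) h)"
      using f by (simp add: induced_functor_path_class pathin_compose pathin_path_join o)
  next
    fix a assume "a \<in> Obj (fundamental_groupoid X)"
    then show "onObj (induced_functor Y f) a \<in> Obj (fundamental_groupoid Y)"
      "onArr (induced_functor Y f) (Ident (fundamental_groupoid X) a)
        = Ident (fundamental_groupoid Y) (onObj (induced_functor Y f) a)"
      using f continuous_map_image_subset_topspace[OF f]
      by (auto simp: induced_functor_path_class comp_def)
  qed
qed

section \<open>Functors on the fundamental groupoid from local transport data\<close>

text \<open>The preimages of the cover are open only relative to \<open>K\<close>, hence the Lebesgue number lemma is applied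
  to open sets that cut out subsets of them.\<close>

lemma Lebesgue_number_pullback:
  fixes K :: "'k::metric_space set"
  assumes "compact K" "continuous_map (top_of_set K) X h"
    and "\<And>U. U \<in> \<U> \<Longrightarrow> openin X U" "topspace X \<subseteq> \<Union>\<U>"
  obtains e where "e > 0" "\<And>T. \<lbrakk>T \<subseteq> K; T \<noteq> {}; diameter T < e\<rbrakk> \<Longrightarrow> \<exists>U\<in>\<U>. h ` T \<subseteq> U"
proof -
  define \<C> where "\<C> = {V. open V \<and> (V \<inter> K = {} \<or> (\<exists>U\<in>\<U>. h ` (K \<inter> V) \<subseteq> U))}"
  have "x \<in> \<Union>\<C>" if x: "x \<in> K" for x
  proof -
    have "h x \<in> topspace X"
      using assms(2) x by (auto simp: continuous_map_def)
    then obtain U where U: "U \<in> \<U>" "h x \<in> U" using assms(4) by blast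
    then have "openin (top_of_set K) {y \<in> K. h y \<in> U}"
      using assms(2,3) by (auto simp: continuous_map_def)
    then obtain V where V: "open V" "{y \<in> K. h y \<in> U} = K \<inter> V" by (auto simp: openin_open)
    then have "V \<in> \<C>" using U by (auto simp: \<C>_def)
    moreover have "x \<in> V" using V U x by blast
    ultimately show ?thesis by blast
  qed
  moreover have "{} \<in> \<C>" by (simp add: \<C>_def)
  moreover have "open V" if "V \<in> \<C>" for V using that by (simp add: \<C>_def)
  ultimately obtain e where e: "0 < e" "\<And>T. \<lbrakk>T \<subseteq> K; diameter T < e\<rbrakk> \<Longrightarrow> \<exists>B \<in> \<C>. T \<subseteq> B"
    using Lebesgue_number_lemma[of K \<C>] assms(1) by (metis empty_iff subsetI)
  show thesis
  proof (rule that[OF e(1)])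
    fix T assume T: "T \<subseteq> K" "T \<noteq> {}" "diameter T < e"
    then obtain V where V: "V \<in> \<C>" "T \<subseteq> V" using e(2) by blast
    then have "V \<inter> K \<noteq> {}" using T by blast
    then obtain U where "U \<in> \<U>" "h ` (K \<inter> V) \<subseteq> U" using V(1) unfolding \<C>_def by blast
    then show "\<exists>U\<in>\<U>. h ` T \<subseteq> U" using T V(2) by (intro bexI[of _ U]) blast+
  qed
qed

text \<open>Transport along short paths: \<open>\<tau>\<close> is meaningful for two points in a common member of the cover \<open>\<U>\<close>,
  and must not depend on the member which contains them. By the cocycle condition it extends to
  arbitrary paths, by subdivision.\<close>

locale local_transport = G: groupoid G
  for G :: "('o, 'm) gpd" and X :: "'x topology" and \<U> :: "'x set set"
    and \<phi> :: "'x \<Rightarrow> 'o" and \<tau> :: "'x \<Rightarrow> 'x \<Rightarrow> 'm" +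
  assumes open_cover: "U \<in> \<U> \<Longrightarrow> openin X U" "topspace X \<subseteq> \<Union>\<U>"
    and transport_arr: "\<lbrakk>U \<in> \<U>; w \<in> U; w' \<in> U\<rbrakk>
      \<Longrightarrow> \<tau> w w' \<in> Arr G \<and> Dom G (\<tau> w w') = \<phi> w \<and> Cod G (\<tau> w w') = \<phi> w'"
    and cocycle: "\<lbrakk>U \<in> \<U>; w \<in> U; w' \<in> U; w'' \<in> U\<rbrakk> \<Longrightarrow> Comp G (\<tau> w w') (\<tau> w' w'') = \<tau> w w''"
begin

lemma transport_refl:
  assumes "U \<in> \<U>" "w \<in> U"
  shows "\<tau> w w = Ident G (\<phi> w)"
  using G.idempotent_is_Ident[of "\<tau> w w"] transport_arr[OF assms assms(2)]
    cocycle[OF assms assms(2) assms(2)] by simp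

lemma base_obj:
  assumes "w \<in> topspace X"
  shows "\<phi> w \<in> Obj G"
proof -
  obtain U where "U \<in> \<U>" "w \<in> U" using assms open_cover by blast
  then show ?thesis using transport_arr[of U w w] G.dom_in_obj[of "\<tau> w w"] by simp
qed

definition subdivided :: "nat \<Rightarrow> (real \<Rightarrow> 'x) \<Rightarrow> bool" where
  "subdivided N p \<longleftrightarrow> 0 < N \<and> (\<forall>k<N. \<exists>U\<in>\<U>. p ` {real k / N .. real (Suc k) / N} \<subseteq> U)"

primrec chain :: "nat \<Rightarrow> (real \<Rightarrow> 'x) \<Rightarrow> nat \<Rightarrow> 'm" where
  "chain N p 0 = Ident G (\<phi> (p 0))"
| "chain N p (Suc k) = Comp G (chain N p k) (\<tau> (p (real k / N)) (p (real (Suc k) / N)))"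

lemma subdividedE:
  assumes "subdivided N p" "k < N"
  obtains U where "U \<in> \<U>" "\<And>t. real k / N \<le> t \<Longrightarrow> t \<le> real (Suc k) / N \<Longrightarrow> p t \<in> U"
proof -
  obtain U where "U \<in> \<U>" "p ` {real k / N .. real (Suc k) / N} \<subseteq> U"
    using assms unfolding subdivided_def by blast
  then show thesis by (intro that[of U]) (auto simp del: of_nat_Suc)
qed

lemma chain_arr:
  assumes "subdivided N p" "k \<le> N"
  shows "chain N p k \<in> Arr G \<and> Dom G (chain N p k) = \<phi> (p 0) \<and> Cod G (chain N p k) = \<phi> (p (real k / N))"
  using assms(2)
proof (induction k)
  case 0
  have "0 < N" using assms(1) by (simp add: subdivided_def)
  then obtain U where U: "U \<in> \<U>" "\<And>t. real 0 / N \<le> t \<Longrightarrow> t \<le> real (Suc 0) / N \<Longrightarrow> p t \<in> U"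
    using subdividedE[OF assms(1), of 0] by blast
  have "\<phi> (p 0) \<in> Obj G" using transport_arr[OF U(1), of "p 0" "p 0"] U(2)[of 0] G.dom_in_obj[of "\<tau> (p 0) (p 0)"] by simp
  then show ?case by simp
next
  case (Suc k)
  then obtain U where U: "U \<in> \<U>" "\<And>t. real k / N \<le> t \<Longrightarrow> t \<le> real (Suc k) / N \<Longrightarrow> p t \<in> U"
    using subdividedE[OF assms(1), of k] by auto
  have "real k / N \<le> real (Suc k) / N" by (simp add: divide_right_mono)
  then show ?case using Suc transport_arr[OF U(1), of "p (real k / N)" "p (real (Suc k) / N)"] U(2)
    by (auto simp del: of_nat_Suc)
qed

lemma chain_cong:
  assumes "\<And>t. t \<in> {0..1} \<Longrightarrow> p t = q t" "0 < N" "k \<le> N"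
  shows "chain N p k = chain N q k"
  using assms(3) by (induction k) (auto simp: assms(1,2) simp del: of_nat_Suc)

lemma subdivided_cong:
  assumes "\<And>t. t \<in> {0..1} \<Longrightarrow> p t = q t" "subdivided N p"
  shows "subdivided N q"
proof -
  have "q ` {real k / N .. real (Suc k) / N} = p ` {real k / N .. real (Suc k) / N}" if "k < N" for k
  proof (rule image_cong[OF refl])
    fix t assume t: "t \<in> {real k / N .. real (Suc k) / N}"
    have "real (Suc k) / N \<le> 1" using that by simp
    then have "t \<le> 1" using t by (auto simp del: of_nat_Suc)
    moreover have "0 \<le> real k / N" by simp
    then have "0 \<le> t" using t unfolding atLeastAtMost_iff by linarith
    ultimately have "t \<in> {0..1}" by simp
    then show "q t = p t" using assms(1) by simp
  qed
  then show ?thesis using assms(2) by (simp add: subdivided_def del: of_nat_Suc)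
qed

lemma subdivided_mult:
  assumes "subdivided N p" "0 < m"
  shows "subdivided (N * m) p"
  unfolding subdivided_def
proof (intro conjI allI impI)
  show "0 < N * m" using assms by (simp add: subdivided_def)
  fix k assume k: "k < N * m"
  then have "k div m < N" by (simp add: less_mult_imp_div_less)
  then obtain U where U: "U \<in> \<U>" "\<And>t. real (k div m) / N \<le> t \<Longrightarrow> t \<le> real (Suc (k div m)) / N \<Longrightarrow> p t \<in> U"
    using subdividedE[OF assms(1)] by blast
  have N: "0 < N" using assms(1) by (simp add: subdivided_def)
  have "(k div m) * m \<le> k" "Suc k \<le> Suc (k div m) * m"
    using assms(2) dividend_less_div_times[of m k] by (simp_all add: Suc_le_eq)
  then have "real (k div m) * m \<le> k" "real (Suc k) \<le> real (Suc (k div m)) * m"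
    by (metis of_nat_le_iff of_nat_mult)+
  then have "real (k div m) * m / (N * m) \<le> real k / (N * m)"
      "real (Suc k) / (N * m) \<le> real (Suc (k div m)) * m / (N * m)"
    by (intro divide_right_mono; simp)+
  then have "real (k div m) / N \<le> real k / (N * m)" "real (Suc k) / (N * m) \<le> real (Suc (k div m)) / N"
    using assms(2) by simp_all
  then show "\<exists>U\<in>\<U>. p ` {real k / real (N * m)..real (Suc k) / real (N * m)} \<subseteq> U"
    using U by (intro bexI[of _ U]) (auto simp del: of_nat_Suc)
qed

text \<open>Within a piece of the coarser subdivision the finer transports telescope, by the cocycle
  condition.\<close>

lemma chain_refine:
  assumes "subdivided N p" "0 < m" "j \<le> N"
  shows "chain (N * m) p (j * m) = chain N p j"
  using assms(3)
proof (induction j)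
  case (Suc j)
  have N: "0 < N" using assms(1) by (simp add: subdivided_def)
  obtain U where U: "U \<in> \<U>" "\<And>t. real j / N \<le> t \<Longrightarrow> t \<le> real (Suc j) / N \<Longrightarrow> p t \<in> U"
    using subdividedE[OF assms(1), of j] Suc.prems by auto
  let ?t = "\<lambda>i. real (j * m + i) / (N * m)"
  have in_U: "p (?t i) \<in> U" if "i \<le> m" for i
  proof (rule U(2))
    show "real j / N \<le> ?t i" using N assms(2) by (simp add: field_simps)
    have "real (j * m + i) \<le> real (Suc j) * m" using that by (simp add: algebra_simps)
    then show "?t i \<le> real (Suc j) / N" using N assms(2) by (simp add: field_simps)
  qed
  have t0: "?t 0 = real j / N" using assms(2) by simp
  have tm: "?t m = real (Suc j) / N" using N assms(2) by (simp add: field_simps)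
  have "chain (N * m) p (j * m + i) = Comp G (chain N p j) (\<tau> (p (?t 0)) (p (?t i)))" if "i \<le> m" for i
    using that
  proof (induction i)
    case 0
    have "chain N p j \<in> Arr G" "Cod G (chain N p j) = \<phi> (p (?t 0))"
      using chain_arr[OF assms(1), of j] Suc.prems assms(2) by (auto simp: t0 simp del: of_nat_add)
    then show ?case using Suc transport_refl[OF U(1) in_U[of 0]] by (simp del: of_nat_add add: t0)
  next
    case (Suc i)
    have "chain (N * m) p (j * m + Suc i)
      = Comp G (Comp G (chain N p j) (\<tau> (p (?t 0)) (p (?t i)))) (\<tau> (p (?t i)) (p (?t (Suc i))))"
      using Suc by simp
    also have "\<dots> = Comp G (chain N p j) (Comp G (\<tau> (p (?t 0)) (p (?t i))) (\<tau> (p (?t i)) (p (?t (Suc i)))))"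
      using chain_arr[OF assms(1), of j] Suc.prems \<open>Suc j \<le> N\<close>
        transport_arr[OF U(1) in_U[of 0] in_U[of i]] transport_arr[OF U(1) in_U[of i] in_U[of "Suc i"]]
        assms(2) by (intro G.comp_assoc) (simp_all add: t0[simplified])
    also have "\<dots> = Comp G (chain N p j) (\<tau> (p (?t 0)) (p (?t (Suc i))))"
      using cocycle[OF U(1) in_U[of 0] in_U[of i] in_U[of "Suc i"]] Suc.prems by simp
    finally show ?case .
  qed
  from this[of m] show ?case unfolding t0 tm by (simp add: add.commute)
qed simp

definition transport :: "(real \<Rightarrow> 'x) \<Rightarrow> 'm" where
  "transport p = (let N = (SOME N. subdivided N p) in chain N p N)"

text \<open>Any two subdivisions have a common refinement.\<close>

lemma transport_eq_chain:
  assumes "subdivided N p"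
  shows "transport p = chain N p N"
proof -
  define M where "M = (SOME N. subdivided N p)"
  have M: "subdivided M p" unfolding M_def using assms by (rule someI)
  have "chain (N * M) p (N * M) = chain N p N" "chain (M * N) p (M * N) = chain M p M"
    using M assms by (auto simp: subdivided_def intro!: chain_refine)
  then show ?thesis by (simp add: transport_def M_def[symmetric] mult.commute)
qed

lemma ex_subdivided_grid:
  assumes h: "continuous_map (top_of_set ({0..1::real} \<times> {0..1::real})) X h"
  obtains N where "0 < N" "\<And>i k. \<lbrakk>i < N; k < N\<rbrakk> \<Longrightarrow> \<exists>U\<in>\<U>.
    h ` ({real i / N .. real (Suc i) / N} \<times> {real k / N .. real (Suc k) / N}) \<subseteq> U"
proof -
  obtain e where e: "e > 0" "\<And>T. \<lbrakk>T \<subseteq> {0..1::real} \<times> {0..1::real}; T \<noteq> {}; diameter T < e\<rbrakk> \<Longrightarrow> \<exists>U\<in>\<U>. h ` T \<subseteq> U"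
    using Lebesgue_number_pullback[OF _ h open_cover] compact_Times compact_Icc by metis
  obtain N :: nat where N: "2 / e < N" using reals_Archimedean2 by blast
  then have "0 < real N" using e(1) by (smt (verit) divide_pos_pos)
  then have N0: "0 < N" and Ne: "2 / N < e" using N e(1) by (simp_all add: field_simps)
  show thesis
  proof (rule that[OF N0])
    fix i k assume ik: "i < N" "k < N"
    let ?T = "{real i / N .. real (Suc i) / N} \<times> {real k / N .. real (Suc k) / N}"
    have le: "real j / N \<le> real (Suc j) / N" "real (Suc j) / N - real j / N = 1 / N" for j
      by (simp_all add: divide_right_mono diff_divide_distrib[symmetric])
    have ub: "real (Suc j) / N \<le> 1" if "j < N" for j using that by simp
    have "dist x y \<le> 2 / N" if "x \<in> ?T" "y \<in> ?T" for x y
    proof -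
      have "\<bar>fst x - fst y\<bar> \<le> 1 / N" "\<bar>snd x - snd y\<bar> \<le> 1 / N"
        using that le(2)[of i] le(2)[of k] by (auto simp: abs_le_iff simp del: of_nat_Suc)
      moreover have "dist x y \<le> dist (fst x) (fst y) + dist (snd x) (snd y)"
        unfolding dist_prod_def by (rule sqrt_sum_squares_le_sum) auto
      ultimately show ?thesis by (simp add: dist_real_def)
    qed
    then have "diameter ?T \<le> 2 / N"
      by (intro diameter_le) (auto simp: dist_norm)
    moreover have "?T \<noteq> {}" using le(1) by (auto simp del: of_nat_Suc)
    moreover have "?T \<subseteq> {0..1} \<times> {0..1}"
      using ub[OF ik(1)] ub[OF ik(2)] by (intro Sigma_mono) (auto simp del: of_nat_Suc)
    ultimately show "\<exists>U\<in>\<U>. h ` ?T \<subseteq> U" using e(2) Ne by (meson le_less_trans)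
  qed
qed

lemma ex_subdivided:
  assumes "pathin X p"
  obtains N where "subdivided N p"
proof -
  have "continuous_map (top_of_set ({0..1::real} \<times> {0..1::real})) X (p \<circ> snd)"
    by (rule continuous_map_compose[of _ "top_of_set {0..1}"])
      (use assms in \<open>auto simp: pathin_def intro!: continuous_intros\<close>)
  then obtain N where N: "0 < N" "\<And>i k. \<lbrakk>i < N; k < N\<rbrakk> \<Longrightarrow> \<exists>U\<in>\<U>.
    (p \<circ> snd) ` ({real i / N .. real (Suc i) / N} \<times> {real k / N .. real (Suc k) / N}) \<subseteq> U"
    using ex_subdivided_grid by metis
  have "subdivided N p" unfolding subdivided_def
  proof (intro conjI allI impI)
    fix k assume "k < N"
    then obtain U where U: "U \<in> \<U>" "(p \<circ> snd) ` ({real 0 / N .. real (Suc 0) / N} \<times> {real k / N .. real (Suc k) / N}) \<subseteq> U"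
      using N by blast
    have "(p \<circ> snd) (0::real, t) \<in> U" if "t \<in> {real k / N .. real (Suc k) / N}" for t
      by (rule subsetD[OF U(2)], rule imageI) (use that in auto)
    then show "\<exists>U\<in>\<U>. p ` {real k / N .. real (Suc k) / N} \<subseteq> U"
      using U(1) by (intro bexI[of _ U]) (auto simp del: of_nat_Suc)
  qed (use N in auto)
  then show thesis by (rule that)
qed

text \<open>The square is cut into a grid whose small squares are mapped into members of the cover. The
  transports along the initial segments of two neighbouring rows differ by the transport between
  their end points. On the right edge of the square, where the homotopy is constant, the latter is
  trivial.\<close>

lemma transport_homotopic:
  assumes "path_homotopic X p q"
  shows "transport p = transport q"
proof -
  obtain h where h: "continuous_map (top_of_set ({0..1::real} \<times> {0..1::real})) X h"
     "\<forall>t\<in>{0..1}. h (0, t) = p t \<and> h (1, t) = q t" "\<forall>s\<in>{0..1}. h (s, 0) = p 0 \<and> h (s, 1) = p 1"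
    using assms(1) unfolding path_homotopic_iff by blast
  obtain N where N: "0 < N" "\<And>i k. \<lbrakk>i < N; k < N\<rbrakk> \<Longrightarrow> \<exists>U\<in>\<U>.
    h ` ({real i / N .. real (Suc i) / N} \<times> {real k / N .. real (Suc k) / N}) \<subseteq> U"
    using ex_subdivided_grid[OF h(1)] by metis
  define r where "r i t = h (real i / N, t)" for i :: nat and t
  have le: "real j / N \<le> real (Suc j) / N" for j
    by (simp add: divide_right_mono)
  have subdivided: "subdivided N (r i)" if "i \<le> N" for i
    unfolding subdivided_def
  proof (intro conjI allI impI)
    fix k assume k: "k < N"
    obtain j where j: "j < N" "real i / N \<in> {real j / N .. real (Suc j) / N}"
    proof (cases "i < N")
      case True
      then show ?thesis using that[of i] le by auto
    next
      case False
      then show ?thesis using that[of "N - 1"] \<open>i \<le> N\<close> N(1) by (auto simp: divide_right_mono)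
    qed
    obtain U where "U \<in> \<U>" "h ` ({real j / N .. real (Suc j) / N} \<times> {real k / N .. real (Suc k) / N}) \<subseteq> U"
      using N(2)[OF j(1) k] by blast
    then show "\<exists>U\<in>\<U>. r i ` {real k / N .. real (Suc k) / N} \<subseteq> U"
      using j(2) unfolding r_def by (intro bexI[of _ U]) (auto simp del: of_nat_Suc)
  qed (rule N)
  have r0: "r i 0 = p 0" and r1: "r i 1 = p 1" if "i \<le> N" for i
    using that h(3) N(1) by (auto simp: r_def)
  \<comment> \<open>row \<open>i + 1\<close> against row \<open>i\<close>, by induction on the column\<close>
  have step: "chain N (r (Suc i)) k = Comp G (chain N (r i) k) (\<tau> (r i (real k / N)) (r (Suc i) (real k / N)))"
    if i: "i < N" and k: "k \<le> N" for i k
    using k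
  proof (induction k)
    case 0
    have r: "r (Suc i) 0 = p 0" "r i 0 = p 0" using r0[of i] r0[of "Suc i"] i by auto
    obtain U where U: "U \<in> \<U>" "\<And>t. real 0 / N \<le> t \<Longrightarrow> t \<le> real (Suc 0) / N \<Longrightarrow> r i t \<in> U"
      using subdividedE[OF subdivided[of i], of 0] i N(1) by (metis less_imp_le)
    have "U \<in> \<U>" "p 0 \<in> U" using U(1) U(2)[of 0] r by auto
    then have "\<tau> (p 0) (p 0) = Ident G (\<phi> (p 0))" "\<phi> (p 0) \<in> Obj G"
      using transport_refl transport_arr[of U "p 0" "p 0"] G.dom_in_obj[of "\<tau> (p 0) (p 0)"] by auto
    then show ?case by (simp add: r)
  next
    case (Suc k)
    let ?s = "real k / N" and ?t = "real (Suc k) / N"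
    obtain U where U: "U \<in> \<U>" "h ` ({real i / N .. real (Suc i) / N} \<times> {?s .. ?t}) \<subseteq> U"
      using N(2)[OF i, of k] Suc.prems by auto
    then have inU: "r i ?s \<in> U" "r i ?t \<in> U" "r (Suc i) ?s \<in> U" "r (Suc i) ?t \<in> U"
      using le[of i] le[of k] unfolding r_def by (auto simp del: of_nat_Suc)
    note arr = transport_arr[OF U(1)] and chain = chain_arr[OF subdivided[of i], of k] chain_arr[OF subdivided[of "Suc i"], of k]
    have "chain N (r (Suc i)) (Suc k) = Comp G (Comp G (chain N (r i) k) (\<tau> (r i ?s) (r (Suc i) ?s))) (\<tau> (r (Suc i) ?s) (r (Suc i) ?t))"
      using Suc by (simp del: of_nat_Suc)
    also have "\<dots> = Comp G (chain N (r i) k) (\<tau> (r i ?s) (r (Suc i) ?t))"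
      using arr inU chain i Suc.prems cocycle[OF U(1)] by (simp add: G.comp_assoc del: of_nat_Suc)
    also have "\<dots> = Comp G (chain N (r i) (Suc k)) (\<tau> (r i ?t) (r (Suc i) ?t))"
      using arr inU chain i Suc.prems cocycle[OF U(1)] by (simp add: G.comp_assoc del: of_nat_Suc)
    finally show ?case .
  qed
  have eq: "chain N (r i) N = chain N (r 0) N" if "i \<le> N" for i
    using that
  proof (induction i)
    case (Suc i)
    have r: "r (Suc i) 1 = p 1" "r i 1 = p 1" using r1[of i] r1[of "Suc i"] Suc.prems by auto
    obtain U where U: "U \<in> \<U>" "\<And>t. real (N - 1) / N \<le> t \<Longrightarrow> t \<le> real (Suc (N - 1)) / N \<Longrightarrow> r i t \<in> U"
      using subdividedE[OF subdivided[of i], of "N - 1"] Suc.prems N(1)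
      by (metis Suc_leD diff_less zero_less_one)
    then have "U \<in> \<U>" "p 1 \<in> U" using U(2)[of 1] r N(1) by auto
    then have "\<tau> (p 1) (p 1) = Ident G (\<phi> (p 1))" using transport_refl by blast
    then have "chain N (r (Suc i)) N = chain N (r i) N"
      using step[of i N] Suc.prems N(1) r chain_arr[OF subdivided[of i], of N] by simp
    then show ?case using Suc by simp
  qed simp
  have p: "r 0 t = p t" and q: "r N t = q t" if "t \<in> {0..1}" for t
    using that h(2) N(1) by (auto simp: r_def)
  have "transport p = chain N p N"
    by (intro transport_eq_chain subdivided_cong[OF p subdivided]) auto
  also have "\<dots> = chain N (r 0) N" by (rule chain_cong) (use p N(1) in auto)
  also have "\<dots> = chain N (r N) N" using eq[of N] by simp
  also have "\<dots> = chain N q N" by (rule chain_cong) (use q N(1) in auto)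
  also have "\<dots> = transport q"
    by (intro transport_eq_chain[symmetric] subdivided_cong[OF q subdivided]) auto
  finally show ?thesis .
qed

text \<open>If both paths are cut into \<open>N\<close> pieces, then their join is cut into \<open>2 * N\<close> pieces, the first \<open>N\<close>
  of which belong to the first path.\<close>

lemma transport_path_join:
  assumes "pathin X p" "pathin X q" "p 1 = q 0"
  shows "transport (path_join p q) = Comp G (transport p) (transport q)"
proof -
  obtain M M' where M: "subdivided M p" "subdivided M' q" using ex_subdivided assms by metis
  define N where "N = M * M'"
  have N: "subdivided N p" "subdivided N q"
    using subdivided_mult[OF M(1), of M'] subdivided_mult[OF M(2), of M] M by (auto simp: N_def mult.commute subdivided_def)
  have N0: "0 < N" using N by (simp add: subdivided_def)
  let ?j = "path_join p q"
  have first: "?j t = p (2 * t)" if "t \<le> 1/2" for t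
    using that by (simp add: path_join_def)
  have second: "?j t = q (2 * t - 1)" if "1/2 \<le> t" for t
  proof (cases "t = 1/2")
    case True
    show ?thesis unfolding True using assms(3) by (simp add: path_join_def)
  qed (use that in \<open>simp add: path_join_def\<close>)
  have "subdivided (2 * N) ?j" unfolding subdivided_def
  proof (intro conjI allI impI)
    fix k assume k: "k < 2 * N"
    show "\<exists>U\<in>\<U>. ?j ` {real k / real (2 * N)..real (Suc k) / real (2 * N)} \<subseteq> U"
    proof (cases "k < N")
      case True
      obtain U where U: "U \<in> \<U>" "\<And>t. real k / N \<le> t \<Longrightarrow> t \<le> real (Suc k) / N \<Longrightarrow> p t \<in> U"
        using subdividedE[OF N(1) True] by blast
      have "?j t \<in> U" if t: "real k / real (2 * N) \<le> t" "t \<le> real (Suc k) / real (2 * N)" for t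
      proof -
        have "real (Suc k) \<le> N" using True by simp
        then have "real (Suc k) / real (2 * N) \<le> 1/2" using N0 by (simp add: field_simps)
        then have "t \<le> 1/2" using t by linarith
        moreover have "real k / N \<le> 2 * t" "2 * t \<le> real (Suc k) / N"
          using t N0 by (simp_all add: field_simps)
        ultimately show ?thesis using U(2) first by simp
      qed
      then show ?thesis using U(1) by (intro bexI[of _ U]) (auto simp del: of_nat_Suc)
    next
      case False
      define l where "l = k - N"
      have l: "k = N + l" "l < N" using False k by (auto simp: l_def)
      obtain U where U: "U \<in> \<U>" "\<And>t. real l / N \<le> t \<Longrightarrow> t \<le> real (Suc l) / N \<Longrightarrow> q t \<in> U"
        using subdividedE[OF N(2) l(2)] by blast
      have "?j t \<in> U" if t: "real k / real (2 * N) \<le> t" "t \<le> real (Suc k) / real (2 * N)" for t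
      proof -
        have "1/2 \<le> real k / real (2 * N)" using N0 l by (simp add: field_simps)
        then have "1/2 \<le> t" using t by linarith
        moreover have "real l / N \<le> 2 * t - 1" "2 * t - 1 \<le> real (Suc l) / N"
          using t N0 by (simp_all add: field_simps l)
        ultimately show ?thesis using U(2) second by simp
      qed
      then show ?thesis using U(1) by (intro bexI[of _ U]) (auto simp del: of_nat_Suc)
    qed
  qed (use N0 in simp)
  then have "transport ?j = chain (2 * N) ?j (2 * N)" by (rule transport_eq_chain)
  also have "\<dots> = Comp G (chain N p N) (chain N q N)"
  proof -
    have a: "chain (2 * N) ?j k = chain N p k" if "k \<le> N" for k
      using that
    proof (induction k)
      case (Suc k)
      have eq: "2 * (real k / real (2 * N)) = real k / N" "2 * (real (Suc k) / real (2 * N)) = real (Suc k) / N"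
        using N0 by (simp_all add: field_simps)
      have "?j (real k / real (2 * N)) = p (real k / N)" "?j (real (Suc k) / real (2 * N)) = p (real (Suc k) / N)"
        unfolding eq[symmetric] using Suc.prems N0 by (intro first; simp add: field_simps)+
      then show ?case using Suc by (simp del: of_nat_Suc of_nat_mult)
    qed (use first[of 0] in simp)
    have "chain (2 * N) ?j (N + k) = Comp G (chain N p N) (chain N q k)" if "k \<le> N" for k
      using that
    proof (induction k)
      case 0
      have "Cod G (chain N p N) = \<phi> (q 0)" "chain N p N \<in> Arr G"
        using chain_arr[OF N(1), of N] N0 assms(3) by auto
      then show ?case using a[of N] by simp
    next
      case (Suc k)
      have eq: "2 * (real (N + k) / real (2 * N)) - 1 = real k / N"
        "2 * (real (Suc (N + k)) / real (2 * N)) - 1 = real (Suc k) / N" using N0 by (auto simp: field_simps)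
      have "?j (real (N + k) / real (2 * N)) = q (real k / N)" "?j (real (Suc (N + k)) / real (2 * N)) = q (real (Suc k) / N)"
        unfolding eq[symmetric] using N0 by (intro second; simp add: field_simps)+
      then have "chain (2 * N) ?j (N + Suc k) =
          Comp G (Comp G (chain N p N) (chain N q k)) (\<tau> (q (real k / N)) (q (real (Suc k) / N)))"
        using Suc by (simp del: of_nat_Suc of_nat_mult of_nat_add)
      also have "\<dots> = Comp G (chain N p N) (chain N q (Suc k))"
      proof -
        obtain U where "U \<in> \<U>" "\<And>t. real k / N \<le> t \<Longrightarrow> t \<le> real (Suc k) / N \<Longrightarrow> q t \<in> U"
          using subdividedE[OF N(2), of k] Suc.prems by auto
        then have "\<tau> (q (real k / N)) (q (real (Suc k) / N)) \<in> Arr G"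
            "Dom G (\<tau> (q (real k / N)) (q (real (Suc k) / N))) = \<phi> (q (real k / N))"
          using transport_arr[of U "q (real k / N)" "q (real (Suc k) / N)"]
          by (simp_all add: divide_right_mono)
        then show ?thesis
          using chain_arr[OF N(1), of N] chain_arr[OF N(2), of k] Suc.prems N0 assms(3)
          by (simp add: G.comp_assoc del: of_nat_Suc)
      qed
      finally show ?case .
    qed
    from this[of N] show ?thesis by (simp add: mult_2)
  qed
  finally show ?thesis by (simp add: transport_eq_chain[OF N(1)] transport_eq_chain[OF N(2)])
qed

lemma transport_in_chart:
  assumes "U \<in> \<U>" "p ` {0..1} \<subseteq> U"
  shows "transport p = \<tau> (p 0) (p 1)"
proof -
  have "subdivided 1 p" using assms by (auto simp: subdivided_def)
  then have "transport p = chain 1 p (Suc 0)" using transport_eq_chain by simp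
  also have "\<dots> = \<tau> (p 0) (p 1)"
    using transport_arr[OF assms(1), of "p 0" "p 1"] assms(2) by (simp add: image_subset_iff)
  finally show ?thesis .
qed

definition transport_functor :: "('x, 'x path_arrow, 'o, 'm) gpd_map" where
  "transport_functor = \<lparr>onObj = \<phi>, onArr = (\<lambda>(a, c, b). transport (SOME p. p \<in> c))\<rparr>"

lemma onObj_transport_functor [simp]: "onObj transport_functor = \<phi>"
  by (simp add: transport_functor_def)

lemma transport_functor_path_class:
  assumes "pathin X p"
  shows "onArr transport_functor (path_class X p) = transport p"
proof -
  have "path_homotopic X p (SOME q. path_homotopic X p q)"
    by (rule someI[of _ p]) (rule path_homotopic_refl[OF assms])
  then show ?thesis
    using transport_homotopic by (simp add: transport_functor_def path_class_def)
qed

lemma transport_arrow: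
  assumes "pathin X p"
  shows "transport p \<in> Arr G \<and> Dom G (transport p) = \<phi> (p 0) \<and> Cod G (transport p) = \<phi> (p 1)"
proof -
  obtain N where N: "subdivided N p" using ex_subdivided assms by blast
  then have "0 < N" by (simp add: subdivided_def)
  then show ?thesis using chain_arr[OF N, of N] transport_eq_chain[OF N] by simp
qed

lemma groupoid_functor_transport: "groupoid_functor (fundamental_groupoid X) G transport_functor"
proof -
  interpret P: groupoid "fundamental_groupoid X" by (rule groupoid_fundamental)
  show ?thesis
  proof
    fix f assume "f \<in> Arr (fundamental_groupoid X)"
    then obtain p where "pathin X p" "f = path_class X p" by (rule fundamental_groupoid_ArrE)
    then show "onArr transport_functor f \<in> Arr G"
      "Dom G (onArr transport_functor f) = onObj transport_functor (Dom (fundamental_groupoid X) f)"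
      "Cod G (onArr transport_functor f) = onObj transport_functor (Cod (fundamental_groupoid X) f)"
      using transport_arrow by (simp_all add: transport_functor_path_class)
  next
    fix a assume "a \<in> Obj (fundamental_groupoid X)"
    then have a: "a \<in> topspace X" by simp
    then obtain U where U: "U \<in> \<U>" "a \<in> U" using open_cover by blast
    show "onObj transport_functor a \<in> Obj G" using base_obj a by simp
    show "onArr transport_functor (Ident (fundamental_groupoid X) a) = Ident G (onObj transport_functor a)"
      using a transport_in_chart[OF U(1), of "\<lambda>_. a"] U transport_refl[OF U]
      by (simp add: transport_functor_path_class image_subset_iff)
  next
    fix f g let ?C = "fundamental_groupoid X"
    assume "f \<in> Arr ?C" "g \<in> Arr ?C" "Cod ?C f = Dom ?C g"
    then obtain p q where "pathin X p" "f = path_class X p" "pathin X q" "g = path_class X q" "p 1 = q 0"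
      by (elim fundamental_groupoid_ArrE) auto
    then show "onArr transport_functor (Comp ?C f g) = Comp G (onArr transport_functor f) (onArr transport_functor g)"
      by (simp add: transport_functor_path_class pathin_path_join transport_path_join)
  qed
qed

text \<open>A property of arrows that holds in each member of the cover and is stable under composition holds
  everywhere, since a subdivided path is the composite of its pieces.\<close>

lemma path_class_induct:
  assumes p: "pathin X p"
    and chart: "\<And>U q. \<lbrakk>U \<in> \<U>; pathin X q; q ` {0..1} \<subseteq> U\<rbrakk> \<Longrightarrow> Q (path_class X q)"
    and comp: "\<And>f g. \<lbrakk>f \<in> Arr (fundamental_groupoid X); g \<in> Arr (fundamental_groupoid X);
      Cod (fundamental_groupoid X) f = Dom (fundamental_groupoid X) g; Q f; Q g\<rbrakk>
      \<Longrightarrow> Q (Comp (fundamental_groupoid X) f g)"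
  shows "Q (path_class X p)"
proof -
  obtain N where N: "subdivided N p" using ex_subdivided[OF p] by blast
  then have N0: "0 < N" by (simp add: subdivided_def)
  let ?a = "\<lambda>k t. t * (real k / N)" and ?b = "\<lambda>k t. (real k + t) / N"
  have b: "continuous_on {0..1} (?b k)" "?b k ` {0..1} \<subseteq> {real k / N .. real (Suc k) / N}" for k
    using N0 by (auto intro!: continuous_intros divide_right_mono)
  have a: "continuous_on {0..1} (?a k)" for k by (intro continuous_intros)
  have a_range: "?a k ` {0..1} \<subseteq> {0..1}" if "k \<le> N" for k
  proof -
    have "0 \<le> real k / N" "real k / N \<le> 1" using that N0 by simp_all
    then have "0 \<le> ?a k t \<and> ?a k t \<le> 1" if "0 \<le> t" "t \<le> 1" for t
      using that by (meson mult_le_one mult_nonneg_nonneg)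
    then show ?thesis by (simp add: image_subset_iff)
  qed
  have b_range: "?b k ` {0..1} \<subseteq> {0..1}" if "k < N" for k
  proof -
    have "0 \<le> real k / N" "real (Suc k) / N \<le> 1" using that N0 by simp_all
    then have "{real k / N .. real (Suc k) / N} \<subseteq> {0..1}" by (auto simp del: of_nat_Suc)
    then show ?thesis using b(2)[of k] by (rule order_trans[rotated])
  qed
  have "Q (path_class X (p \<circ> ?a k))" if "k \<le> N" for k
    using that
  proof (induction k)
    case 0
    obtain U where U: "U \<in> \<U>" "p ` {real 0 / N .. real (Suc 0) / N} \<subseteq> U"
      using N N0 unfolding subdivided_def by blast
    have "(p \<circ> ?a 0) ` {0..1} \<subseteq> U" using U(2) by auto
    then show ?case
      by (rule chart[OF U(1) pathin_reparam[OF p a a_range[OF 0]]])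
  next
    case (Suc k)
    have eq: "Comp (fundamental_groupoid X) (path_class X (p \<circ> ?a k)) (path_class X (p \<circ> ?b k)) = path_class X (p \<circ> ?a (Suc k))"
      by (rule Comp_path_class_reparam[OF p a a_range b(1) b_range _ a a_range])
        (use Suc.prems in \<open>simp_all add: add.commute\<close>)
    obtain U where U: "U \<in> \<U>" "p ` {real k / N .. real (Suc k) / N} \<subseteq> U"
      using N Suc.prems unfolding subdivided_def by (metis Suc_le_lessD)
    have "(p \<circ> ?b k) ` {0..1} \<subseteq> p ` {real k / N .. real (Suc k) / N}"
      using image_mono[OF b(2)[of k], of p] by (simp only: image_comp)
    then have "Q (path_class X (p \<circ> ?b k))"
      using U Suc.prems by (intro chart[OF U(1)] pathin_reparam[OF p b(1) b_range]) auto
    moreover have "pathin X (p \<circ> ?a k)" "pathin X (p \<circ> ?b k)"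
      using Suc.prems by (intro pathin_reparam[OF p] a a_range b(1) b_range; simp)+
    moreover have "Q (path_class X (p \<circ> ?a k))" by (rule Suc.IH) (use Suc.prems in simp)
    ultimately show ?case unfolding eq[symmetric] by (intro comp) simp_all
  qed
  from this[of N] show ?thesis using N0 by (simp add: comp_def)
qed

end

section \<open>Lifting through the quotient by a lattice of translations\<close>

text \<open>The number \<open>\<rho>\<close> separates the points of an orbit from each other; it measures how far local lifts
  reach.\<close>

locale translation_quotient =
  fixes L :: "'v::real_normed_vector set" and S :: "('v \<times> 'v) set" and \<rho> :: real
  assumes zero_mem: "0 \<in> L" and diff_mem: "\<lbrakk>m \<in> L; m' \<in> L\<rbrakk> \<Longrightarrow> m - m' \<in> L"
    and \<rho>_pos: "0 < \<rho>" and separated: "\<lbrakk>m \<in> L; m \<noteq> 0\<rbrakk> \<Longrightarrow> \<rho> \<le> norm m"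
    and invariant: "\<lbrakk>z \<in> S; m \<in> L\<rbrakk> \<Longrightarrow> z + (m, 0) \<in> S"
begin

abbreviation "X \<equiv> top_of_set S"
abbreviation "Y \<equiv> quotient_topology X (orbit L)"

lemma minus_mem: "m \<in> L \<Longrightarrow> - m \<in> L"
  using diff_mem[OF zero_mem] by simp

lemma add_mem: "\<lbrakk>m \<in> L; m' \<in> L\<rbrakk> \<Longrightarrow> m + m' \<in> L"
  using diff_mem[of m "- m'"] minus_mem by simp

lemma orbit_eq_iff: "orbit L z = orbit L z' \<longleftrightarrow> (\<exists>m\<in>L. z' = z + (m, 0))"
proof
  assume "orbit L z = orbit L z'"
  moreover have "z' \<in> orbit L z'" using zero_mem by (auto simp: orbit_def zero_prod_def[symmetric] intro!: exI[of _ 0])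
  ultimately have "z' \<in> orbit L z" by simp
  then show "\<exists>m\<in>L. z' = z + (m, 0)" by (auto simp: orbit_def)
next
  assume "\<exists>m\<in>L. z' = z + (m, 0)"
  then obtain m where m: "m \<in> L" "z' = z + (m, 0)" by blast
  have "z + (k, 0) \<in> orbit L z'" if "k \<in> L" for k
    using diff_mem[OF that m(1)] unfolding orbit_def m(2) by (force intro!: exI[of _ "k - m"])
  moreover have "z' + (k, 0) \<in> orbit L z" if "k \<in> L" for k
    using add_mem[OF m(1) that] unfolding orbit_def m(2) by (force intro!: exI[of _ "m + k"])
  ultimately show "orbit L z = orbit L z'" unfolding orbit_def[of L z] orbit_def[of L z'] by (force simp: orbit_def)
qed

lemma orbit_eq_near:
  assumes "orbit L z = orbit L z'" "dist z z' < \<rho>"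
  shows "z = z'"
proof -
  obtain m where m: "m \<in> L" "z' = z + (m, 0)" using assms(1) by (auto simp: orbit_eq_iff)
  have "norm m < \<rho>" using assms(2) by (simp add: m dist_norm norm_Pair)
  then have "m = 0" using separated[OF m(1)] by force
  then show ?thesis using m by (simp add: zero_prod_def[symmetric])
qed

lemma topspace_Y: "topspace Y = orbit L ` S"
  by (simp add: topspace_quotient_topology)

lemma continuous_orbit: "continuous_map X Y (orbit L)"
  by (rule quotient_imp_continuous_map[OF quotient_map_quotient_topology])

lemma open_orbit:
  assumes "openin X U"
  shows "openin Y (orbit L ` U)"
proof -
  obtain V where V: "open V" "U = S \<inter> V" using assms by (auto simp: openin_open)
  have "{z \<in> topspace X. orbit L z \<in> orbit L ` U} = S \<inter> (\<Union>m\<in>L. (+) (m, 0) ` V)"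
  proof (intro equalityI subsetI)
    fix z assume "z \<in> {z \<in> topspace X. orbit L z \<in> orbit L ` U}"
    then obtain u where u: "z \<in> S" "u \<in> U" "orbit L z = orbit L u" by auto
    then obtain m where "m \<in> L" "z = u + (m, 0)" using orbit_eq_iff[of u z] by auto
    then show "z \<in> S \<inter> (\<Union>m\<in>L. (+) (m, 0) ` V)" using u V(2) by (auto simp: add.commute)
  next
    fix z assume "z \<in> S \<inter> (\<Union>m\<in>L. (+) (m, 0) ` V)"
    then obtain m v where m: "z \<in> S" "m \<in> L" "v \<in> V" "z = v + (m, 0)" by (auto simp: add.commute)
    have "z + (- m, 0) \<in> S" using invariant minus_mem m by blast
    then have "v \<in> S" using m(4) by (simp add: add.assoc zero_prod_def[symmetric])
    moreover have "orbit L v = orbit L z" using m orbit_eq_iff by blast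
    ultimately show "z \<in> {z \<in> topspace X. orbit L z \<in> orbit L ` U}" using m V(2) by auto
  qed
  moreover have "open (\<Union>m\<in>L. (+) (m, 0) ` V)" using V(1) by (intro open_UN ballI open_translation)
  ultimately show ?thesis
    using openin_subset[OF assms] by (auto simp: openin_quotient_topology openin_open)
qed

text \<open>The representative of \<open>q\<close> near \<open>z\<close>. There is at most one within \<open>\<rho> / 2\<close>, as two of them would be
  closer to each other than \<open>\<rho>\<close>.\<close>

definition nearest_lift :: "'v \<times> 'v \<Rightarrow> ('v \<times> 'v) set \<Rightarrow> 'v \<times> 'v" where
  "nearest_lift z q = (SOME z'. z' \<in> S \<and> orbit L z' = q \<and> dist z z' < \<rho> / 2)"

lemma nearest_lift_eq:
  assumes "z' \<in> S" "orbit L z' = q" "dist z z' < \<rho> / 2"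
  shows "nearest_lift z q = z'"
  unfolding nearest_lift_def
proof (rule some_equality)
  fix w assume w: "w \<in> S \<and> orbit L w = q \<and> dist z w < \<rho> / 2"
  have "dist w z' < \<rho>" using w assms(3) dist_triangle[of w z' z] by (simp add: dist_commute)
  then show "w = z'" using w assms by (intro orbit_eq_near) auto
qed (use assms in auto)

text \<open>Images of open sets in the quotient are open. Hence for nearby arguments there is a
  representative close to the nearest lift at \<open>k\<close>, and being close it is the nearest lift.\<close>

lemma continuous_on_nearest_lift:
  fixes K :: "'k::metric_space set"
  assumes z: "continuous_on K z" and g: "continuous_map (top_of_set K) Y g"
    and near: "\<And>k. k \<in> K \<Longrightarrow> \<exists>z'\<in>S. orbit L z' = g k \<and> dist (z k) z' < \<rho> / 2"
  shows "continuous_on K (\<lambda>k. nearest_lift (z k) (g k))"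
  unfolding continuous_on_iff
proof (intro ballI allI impI)
  fix k e assume k: "k \<in> K" and e: "0 < (e::real)"
  obtain z' where z': "z' \<in> S" "orbit L z' = g k" "dist (z k) z' < \<rho> / 2" using near[OF k] by blast
  define e' where "e' = min e ((\<rho> / 2 - dist (z k) z') / 2)"
  have e': "0 < e'" "e' \<le> e" using e z' by (simp_all add: e'_def)
  have "e' \<le> (\<rho> / 2 - dist (z k) z') / 2" unfolding e'_def by (rule min.cobounded2)
  then have e'2: "2 * e' \<le> \<rho> / 2 - dist (z k) z'" by simp
  have "openin Y (orbit L ` (S \<inter> ball z' e'))" by (intro open_orbit) auto
  then have "openin (top_of_set K) {x \<in> K. g x \<in> orbit L ` (S \<inter> ball z' e')}"
    using g by (auto simp: continuous_map_def)
  moreover have "k \<in> {x \<in> K. g x \<in> orbit L ` (S \<inter> ball z' e')}"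
    using k z' e' by (auto intro!: image_eqI[of _ _ z'])
  ultimately have "\<exists>d>0. \<forall>x\<in>K. dist x k < d \<longrightarrow> x \<in> {x \<in> K. g x \<in> orbit L ` (S \<inter> ball z' e')}"
    unfolding openin_euclidean_subtopology_iff by blast
  then obtain d where d: "0 < d" "\<And>x. \<lbrakk>x \<in> K; dist x k < d\<rbrakk> \<Longrightarrow> g x \<in> orbit L ` (S \<inter> ball z' e')"
    by (smt (verit, best) mem_Collect_eq)
  obtain d' where d': "0 < d'" "\<And>x. \<lbrakk>x \<in> K; dist x k < d'\<rbrakk> \<Longrightarrow> dist (z x) (z k) < e'"
    using z[unfolded continuous_on_iff] k e'(1) by blast
  have "dist (nearest_lift (z x) (g x)) (nearest_lift (z k) (g k)) < e" if x: "x \<in> K" "dist x k < min d d'" for x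
  proof -
    have "g x \<in> orbit L ` (S \<inter> ball z' e')" using d(2)[of x] x by simp
    then obtain y where "y \<in> S \<inter> ball z' e'" "g x = orbit L y" by blast
    then have y: "y \<in> S" "dist z' y < e'" "g x = orbit L y" by (simp_all only: Int_iff mem_ball)
    have "dist (z x) y \<le> dist (z x) (z k) + dist (z k) z' + dist z' y"
      using dist_triangle[of "z x" y "z k"] dist_triangle[of "z k" y z'] by linarith
    then have "dist (z x) y < \<rho> / 2" using d'(2)[of x] x y(2) e'2 by auto
    then have "nearest_lift (z x) (g x) = y" using y by (intro nearest_lift_eq) auto
    moreover have "nearest_lift (z k) (g k) = z'" using z' by (intro nearest_lift_eq) auto
    ultimately show ?thesis using y(2) e'(2) by (simp add: dist_commute)
  qed
  then show "\<exists>d>0. \<forall>x'\<in>K. dist x' k < d \<longrightarrow> dist (nearest_lift (z x') (g x')) (nearest_lift (z k) (g k)) < e"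
    using d(1) d'(1) by (intro exI[of _ "min d d'"]) auto
qed

text \<open>The value at \<open>k\<close> is found by walking from \<open>k0\<close> to \<open>k\<close> in \<open>n\<close> equal steps and passing to the nearest
  lift in each step. As \<open>K\<close> is bounded, one \<open>n\<close> makes the steps short enough for all \<open>k\<close>, so that
  continuity follows by induction on the number of steps, without any gluing.\<close>

lemma lift_exists:
  fixes K :: "'k::real_normed_vector set"
  assumes K: "compact K" "convex K" "k0 \<in> K" and h: "continuous_map (top_of_set K) Y h"
    and z0: "z0 \<in> S" "orbit L z0 = h k0"
  obtains f where "continuous_on K f" "f ` K \<subseteq> S" "\<And>k. k \<in> K \<Longrightarrow> orbit L (f k) = h k" "f k0 = z0"
proof -
  \<comment> \<open>two points of the same ball of radius \<open>\<rho> / 4\<close> are closer than \<open>\<rho> / 2\<close>, as required for nearest lifts\<close>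
  define \<U> where "\<U> = {orbit L ` (S \<inter> ball z (\<rho> / 4)) | z. z \<in> S}"
  have "openin Y U" if "U \<in> \<U>" for U
  proof -
    obtain z where "U = orbit L ` (S \<inter> ball z (\<rho> / 4))" using \<open>U \<in> \<U>\<close> unfolding \<U>_def by blast
    then show ?thesis using open_orbit[of "S \<inter> ball z (\<rho> / 4)"] by auto
  qed
  moreover have "topspace Y \<subseteq> \<Union>\<U>"
  proof
    fix q assume "q \<in> topspace Y"
    then obtain z where z: "z \<in> S" "q = orbit L z" unfolding topspace_Y by blast
    have "z \<in> S \<inter> ball z (\<rho> / 4)" using z(1) \<rho>_pos by simp
    then have "q \<in> orbit L ` (S \<inter> ball z (\<rho> / 4))" using z(2) by blast
    then show "q \<in> \<Union>\<U>" using z(1) unfolding \<U>_def by blast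
  qed
  ultimately obtain e where e: "e > 0" "\<And>T. \<lbrakk>T \<subseteq> K; T \<noteq> {}; diameter T < e\<rbrakk> \<Longrightarrow> \<exists>U\<in>\<U>. h ` T \<subseteq> U"
    using Lebesgue_number_pullback[OF K(1) h, of \<U>] by metis
  have step: "\<exists>y'\<in>S. orbit L y' = h k' \<and> dist y y' < \<rho> / 2"
    if that': "k \<in> K" "k' \<in> K" "dist k k' < e" "orbit L y = h k" for k k' y
  proof -
    have "diameter {k, k'} \<le> dist k k'"
      by (rule diameter_le) (auto simp: dist_norm norm_minus_commute)
    then have "\<exists>U\<in>\<U>. h ` {k, k'} \<subseteq> U" using that'(1-3) by (intro e(2)) auto
    then obtain U where U: "U \<in> \<U>" "h ` {k, k'} \<subseteq> U" by blast
    then obtain z where "z \<in> S" "{h k, h k'} \<subseteq> orbit L ` (S \<inter> ball z (\<rho> / 4))"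
      unfolding \<U>_def by blast
    then have "h k \<in> orbit L ` (S \<inter> ball z (\<rho> / 4))" "h k' \<in> orbit L ` (S \<inter> ball z (\<rho> / 4))"
      by simp_all
    then obtain w w' where "w \<in> S \<inter> ball z (\<rho> / 4)" "h k = orbit L w"
        "w' \<in> S \<inter> ball z (\<rho> / 4)" "h k' = orbit L w'"
      by blast
    then have w: "w \<in> S" "dist z w < \<rho> / 4" "orbit L w = h k"
       and w': "w' \<in> S" "dist z w' < \<rho> / 4" "orbit L w' = h k'" by (simp_all only: Int_iff mem_ball)
    obtain m where m: "m \<in> L" "y = w + (m, 0)" using w(3) that'(4) orbit_eq_iff[of w y] by auto
    have "dist y (w' + (m, 0)) = dist w w'" by (simp add: m(2))
    also have "\<dots> < \<rho> / 2" using w(2) w'(2) dist_triangle[of w w' z] by (simp add: dist_commute)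
    finally have "dist y (w' + (m, 0)) < \<rho> / 2" .
    moreover have "w' + (m, 0) \<in> S" using w'(1) m(1) by (rule invariant)
    moreover have "orbit L (w' + (m, 0)) = h k'" using w'(3) m(1) orbit_eq_iff by blast
    ultimately show ?thesis by blast
  qed
  obtain B where "\<forall>k\<in>K. dist k0 k \<le> B"
    using compact_imp_bounded[OF K(1)] bounded_any_center[of K k0] by blast
  then have B: "norm (k - k0) \<le> B" if "k \<in> K" for k
  proof -
    have "dist k0 k \<le> B" using \<open>\<forall>k\<in>K. dist k0 k \<le> B\<close> that by blast
    then show ?thesis by (simp only: dist_norm norm_minus_commute[of k k0])
  qed
  obtain n :: nat where n: "\<bar>B\<bar> / e < n" using reals_Archimedean2 by blast
  have "0 \<le> \<bar>B\<bar> / e" using e(1) by simp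
  then have n0: "0 < real n" using n by linarith
  define c where "c j k = k0 + (real j / n) *\<^sub>R (k - k0)" for j k
  have cK: "c j k \<in> K" if "k \<in> K" "j \<le> n" for j k
  proof -
    have "c j k = (1 - real j / n) *\<^sub>R k0 + (real j / n) *\<^sub>R k" by (simp add: c_def algebra_simps)
    then show ?thesis using that K(3) n0 by (simp add: convexD_alt[OF K(2)])
  qed
  have dist_c: "dist (c j k) (c (Suc j) k) < e" if "k \<in> K" for j k
  proof -
    have "c (Suc j) k - c j k = (1 / n) *\<^sub>R (k - k0)"
      by (simp add: c_def scaleR_diff_left[symmetric] diff_divide_distrib[symmetric])
    then have "dist (c (Suc j) k) (c j k) = norm ((1 / n) *\<^sub>R (k - k0))"
      by (simp only: dist_norm)
    also have "\<dots> = norm (k - k0) / n" by simp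
    finally have "dist (c j k) (c (Suc j) k) = norm (k - k0) / n" by (simp only: dist_commute)
    also have "\<dots> \<le> \<bar>B\<bar> / n" using B[OF that] n0 by (simp add: divide_right_mono)
    also have "\<dots> < e" using n n0 e(1) by (simp add: field_simps)
    finally show ?thesis .
  qed
  define s where "s = rec_nat (\<lambda>_. z0) (\<lambda>j f k. nearest_lift (f k) (h (c (Suc j) k)))"
  have s_simps: "s 0 k = z0" "s (Suc j) k = nearest_lift (s j k) (h (c (Suc j) k))" for j k
    by (simp_all add: s_def)
  have inv: "continuous_on K (s j) \<and> (\<forall>k\<in>K. s j k \<in> S \<and> orbit L (s j k) = h (c j k)) \<and> s j k0 = z0"
    if "j \<le> n" for j
    using that
  proof (induction j)
    case 0
    then show ?case using z0 by (simp add: s_simps[abs_def] c_def)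
  next
    case (Suc j)
    then have IH: "continuous_on K (s j)" "\<And>k. k \<in> K \<Longrightarrow> orbit L (s j k) = h (c j k)" "s j k0 = z0" by auto
    have near: "\<exists>z'\<in>S. orbit L z' = h (c (Suc j) k) \<and> dist (s j k) z' < \<rho> / 2" if "k \<in> K" for k
      using step[OF cK cK dist_c IH(2)] that Suc.prems by simp
    have "continuous_on K (c (Suc j))" unfolding c_def by (intro continuous_intros)
    then have "continuous_map (top_of_set K) (top_of_set K) (c (Suc j))"
      using cK[of _ "Suc j"] Suc.prems by auto
    then have "continuous_map (top_of_set K) Y (\<lambda>k. h (c (Suc j) k))"
      using continuous_map_compose[OF _ h, unfolded comp_def] by blast
    then have "continuous_on K (s (Suc j))"
      unfolding s_simps[abs_def] using IH(1) near by (intro continuous_on_nearest_lift)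
    moreover have "s (Suc j) k \<in> S \<and> orbit L (s (Suc j) k) = h (c (Suc j) k)" if k: "k \<in> K" for k
    proof -
      obtain z' where "z' \<in> S" "orbit L z' = h (c (Suc j) k)" "dist (s j k) z' < \<rho> / 2"
        using near[OF k] by blast
      then show ?thesis using nearest_lift_eq[of z'] by (simp add: s_simps)
    qed
    moreover have "s (Suc j) k0 = z0"
    proof -
      have "nearest_lift z0 (h k0) = z0" using z0 \<rho>_pos by (intro nearest_lift_eq) simp_all
      moreover have "c (Suc j) k0 = k0" by (simp add: c_def)
      ultimately show ?thesis using IH(3) by (simp only: s_simps)
    qed
    ultimately show ?case by blast
  qed
  show thesis
    using inv[of n] n0 by (intro that[of "s n"]) (auto simp: c_def)
qed

text \<open>The distance of two lifts is \<open>0\<close> or at least \<open>\<rho>\<close>, and by connectedness it cannot jump.\<close>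

lemma lift_unique:
  fixes f g :: "'k::topological_space \<Rightarrow> 'v \<times> 'v"
  assumes "connected K" "continuous_on K f" "continuous_on K g"
    and "\<And>k. k \<in> K \<Longrightarrow> orbit L (f k) = orbit L (g k)" and "k0 \<in> K" "f k0 = g k0" "k \<in> K"
  shows "f k = g k"
proof -
  let ?d = "\<lambda>k. dist (f k) (g k)"
  have gap: "?d x = 0 \<or> \<rho> \<le> ?d x" if "x \<in> K" for x
    using orbit_eq_near[OF assms(4)[OF that]] by force
  have "connected (?d ` K)"
    using assms(1-3) by (intro connected_continuous_image continuous_intros)
  moreover have "0 \<in> ?d ` K" "?d k \<in> ?d ` K"
    using assms(5-7) by (auto intro!: image_eqI[of _ _ k0])
  ultimately have "{0..?d k} \<subseteq> ?d ` K"
    by (intro connected_contains_Icc)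
  then have False if "\<rho> \<le> ?d k"
  proof -
    have "\<rho> / 2 \<in> ?d ` K" using \<open>{0..?d k} \<subseteq> ?d ` K\<close> that \<rho>_pos by auto
    then obtain x where "x \<in> K" "\<rho> / 2 = ?d x" by blast
    then show False using gap[of x] \<rho>_pos by auto
  qed
  then show ?thesis using gap[OF assms(7)] by auto
qed

lemma path_lift:
  assumes "pathin Y q" "z0 \<in> S" "orbit L z0 = q 0"
  obtains p where "pathin X p" "p 0 = z0" "path_class Y (orbit L \<circ> p) = path_class Y q"
    "\<And>t. t \<in> {0..1} \<Longrightarrow> orbit L (p t) = q t"
proof -
  obtain p where p: "continuous_on {0..1} p" "p ` {0..1} \<subseteq> S" "\<And>t. t \<in> {0..1} \<Longrightarrow> orbit L (p t) = q t" "p 0 = z0"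
    using lift_exists[of "{0..1::real}" 0 q z0] assms by (auto simp: pathin_def)
  have "path_homotopic Y q (orbit L \<circ> p)"
    using assms(1) p(3) by (intro path_homotopic_cong) auto
  then have "path_class Y (orbit L \<circ> p) = path_class Y q" using path_class_eqI by metis
  moreover have "pathin X p" using p by (auto simp: pathin_def)
  ultimately show thesis using that p by blast
qed

text \<open>By uniqueness of lifts the four sides of the lifted homotopy are \<open>p\<close>, \<open>q\<close> and two constant paths.
  In particular \<open>p\<close> and \<open>q\<close> end at the same point.\<close>

lemma path_homotopic_lift:
  assumes p: "pathin X p" and q: "pathin X q" and start: "p 0 = q 0"
    and hom: "path_homotopic Y (orbit L \<circ> p) (orbit L \<circ> q)"
  shows "path_homotopic X p q"
proof -
  let ?I = "{0..1::real}"
  obtain h where h: "continuous_map (top_of_set (?I \<times> ?I)) Y h"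
     "\<forall>t\<in>?I. h (0, t) = orbit L (p t) \<and> h (1, t) = orbit L (q t)"
     "\<forall>s\<in>?I. h (s, 0) = orbit L (p 0) \<and> h (s, 1) = orbit L (p 1)"
    using hom unfolding path_homotopic_iff by auto
  have pS: "p t \<in> S" "q t \<in> S" if "t \<in> ?I" for t
    using p q that by (auto simp: pathin_def)
  have cp: "continuous_on ?I p" "continuous_on ?I q" using p q by (auto simp: pathin_def)
  obtain f where f: "continuous_on (?I \<times> ?I) f" "f ` (?I \<times> ?I) \<subseteq> S"
    "\<And>k. k \<in> ?I \<times> ?I \<Longrightarrow> orbit L (f k) = h k" "f (0, 0) = p 0"
  proof (rule lift_exists[of "?I \<times> ?I" "(0, 0)" h "p 0"])
    show "convex (?I \<times> ?I)" by (intro convex_Times) auto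
  qed (use h pS[of 0] in \<open>auto simp: compact_Times\<close>)
  have row: "continuous_on ?I (\<lambda>t. f (s, t))" "continuous_on ?I (\<lambda>t. f (t, s))" if "s \<in> ?I" for s
    using that by (auto intro!: continuous_on_compose2[OF f(1)] continuous_intros)
  have f0: "f (0, t) = p t" if "t \<in> ?I" for t
    by (rule lift_unique[of ?I "\<lambda>t. f (0, t)" p 0]) (use row(1)[of 0] cp f(3,4) h(2) that in auto)
  have left: "f (s, 0) = p 0" if "s \<in> ?I" for s
    by (rule lift_unique[of ?I "\<lambda>s. f (s, 0)" "\<lambda>_. p 0" 0]) (use row(2)[of 0] f(3,4) h(3) that in auto)
  have right: "f (s, 1) = p 1" if "s \<in> ?I" for s
    by (rule lift_unique[of ?I "\<lambda>s. f (s, 1)" "\<lambda>_. p 1" 0]) (use row(2)[of 1] f(3) f0 h(3) that in auto)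
  have f1: "f (1, t) = q t" if "t \<in> ?I" for t
    by (rule lift_unique[of ?I "\<lambda>t. f (1, t)" q 0]) (use row(1)[of 1] cp f(3) left start h(2) that in auto)
  show ?thesis unfolding path_homotopic_iff
    by (intro exI[of _ f]) (use f f0 f1 left right in auto)
qed

lemma faithful_orbit:
  "faithful_functor (fundamental_groupoid X) (fundamental_groupoid Y) (induced_functor Y (orbit L))"
proof -
  interpret groupoid_functor "fundamental_groupoid X" "fundamental_groupoid Y" "induced_functor Y (orbit L)"
    by (rule groupoid_functor_induced[OF continuous_orbit])
  show ?thesis
  proof
    fix f g
    let ?C = "fundamental_groupoid X" and ?F = "induced_functor Y (orbit L)"
    assume *: "f \<in> Arr ?C" "g \<in> Arr ?C" "Dom ?C f = Dom ?C g" "Cod ?C f = Cod ?C g" "onArr ?F f = onArr ?F g"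
    then obtain p q where p: "pathin X p" "f = path_class X p" "pathin X q" "g = path_class X q" "p 0 = q 0"
      by (elim fundamental_groupoid_ArrE) auto
    then have "path_homotopic Y (orbit L \<circ> p) (orbit L \<circ> q)"
      using *(5) continuous_orbit pathin_compose[OF p(1) continuous_orbit]
      by (simp add: induced_functor_path_class path_class_eq_iff)
    then show "f = g" using p by (auto intro!: path_class_eqI path_homotopic_lift)
  qed
qed

end

section \<open>Lattices and locally finite arrangements\<close>

lemma compact_coefficient_box:
  fixes B :: "'v::real_normed_vector set"
  assumes "finite B"
  shows "compact {(\<Sum>b\<in>B. c b *\<^sub>R b) | c. \<forall>b\<in>B. \<bar>c b\<bar> \<le> 1}"
  using assms
proof (induction B)
  case (insert b B)
  let ?S = "{(\<Sum>b\<in>B. c b *\<^sub>R b) | c. \<forall>b\<in>B. \<bar>c b\<bar> \<le> 1}"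
  have "compact ((\<lambda>t. t *\<^sub>R b) ` {-1..1::real})"
    by (intro compact_continuous_image continuous_intros) auto
  then have "compact {x + y | x y. x \<in> (\<lambda>t. t *\<^sub>R b) ` {-1..1::real} \<and> y \<in> ?S}"
    using insert.IH by (rule compact_sums)
  also have "{x + y | x y. x \<in> (\<lambda>t. t *\<^sub>R b) ` {-1..1::real} \<and> y \<in> ?S}
      = {(\<Sum>b\<in>insert b B. c b *\<^sub>R b) | c. \<forall>b\<in>insert b B. \<bar>c b\<bar> \<le> 1}"
  proof (intro equalityI subsetI)
    fix z assume "z \<in> {x + y | x y. x \<in> (\<lambda>t. t *\<^sub>R b) ` {-1..1::real} \<and> y \<in> ?S}"
    then obtain t c where z: "z = t *\<^sub>R b + (\<Sum>b\<in>B. c b *\<^sub>R b)" "\<bar>t\<bar> \<le> 1" "\<forall>b\<in>B. \<bar>c b\<bar> \<le> 1" by auto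
    have "(\<Sum>x\<in>B. (c(b := t)) x *\<^sub>R x) = (\<Sum>x\<in>B. c x *\<^sub>R x)"
      using insert.hyps by (intro sum.cong) auto
    then show "z \<in> {(\<Sum>b\<in>insert b B. c b *\<^sub>R b) | c. \<forall>b\<in>insert b B. \<bar>c b\<bar> \<le> 1}"
      using z insert.hyps by (intro CollectI exI[of _ "c(b := t)"]) auto
  next
    fix z assume "z \<in> {(\<Sum>b\<in>insert b B. c b *\<^sub>R b) | c. \<forall>b\<in>insert b B. \<bar>c b\<bar> \<le> 1}"
    then obtain c where c: "z = c b *\<^sub>R b + (\<Sum>b\<in>B. c b *\<^sub>R b)" "\<forall>b\<in>insert b B. \<bar>c b\<bar> \<le> 1"
      using insert.hyps by auto
    then have "c b \<in> {-1..1}" by (simp add: abs_le_iff)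
    then have "c b *\<^sub>R b \<in> (\<lambda>t. t *\<^sub>R b) ` {-1..1::real}" by (rule imageI)
    moreover have "(\<Sum>b\<in>B. c b *\<^sub>R b) \<in> ?S" using c(2) by blast
    ultimately show "z \<in> {x + y | x y. x \<in> (\<lambda>t. t *\<^sub>R b) ` {-1..1::real} \<and> y \<in> ?S}"
      using c(1) by blast
  qed
  finally show ?case .
qed simp

text \<open>The combinations in which some coefficient is \<open>1\<close> and all the others are at most \<open>1\<close> in absolute
  value form a compact set. It does not contain \<open>0\<close>, by independence, so its elements are bounded
  away from \<open>0\<close>. Every other combination is a multiple of one of these.\<close>

lemma independent_coefficient_bound:
  fixes B :: "'v::real_normed_vector set"
  assumes B: "finite B" "independent B"
  obtains d where "d > 0" "\<And>c b. b \<in> B \<Longrightarrow> d * \<bar>c b\<bar> \<le> norm (\<Sum>b\<in>B. c b *\<^sub>R b)"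
proof -
  define Box where "Box D = {(\<Sum>b\<in>D. c b *\<^sub>R b) | c. \<forall>b\<in>D. \<bar>c b\<bar> \<le> 1}" for D :: "'v set"
  define T where "T = (\<Union>b\<in>B. (+) b ` Box (B - {b}))"
  have "compact T" unfolding T_def Box_def
    using B(1) by (intro compact_UN compact_translation compact_coefficient_box) auto
  then have "closed T" by (rule compact_imp_closed)
  moreover have "0 \<notin> T"
  proof
    assume "0 \<in> T"
    then obtain b z where bz: "b \<in> B" "0 = b + z" "z \<in> Box (B - {b})" unfolding T_def by blast
    then obtain c where "z = (\<Sum>x\<in>B - {b}. c x *\<^sub>R x)" unfolding Box_def by blast
    then have b: "b \<in> B" "b + (\<Sum>x\<in>B - {b}. c x *\<^sub>R x) = 0" using bz by auto
    then have "b = - (\<Sum>x\<in>B - {b}. c x *\<^sub>R x)" by (simp add: eq_neg_iff_add_eq_0)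
    moreover have "(\<Sum>x\<in>B - {b}. c x *\<^sub>R x) \<in> span (B - {b})"
      by (intro span_sum span_scale span_base)
    ultimately have "b \<in> span (B - {b})" using span_neg by metis
    then show False using B(2) b(1) unfolding dependent_def by blast
  qed
  ultimately obtain d where "d > 0" "ball 0 d \<subseteq> - T"
    by (metis ComplI open_Compl openE)
  then have d: "d > 0" "\<And>x. x \<in> T \<Longrightarrow> d \<le> norm x" by force+
  show thesis
  proof (rule that[OF d(1)])
    fix c :: "'v \<Rightarrow> real" and b assume b: "b \<in> B"
    obtain b0 where b0: "b0 \<in> B" "\<And>x. x \<in> B \<Longrightarrow> \<bar>c x\<bar> \<le> \<bar>c b0\<bar>"
    proof -
      let ?m = "Max ((\<lambda>x. \<bar>c x\<bar>) ` B)"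
      have "?m \<in> (\<lambda>x. \<bar>c x\<bar>) ` B" using b B(1) by (intro Max_in) auto
      then obtain b0 where "b0 \<in> B" "\<bar>c b0\<bar> = ?m" by auto
      then show thesis using that[of b0] B(1) by simp
    qed
    show "d * \<bar>c b\<bar> \<le> norm (\<Sum>b\<in>B. c b *\<^sub>R b)"
    proof (cases "c b0 = 0")
      case True
      then show ?thesis using b0(2)[OF b] by simp
    next
      case False
      let ?x = "\<Sum>b\<in>B. c b *\<^sub>R b"
      have "(1 / c b0) *\<^sub>R ?x = (\<Sum>b\<in>B. (c b / c b0) *\<^sub>R b)"
        by (simp add: scaleR_sum_right)
      also have "\<dots> = (c b0 / c b0) *\<^sub>R b0 + (\<Sum>b\<in>B - {b0}. (c b / c b0) *\<^sub>R b)"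
        by (rule sum.remove[OF B(1) b0(1)])
      also have "\<dots> = b0 + (\<Sum>b\<in>B - {b0}. (c b / c b0) *\<^sub>R b)"
        using False by simp
      also have "\<dots> \<in> T"
      proof -
        have "\<bar>c b / c b0\<bar> \<le> 1" if "b \<in> B - {b0}" for b
          using b0(2)[of b] that False by simp
        then have "(\<Sum>b\<in>B - {b0}. (c b / c b0) *\<^sub>R b) \<in> Box (B - {b0})"
          unfolding Box_def by (intro CollectI exI[of _ "\<lambda>b. c b / c b0"]) simp
        then show ?thesis unfolding T_def using b0(1) by blast
      qed
      finally have "d \<le> norm ((1 / c b0) *\<^sub>R ?x)" by (rule d(2))
      then have "d \<le> norm ?x / \<bar>c b0\<bar>" by simp
      then have "d * \<bar>c b0\<bar> \<le> norm ?x" using False by (subst (asm) pos_le_divide_eq) auto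
      moreover have "d * \<bar>c b\<bar> \<le> d * \<bar>c b0\<bar>"
        using b0(2)[OF b] d(1) by (intro mult_left_mono) auto
      ultimately show ?thesis by (rule order_trans[rotated])
    qed
  qed
qed

lemma convex_Union_balls:
  fixes T :: "'v::real_normed_vector set"
  assumes "convex T"
  shows "convex (\<Union>x\<in>T. ball x e)"
proof (rule convexI)
  fix p q and u v :: real
  assume p: "p \<in> (\<Union>x\<in>T. ball x e)" and q: "q \<in> (\<Union>x\<in>T. ball x e)" and uv: "0 \<le> u" "0 \<le> v" "u + v = 1"
  obtain x where x: "x \<in> T" "p \<in> ball x e" using p by (rule UN_E)
  obtain y where y: "y \<in> T" "q \<in> ball y e" using q by (rule UN_E)
  have "u *\<^sub>R (p - x) + v *\<^sub>R (q - y) \<in> ball 0 e"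
    using x(2) y(2) uv by (intro convexD[OF convex_ball]) (auto simp: dist_norm norm_minus_commute)
  then have "u *\<^sub>R p + v *\<^sub>R q \<in> ball (u *\<^sub>R x + v *\<^sub>R y) e"
    by (simp add: dist_norm algebra_simps norm_minus_commute)
  moreover have "u *\<^sub>R x + v *\<^sub>R y \<in> T" using x(1) y(1) uv by (intro convexD[OF assms])
  ultimately show "u *\<^sub>R p + v *\<^sub>R q \<in> (\<Union>x\<in>T. ball x e)" by (rule UN_I[rotated])
qed

locale lattice_arrangement =
  fixes L :: "'v::real_normed_vector set" and \<A> :: "'v set set" and Vgen :: "'v set"
  assumes lattice: "is_lattice L"
    and arrangement: "invariant_arrangement L \<A>"
    and generic: "generic_directions \<A> Vgen"
begin

lemma lattice_subgroup: "0 \<in> L" "\<lbrakk>m \<in> L; m' \<in> L\<rbrakk> \<Longrightarrow> m - m' \<in> L"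
proof -
  obtain B where B: "L = {(\<Sum>b\<in>B. of_int (k b) *\<^sub>R b) | k :: 'v \<Rightarrow> int. True}"
    using lattice unfolding is_lattice_def by blast
  have "(\<Sum>b\<in>B. of_int 0 *\<^sub>R b) \<in> L" unfolding B by (intro CollectI exI[of _ "\<lambda>_. 0"]) simp
  then show "0 \<in> L" by simp
  assume "m \<in> L" "m' \<in> L"
  then obtain k k' :: "'v \<Rightarrow> int" where "m = (\<Sum>b\<in>B. of_int (k b) *\<^sub>R b)" "m' = (\<Sum>b\<in>B. of_int (k' b) *\<^sub>R b)"
    unfolding B by blast
  then have "m - m' = (\<Sum>b\<in>B. of_int (k b - k' b) *\<^sub>R b)"
    by (simp add: sum_subtractf[symmetric] scaleR_diff_left)
  then show "m - m' \<in> L" unfolding B by (intro CollectI exI[of _ "\<lambda>b. k b - k' b"]) simp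
qed

text \<open>A nonzero vector of the lattice has a nonzero integral coefficient.\<close>

lemma lattice_separated: obtains \<rho> where "0 < \<rho>" "\<And>m. \<lbrakk>m \<in> L; m \<noteq> 0\<rbrakk> \<Longrightarrow> \<rho> \<le> norm m"
proof -
  obtain B where B: "finite B" "independent B" "L = {(\<Sum>b\<in>B. of_int (k b) *\<^sub>R b) | k :: 'v \<Rightarrow> int. True}"
    using lattice unfolding is_lattice_def by blast
  obtain d where d: "d > 0" "\<And>c b. b \<in> B \<Longrightarrow> d * \<bar>c b\<bar> \<le> norm (\<Sum>b\<in>B. c b *\<^sub>R b)"
    using independent_coefficient_bound[OF B(1,2)] by metis
  show thesis
  proof (rule that[OF d(1)])
    fix m assume m: "m \<in> L" "m \<noteq> 0"
    then obtain k :: "'v \<Rightarrow> int" where k: "m = (\<Sum>b\<in>B. of_int (k b) *\<^sub>R b)" unfolding B by blast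
    obtain b where b: "b \<in> B" "k b \<noteq> 0" using m(2) unfolding k by (metis (no_types, lifting) of_int_0 scaleR_zero_left sum.neutral)
    have "1 \<le> \<bar>real_of_int (k b)\<bar>" using b(2) by linarith
    then have "d \<le> d * \<bar>real_of_int (k b)\<bar>" using d(1) by simp
    also have "\<dots> \<le> norm m" unfolding k using d(2)[OF b(1), of "\<lambda>b. real_of_int (k b)"] .
    finally show "d \<le> norm m" .
  qed
qed

text \<open>The coordinates with respect to a basis are bounded, so all linear functionals are.\<close>

lemma continuous_functional:
  assumes "linear (f :: 'v \<Rightarrow> real)"
  shows "continuous_on S f"
proof -
  obtain B :: "'v set" where B: "finite B" "independent B" "span B = UNIV"
    using lattice unfolding is_lattice_def by blast
  obtain d where d: "d > 0" "\<And>c b. b \<in> B \<Longrightarrow> d * \<bar>c b\<bar> \<le> norm (\<Sum>b\<in>B. c b *\<^sub>R b)"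
    using independent_coefficient_bound[OF B(1,2)] by metis
  have "\<bar>f x\<bar> \<le> norm x * (\<Sum>b\<in>B. \<bar>f b\<bar> / d)" for x
  proof -
    have "x \<in> span B" using B(3) by simp
    then obtain c where c: "x = (\<Sum>b\<in>B. c b *\<^sub>R b)" unfolding span_finite[OF B(1)] by auto
    have "f x = (\<Sum>b\<in>B. c b * f b)" unfolding c by (simp add: linear_sum[OF assms] linear_scale[OF assms])
    then have "\<bar>f x\<bar> \<le> (\<Sum>b\<in>B. \<bar>c b\<bar> * \<bar>f b\<bar>)" by (simp add: abs_mult[symmetric] sum_abs)
    also have "\<dots> \<le> (\<Sum>b\<in>B. norm x / d * \<bar>f b\<bar>)"
      using d(2)[of _ c] d(1) by (intro sum_mono mult_right_mono) (auto simp: c field_simps)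
    also have "\<dots> = norm x * (\<Sum>b\<in>B. \<bar>f b\<bar> / d)" by (simp add: sum_distrib_left)
    finally show ?thesis .
  qed
  then have "bounded_linear f"
    using assms by (intro bounded_linear_intro[of f "\<Sum>b\<in>B. \<bar>f b\<bar> / d"]) (auto simp: linear_add linear_scale)
  then show ?thesis by (rule linear_continuous_on)
qed

subsection \<open>Hyperplanes and the signs of directions\<close>

definition normal :: "'v set \<Rightarrow> 'v \<Rightarrow> real" where
  "normal H = (SOME f. \<exists>c. defines_hyperplane f c H)"

definition level :: "'v set \<Rightarrow> real" where
  "level H = (SOME c. defines_hyperplane (normal H) c H)"

context
  fixes H assumes H: "H \<in> \<A>"
begin

lemma defines_normal: "defines_hyperplane (normal H) (level H) H"
proof -
  have "\<exists>f c. defines_hyperplane f c H"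
    using arrangement H unfolding invariant_arrangement_def is_hyperplane_def by blast
  then have "\<exists>c. defines_hyperplane (normal H) c H" unfolding normal_def by (rule someI_ex)
  then show ?thesis unfolding level_def by (rule someI_ex)
qed

lemma linear_normal: "linear (normal H)"
  and mem_hyperplane: "x \<in> H \<longleftrightarrow> normal H x = level H"
  and nonzero_normal: "\<exists>x. normal H x \<noteq> 0"
  using defines_normal unfolding defines_hyperplane_def by auto

lemma normal_simps [simp]: "normal H (x + y) = normal H x + normal H y"
  "normal H (t *\<^sub>R x) = t * normal H x" "normal H (x - y) = normal H x - normal H y"
  "normal H (- x) = - normal H x" "normal H 0 = 0"
  using linear_normal by (simp_all add: linear_add linear_scale linear_diff linear_neg linear_0)

lemma continuous_normal: "continuous_on S (normal H)"
  by (rule continuous_functional[OF linear_normal])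

lemma closed_hyperplane: "closed H"
proof -
  have "H = {x. normal H x = level H}" using mem_hyperplane by blast
  moreover have "closed {x. normal H x = level H}"
    using continuous_normal[of UNIV] by (intro closed_Collect_eq) auto
  ultimately show ?thesis by simp
qed

lemma direction_iff: "x \<in> direction H \<longleftrightarrow> normal H x = 0"
proof
  assume x: "normal H x = 0"
  obtain u where u: "normal H u \<noteq> 0" using nonzero_normal by blast
  let ?p = "(level H / normal H u) *\<^sub>R u"
  have "?p + x \<in> H" "?p \<in> H" using u x by (simp_all add: mem_hyperplane)
  then show "x \<in> direction H" unfolding direction_def
    by (intro CollectI exI[of _ "?p + x"] exI[of _ ?p]) simp
qed (auto simp: direction_def mem_hyperplane)

text \<open>Functionals that define the same hyperplane differ by a nonzero factor, so one of them decides about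
  orientations.\<close>

lemma same_orientation_iff: "same_orientation H y y' \<longleftrightarrow> sgn (normal H y) = sgn (normal H y')"
proof
  assume s: "sgn (normal H y) = sgn (normal H y')"
  show "same_orientation H y y'" unfolding same_orientation_def
  proof (intro allI impI)
    fix f c assume f: "defines_hyperplane f c H"
    then have lf: "linear f" and mem: "x \<in> H \<longleftrightarrow> f x = c" for x by (auto simp: defines_hyperplane_def)
    obtain u where u: "normal H u \<noteq> 0" using nonzero_normal by blast
    have dir0: "f x = 0" if "normal H x = 0" for x
    proof -
      have "x \<in> direction H" using that direction_iff by simp
      then obtain p q where "x = p - q" "p \<in> H" "q \<in> H" by (auto simp: direction_def)
      then show ?thesis using lf mem by (simp add: linear_diff)
    qed
    have eq: "f x = (f u / normal H u) * normal H x" for x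
    proof -
      have "f (x - (normal H x / normal H u) *\<^sub>R u) = 0" using u by (intro dir0) simp
      then show ?thesis by (simp add: linear_diff[OF lf] linear_scale[OF lf])
    qed
    show "sgn (f y) = sgn (f y')" unfolding eq[of y] eq[of y'] sgn_mult using s by simp
  qed
qed (use defines_normal in \<open>auto simp: same_orientation_def\<close>)

end

text \<open>Equal orientation relative to the hyperplanes that meet \<open>T\<close>. The strict inequality rules out
  directions parallel to one of them, so this is reflexive only for transversal directions.\<close>

definition cosided :: "'v set \<Rightarrow> 'v \<Rightarrow> 'v \<Rightarrow> bool" where
  "cosided T y y' \<longleftrightarrow> (\<forall>H\<in>\<A>. H \<inter> T \<noteq> {} \<longrightarrow> 0 < normal H y * normal H y')"

definition transversal :: "'v set \<Rightarrow> 'v \<Rightarrow> bool" where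
  "transversal T y \<longleftrightarrow> (\<forall>H\<in>\<A>. H \<inter> T \<noteq> {} \<longrightarrow> normal H y \<noteq> 0)"

lemma cosided_refl:
  assumes "transversal T y"
  shows "cosided T y y"
  unfolding cosided_def
proof (intro ballI impI)
  fix H assume "H \<in> \<A>" "H \<inter> T \<noteq> {}"
  then have "normal H y \<noteq> 0" using assms unfolding transversal_def by blast
  then show "0 < normal H y * normal H y" unfolding zero_less_mult_iff by linarith
qed

lemma cosided_sym: "cosided T y y' \<Longrightarrow> cosided T y' y"
  unfolding cosided_def by (simp add: mult.commute)

lemma cosided_trans:
  assumes "cosided T y y'" "cosided T y' y''"
  shows "cosided T y y''"
  unfolding cosided_def
proof (intro ballI impI)
  fix H assume "H \<in> \<A>" "H \<inter> T \<noteq> {}"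
  then have "0 < normal H y * normal H y'" "0 < normal H y' * normal H y''"
    using assms unfolding cosided_def by blast+
  then show "0 < normal H y * normal H y''" unfolding zero_less_mult_iff by linarith
qed

lemma cosided_subset: "cosided T y y' \<Longrightarrow> S \<subseteq> T \<Longrightarrow> cosided S y y'"
  unfolding cosided_def by blast

lemma transversal_subset: "transversal T y \<Longrightarrow> S \<subseteq> T \<Longrightarrow> transversal S y"
  unfolding transversal_def by blast

lemma cosided_transversal:
  assumes "cosided T y y'"
  shows "transversal T y \<and> transversal T y'"
proof -
  have "normal H y \<noteq> 0 \<and> normal H y' \<noteq> 0" if "H \<in> \<A>" "H \<inter> T \<noteq> {}" for H
  proof -
    have "0 < normal H y * normal H y'" using assms that unfolding cosided_def by blast
    then show ?thesis by auto
  qed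
  then show ?thesis unfolding transversal_def by blast
qed

lemma convex_cosided: "convex {y'. cosided T y y'}"
proof -
  have "convex {y'. 0 < normal H y * normal H y'}" if "H \<in> \<A>" for H
  proof (rule convexI)
    fix a b and u v :: real
    assume ab: "a \<in> {y'. 0 < normal H y * normal H y'}" "b \<in> {y'. 0 < normal H y * normal H y'}"
      and uv: "0 \<le> u" "0 \<le> v" "u + v = 1"
    have "0 < u * (normal H y * normal H a) + v * (normal H y * normal H b)"
    proof (cases "u = 0")
      case True
      then show ?thesis using ab uv by simp
    next
      case False
      then show ?thesis using ab uv by (intro add_pos_nonneg[OF mult_pos_pos mult_nonneg_nonneg]) auto
    qed
    then show "u *\<^sub>R a + v *\<^sub>R b \<in> {y'. 0 < normal H y * normal H y'}"
      using that by (simp add: algebra_simps)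
  qed
  then have "convex (\<Inter>H\<in>{H\<in>\<A>. H \<inter> T \<noteq> {}}. {y'. 0 < normal H y * normal H y'})"
    by (intro convex_INT) auto
  also have "(\<Inter>H\<in>{H\<in>\<A>. H \<inter> T \<noteq> {}}. {y'. 0 < normal H y * normal H y'}) = {y'. cosided T y y'}"
    by (auto simp: cosided_def)
  finally show ?thesis .
qed

lemma open_cosided:
  assumes "finite {H\<in>\<A>. H \<inter> T \<noteq> {}}"
  shows "open {y'. cosided T y y'}"
proof -
  have "open {y'. 0 < normal H y * normal H y'}" if "H \<in> \<A>" for H
    using continuous_normal[OF that, of UNIV] by (intro open_Collect_less continuous_intros) auto
  then have "open (\<Inter>H\<in>{H\<in>\<A>. H \<inter> T \<noteq> {}}. {y'. 0 < normal H y * normal H y'})"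
    using assms by (intro open_INT) auto
  also have "(\<Inter>H\<in>{H\<in>\<A>. H \<inter> T \<noteq> {}}. {y'. 0 < normal H y * normal H y'}) = {y'. cosided T y y'}"
    by (auto simp: cosided_def)
  finally show ?thesis .
qed

lemma same_orientation_iff_cosided:
  assumes "transversal T y"
  shows "(\<forall>H\<in>\<A>. H \<inter> T \<noteq> {} \<longrightarrow> same_orientation H y y') \<longleftrightarrow> cosided T y y'"
proof -
  have "same_orientation H y y' \<longleftrightarrow> 0 < normal H y * normal H y'" if "H \<in> \<A>" "H \<inter> T \<noteq> {}" for H
    using assms that unfolding transversal_def
    by (auto simp: same_orientation_iff zero_less_mult_iff sgn_if split: if_splits)
  then show ?thesis unfolding cosided_def by blast
qed

text \<open>The component of \<open>y\<close> in the complement of the translated hyperplanes contains a generic direction,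
  and no functional changes its sign on a connected set where it does not vanish.\<close>

lemma generic_cosided:
  assumes "finite {H\<in>\<A>. H \<inter> T \<noteq> {}}" "transversal T y"
  obtains l where "l \<in> Vgen" "cosided T y l"
proof -
  let ?F = "{H\<in>\<A>. H \<inter> T \<noteq> {}}" let ?U = "UNIV - \<Union> (direction ` ?F)"
  have "y \<in> ?U" using assms(2) by (auto simp: direction_iff transversal_def)
  then have K: "connected_component_set ?U y \<in> components ?U" by (rule componentsI)
  have "components ?U \<noteq> {} \<Longrightarrow> \<forall>K\<in>components ?U. K \<inter> Vgen \<noteq> {}"
    using generic assms(1) unfolding generic_directions_def by blast
  then obtain l where l: "l \<in> connected_component_set ?U y" "l \<in> Vgen" using K by blast
  then obtain S where S: "connected S" "S \<subseteq> ?U" "y \<in> S" "l \<in> S" by (auto simp: connected_component_def)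
  have "0 < normal H y * normal H l" if H: "H \<in> \<A>" "H \<inter> T \<noteq> {}" for H
  proof (rule ccontr)
    assume "\<not> 0 < normal H y * normal H l"
    have conn: "connected (normal H ` S)" using S(1) continuous_normal[OF H(1)] by (rule connected_continuous_image[rotated])
    have "0 \<in> normal H ` S"
    proof (cases "normal H y \<le> normal H l")
      case True
      then have "0 \<in> {normal H y .. normal H l}" using \<open>\<not> 0 < normal H y * normal H l\<close>
        by (auto simp: zero_less_mult_iff not_less)
      then show ?thesis using connected_contains_Icc[OF conn, of "normal H y" "normal H l"] S by blast
    next
      case False
      then have "0 \<in> {normal H l .. normal H y}" using \<open>\<not> 0 < normal H y * normal H l\<close>
        by (auto simp: zero_less_mult_iff not_less)
      then show ?thesis using connected_contains_Icc[OF conn, of "normal H l" "normal H y"] S by blast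
    qed
    then obtain s where "s \<in> S" "s \<in> direction H" using direction_iff[OF H(1)] by force
    then show False using S(2) H by blast
  qed
  then show thesis using l(2) that by (auto simp: cosided_def)
qed

subsection \<open>Small neighbourhoods\<close>

lemma locally_finite: "\<exists>V. open V \<and> x \<in> V \<and> finite {H\<in>\<A>. H \<inter> V \<noteq> {}}"
  using arrangement unfolding invariant_arrangement_def locally_finite_in_def by force

lemma finite_meeting_compact:
  assumes "compact T"
  obtains W where "open W" "T \<subseteq> W" "finite {H\<in>\<A>. H \<inter> W \<noteq> {}}"
proof -
  obtain V where V: "\<And>x. open (V x)" "\<And>x. x \<in> V x" "\<And>x. finite {H\<in>\<A>. H \<inter> V x \<noteq> {}}"
    using locally_finite by metis
  have "T \<subseteq> (\<Union>x\<in>T. V x)" using V(2) by blast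
  then obtain D where D: "D \<subseteq> T" "finite D" "T \<subseteq> (\<Union>x\<in>D. V x)"
    using compactE_image[OF assms, of T V] V(1) by metis
  have "{H\<in>\<A>. H \<inter> (\<Union>x\<in>D. V x) \<noteq> {}} = (\<Union>x\<in>D. {H\<in>\<A>. H \<inter> V x \<noteq> {}})" by auto
  then have "finite {H\<in>\<A>. H \<inter> (\<Union>x\<in>D. V x) \<noteq> {}}" using D(2) V(3) by simp
  then show thesis using that[of "\<Union>x\<in>D. V x"] V(1) D(3) by blast
qed

text \<open>Some neighbourhood of \<open>T\<close> meets only finitely many hyperplanes. These are closed, so those that miss
  \<open>T\<close> may be removed from it; what is left contains the points at a small distance from \<open>T\<close>.\<close>

lemma convex_neighbourhood:
  assumes "compact T" "convex T"
  obtains B where "open B" "convex B" "T \<subseteq> B" "{H\<in>\<A>. H \<inter> B \<noteq> {}} = {H\<in>\<A>. H \<inter> T \<noteq> {}}"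
    "finite {H\<in>\<A>. H \<inter> B \<noteq> {}}"
proof -
  obtain W where W: "open W" "T \<subseteq> W" "finite {H\<in>\<A>. H \<inter> W \<noteq> {}}"
    using finite_meeting_compact[OF assms(1)] by blast
  define W' where "W' = W - \<Union>{H\<in>\<A>. H \<inter> W \<noteq> {} \<and> H \<inter> T = {}}"
  have "finite {H\<in>\<A>. H \<inter> W \<noteq> {} \<and> H \<inter> T = {}}" by (rule finite_subset[OF _ W(3)]) blast
  then have "closed (\<Union>{H\<in>\<A>. H \<inter> W \<noteq> {} \<and> H \<inter> T = {}})"
    using closed_hyperplane by (intro closed_Union) auto
  then have "open W'" unfolding W'_def using W(1) by (intro open_Diff)
  moreover have "T \<subseteq> W'" unfolding W'_def using W(2) by blast
  ultimately obtain e where e: "e > 0" "(\<Union>x\<in>T. ball x e) \<subseteq> W'"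
    by (rule compact_subset_open_imp_ball_epsilon_subset[OF assms(1)])
  define B where "B = (\<Union>x\<in>T. ball x e)"
  have "convex B" unfolding B_def by (rule convex_Union_balls[OF assms(2)])
  have "open B" unfolding B_def by (intro open_UN ballI open_ball)
  have BW: "B \<subseteq> W'" unfolding B_def by (rule e(2))
  have TB: "T \<subseteq> B"
  proof
    fix x assume "x \<in> T"
    moreover have "x \<in> ball x e" using e(1) by simp
    ultimately show "x \<in> B" unfolding B_def by (rule UN_I)
  qed
  have meets: "H \<inter> T \<noteq> {}" if H: "H \<in> \<A>" "H \<inter> B \<noteq> {}" for H
  proof
    assume T: "H \<inter> T = {}"
    obtain x where x: "x \<in> H" "x \<in> W'" using H(2) BW by blast
    then have "H \<inter> W \<noteq> {}" unfolding W'_def by blast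
    then have "x \<notin> W'" using T H(1) x(1) unfolding W'_def by blast
    then show False using x(2) by simp
  qed
  have eq: "{H\<in>\<A>. H \<inter> B \<noteq> {}} = {H\<in>\<A>. H \<inter> T \<noteq> {}}"
    using meets TB by blast
  have "{H\<in>\<A>. H \<inter> T \<noteq> {}} \<subseteq> {H\<in>\<A>. H \<inter> W \<noteq> {}}"
    using W(2) by blast
  then have "finite {H\<in>\<A>. H \<inter> T \<noteq> {}}" using W(3) by (rule finite_subset)
  then show thesis
    by (intro that[OF \<open>open B\<close> \<open>convex B\<close> TB eq]) (simp only: eq)
qed

lemma finite_meeting_segment: "finite {H\<in>\<A>. H \<inter> closed_segment a b \<noteq> {}}"
proof -
  obtain W where W: "closed_segment a b \<subseteq> W" "finite {H\<in>\<A>. H \<inter> W \<noteq> {}}"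
    using finite_meeting_compact[OF compact_segment] by blast
  then have "{H\<in>\<A>. H \<inter> closed_segment a b \<noteq> {}} \<subseteq> {H\<in>\<A>. H \<inter> W \<noteq> {}}" by blast
  then show ?thesis using W(2) by (rule finite_subset)
qed

subsection \<open>The complement\<close>

definition M :: "('v \<times> 'v) set" where "M = UNIV - (\<Union>H \<in> \<A>. complexify H)"

lemma arr_complement_eq: "arr_complement \<A> = top_of_set M"
  by (simp add: arr_complement_def M_def)

lemma mem_M: "(x, y) \<in> M \<longleftrightarrow> transversal {x} y"
proof -
  have "(x, y) \<in> M \<longleftrightarrow> (\<forall>H\<in>\<A>. x \<in> H \<longrightarrow> y \<notin> direction H)"
    unfolding M_def complexify_def by blast
  then show ?thesis unfolding transversal_def using direction_iff by blast
qed

lemma mem_M_iff: "(x, y) \<in> M \<longleftrightarrow> (\<forall>H\<in>\<A>. x \<in> H \<longrightarrow> normal H y \<noteq> 0)"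
  unfolding mem_M transversal_def by blast

lemma real_point_mem_M: "a \<notin> \<Union>\<A> \<Longrightarrow> (a, y) \<in> M"
  unfolding mem_M_iff by blast

lemma translate_hyperplane: "m \<in> L \<Longrightarrow> x + m \<in> \<Union>\<A> \<longleftrightarrow> x \<in> \<Union>\<A>"
proof -
  have *: "x + m \<in> \<Union>\<A>" if xm: "x \<in> \<Union>\<A>" "m \<in> L" for x m
  proof -
    obtain H where "H \<in> \<A>" "x \<in> H" using xm by blast
    moreover have "(+) m ` H \<in> \<A>" using arrangement xm(2) \<open>H \<in> \<A>\<close> unfolding invariant_arrangement_def by blast
    moreover have "x + m \<in> (+) m ` H" using \<open>x \<in> H\<close> by (simp add: add.commute)
    ultimately show ?thesis by blast
  qed
  assume m: "m \<in> L"
  then have "- m \<in> L" using lattice_subgroup(1) lattice_subgroup(2)[of 0 m] by simp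
  then show ?thesis using *[of x m] *[of "x + m" "- m"] m by auto
qed

lemma translate_M:
  assumes "z \<in> M" "m \<in> L"
  shows "z + (m, 0) \<in> M"
proof (rule ccontr)
  obtain x y where z: "z = (x, y)" by (cases z)
  assume "z + (m, 0) \<notin> M"
  then obtain H where "H \<in> \<A>" "z + (m, 0) \<in> complexify H" unfolding M_def by blast
  then have H: "H \<in> \<A>" "x + m \<in> H" "y \<in> direction H" by (simp_all add: z complexify_def)
  have "- m \<in> L" using assms(2) lattice_subgroup(1) lattice_subgroup(2)[of 0 m] by simp
  then have A: "(+) (- m) ` H \<in> \<A>" using arrangement H(1) unfolding invariant_arrangement_def by blast
  have x: "x \<in> (+) (- m) ` H" using H(2) by (auto intro!: image_eqI[of _ _ "x + m"])
  have y: "y \<in> direction ((+) (- m) ` H)"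
  proof -
    obtain p q where "y = p - q" "p \<in> H" "q \<in> H" using H(3) by (auto simp: direction_def)
    then have "y = (- m + p) - (- m + q)" "- m + p \<in> (+) (- m) ` H" "- m + q \<in> (+) (- m) ` H" by auto
    then show ?thesis unfolding direction_def by blast
  qed
  have "z \<in> complexify ((+) (- m) ` H)" unfolding z complexify_def using x y by (rule SigmaI)
  then show False using A assms(1) unfolding M_def by blast
qed

text \<open>As \<open>y\<close> is not parallel to the hyperplanes through \<open>x\<close>, a step in direction \<open>y\<close> leaves them all, and a
  short step does not reach any other one.\<close>

lemma vertex_near:
  assumes "open W" "x \<in> W" "(x, y) \<in> M"
  obtains t where "t > 0" "x + t *\<^sub>R y \<in> W" "x + t *\<^sub>R y \<notin> \<Union>\<A>"
proof -
  obtain B where B: "open B" "convex B" "{x} \<subseteq> B" "{H\<in>\<A>. H \<inter> B \<noteq> {}} = {H\<in>\<A>. H \<inter> {x} \<noteq> {}}"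
    by (rule convex_neighbourhood[OF compact_sing convex_singleton[of x]])
  have "open (W \<inter> B)" "x \<in> W \<inter> B" using assms B by auto
  then obtain e where e: "e > 0" "ball x e \<subseteq> W \<inter> B" by (rule openE)
  define s where "s = norm y + 1"
  define t where "t = e / (2 * s)"
  have n: "0 < s" "norm y \<le> s" using norm_ge_zero[of y] unfolding s_def by linarith+
  then have t: "t > 0" using e(1) n(1) by (simp add: t_def)
  have "t * norm y < e"
  proof -
    have "t * norm y \<le> t * s" using t n(2) by (intro mult_left_mono) auto
    also have "\<dots> = e / 2" using n(1) unfolding t_def by simp
    finally show ?thesis using e(1) by linarith
  qed
  then have "x + t *\<^sub>R y \<in> ball x e" using t by (simp add: dist_norm)
  then have in_WB: "x + t *\<^sub>R y \<in> W \<inter> B" using e(2) by blast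
  have "x + t *\<^sub>R y \<notin> H" if H: "H \<in> \<A>" for H
  proof
    assume xt: "x + t *\<^sub>R y \<in> H"
    then have "H \<in> {H\<in>\<A>. H \<inter> B \<noteq> {}}" using H in_WB by blast
    then have "x \<in> H" unfolding B(4) by blast
    then have "normal H y \<noteq> 0" "normal H x = level H" using assms(3) H mem_hyperplane by (auto simp: mem_M_iff)
    then show False using xt H t by (simp add: mem_hyperplane)
  qed
  then show thesis using that[OF t] in_WB by blast
qed

end

section \<open>Transitions in the combinatorial groupoid\<close>

context lattice_arrangement
begin

abbreviation \<Gamma>V :: "('v, ('v, 'v edge) word_arrow) gpd" where
  "\<Gamma>V \<equiv> \<Gamma> \<A> Vgen"

text \<open>The condition for a move from \<open>a\<close> to \<open>b\<close> in direction \<open>y\<close> to be valid, see \<open>joined_iff_transversal\<close>.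
  In the present form, that \<open>a\<close> and \<open>b\<close> lie strictly on the same side of each hyperplane parallel to
  \<open>y\<close>, it is evidently transitive in \<open>a\<close> and \<open>b\<close> and defines a convex set.\<close>

definition joined :: "'v \<Rightarrow> 'v \<Rightarrow> 'v \<Rightarrow> bool" where
  "joined y a b \<longleftrightarrow> (\<forall>H\<in>\<A>. normal H y = 0 \<longrightarrow> 0 < (normal H a - level H) * (normal H b - level H))"

text \<open>An affine function has a zero on a segment iff its values at the ends do not have the same strict
  sign.\<close>

lemma joined_iff_transversal: "joined y a b \<longleftrightarrow> transversal (closed_segment a b) y"
proof -
  have "H \<inter> closed_segment a b \<noteq> {} \<longleftrightarrow> \<not> 0 < (normal H a - level H) * (normal H b - level H)"
    if H: "H \<in> \<A>" for H
  proof -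
    let ?p = "normal H a - level H" and ?q = "normal H b - level H"
    have val: "normal H ((1 - u) *\<^sub>R a + u *\<^sub>R b) - level H = (1 - u) * ?p + u * ?q" for u
      using H by (simp add: algebra_simps)
    have mem: "(1 - u) *\<^sub>R a + u *\<^sub>R b \<in> H \<longleftrightarrow> (1 - u) * ?p + u * ?q = 0" for u
      unfolding mem_hyperplane[OF H] using val[of u] by linarith
    show ?thesis
    proof
      assume "H \<inter> closed_segment a b \<noteq> {}"
      then obtain z where z: "z \<in> H" "z \<in> closed_segment a b" by blast
      from z(2) obtain u where u01: "0 \<le> u" "u \<le> 1" and zu: "z = (1 - u) *\<^sub>R a + u *\<^sub>R b"
        unfolding in_segment by (elim exE conjE)
      note u = u01 z(1)[unfolded zu]
      show "\<not> 0 < ?p * ?q"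
      proof
        assume pq: "0 < ?p * ?q"
        have "((1 - u) * ?p + u * ?q) * ?p = (1 - u) * ?p\<^sup>2 + u * (?p * ?q)"
          by (simp add: algebra_simps power2_eq_square)
        moreover have "0 < (1 - u) * ?p\<^sup>2 + u * (?p * ?q)"
        proof (cases "u = 0")
          case True
          then show ?thesis using pq by auto
        next
          case False
          then show ?thesis using pq u by (intro add_nonneg_pos mult_nonneg_nonneg mult_pos_pos[OF _ pq]) auto
        qed
        ultimately show False using u(3) unfolding mem by simp
      qed
    next
      assume pq: "\<not> 0 < ?p * ?q"
      define u where "u = (if ?p = 0 then 0 else ?p / (?p - ?q))"
      have "0 \<le> u \<and> u \<le> 1 \<and> (1 - u) * ?p + u * ?q = 0"
      proof (cases "?p = 0")
        case False
        have quotient_cancel: "p / d * d = p" if "d \<noteq> 0" for p d :: real using that by simp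
        from False have ne: "?p - ?q \<noteq> 0" using pq by (metis eq_iff_diff_eq_0 not_real_square_gt_zero)
        have "u = ?p / (?p - ?q)" using False by (simp add: u_def)
        moreover have "0 \<le> ?p / (?p - ?q) \<and> ?p / (?p - ?q) \<le> 1"
          using pq False by (auto simp: zero_less_mult_iff not_less divide_simps)
        moreover have "(1 - r) * ?p + r * ?q = ?p - r * (?p - ?q)" for r by algebra
        then have "(1 - ?p / (?p - ?q)) * ?p + ?p / (?p - ?q) * ?q = 0"
          by (simp only: quotient_cancel[OF ne] diff_self)
        ultimately show ?thesis by (simp only: simp_thms)
      qed (auto simp: u_def)
      then show "H \<inter> closed_segment a b \<noteq> {}"
        unfolding mem[symmetric] closed_segment_def by blast
    qed
  qed
  then show ?thesis unfolding joined_def transversal_def by blast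
qed

lemma joined_sym: "joined y a b \<Longrightarrow> joined y b a"
  unfolding joined_def by (simp add: mult.commute)

lemma joined_trans:
  assumes "joined y a b" "joined y b c"
  shows "joined y a c"
  unfolding joined_def
proof (intro ballI impI)
  fix H assume "H \<in> \<A>" "normal H y = 0"
  then have "0 < (normal H a - level H) * (normal H b - level H)"
    "0 < (normal H b - level H) * (normal H c - level H)"
    using assms unfolding joined_def by blast+
  then show "0 < (normal H a - level H) * (normal H c - level H)" unfolding zero_less_mult_iff by linarith
qed

lemma joined_refl: "joined y a a \<longleftrightarrow> (a, y) \<in> M"
  unfolding joined_iff_transversal mem_M by simp

lemma joined_M: "joined y a b \<Longrightarrow> (a, y) \<in> M \<and> (b, y) \<in> M"
  using joined_trans joined_sym joined_refl by blast

lemma joined_vertex: "a \<notin> \<Union>\<A> \<Longrightarrow> joined y a a"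
  unfolding joined_refl by (rule real_point_mem_M)

lemma convex_joined: "convex {b. joined y a b}"
proof -
  have "convex {b. 0 < (normal H a - level H) * (normal H b - level H)}" if "H \<in> \<A>" for H
  proof (rule convexI)
    fix b c and u v :: real
    assume bc: "b \<in> {b. 0 < (normal H a - level H) * (normal H b - level H)}"
       "c \<in> {b. 0 < (normal H a - level H) * (normal H b - level H)}"
      and uv: "0 \<le> u" "0 \<le> v" "u + v = 1"
    let ?p = "normal H a - level H"
    have v: "v = 1 - u" using uv(3) by simp
    have "normal H (u *\<^sub>R b + v *\<^sub>R c) = u * normal H b + v * normal H c" using that by simp
    then have "?p * (normal H (u *\<^sub>R b + v *\<^sub>R c) - level H)
        = u * (?p * (normal H b - level H)) + v * (?p * (normal H c - level H))"
      unfolding v by algebra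
    also have "0 < \<dots>"
    proof (cases "u = 0")
      case True
      then show ?thesis using bc uv by simp
    next
      case False
      then show ?thesis using bc uv by (intro add_pos_nonneg[OF mult_pos_pos mult_nonneg_nonneg]) auto
    qed
    finally show "u *\<^sub>R b + v *\<^sub>R c \<in> {b. 0 < ?p * (normal H b - level H)}" by simp
  qed
  then have "convex (\<Inter>H\<in>{H\<in>\<A>. normal H y = 0}. {b. 0 < (normal H a - level H) * (normal H b - level H)})"
    by (intro convex_INT) auto
  also have "(\<Inter>H\<in>{H\<in>\<A>. normal H y = 0}. {b. 0 < (normal H a - level H) * (normal H b - level H)}) = {b. joined y a b}"
    unfolding joined_def by blast
  finally show ?thesis .
qed

lemma valid_move_iff:
  "valid_move \<A> Vgen a l b \<longleftrightarrow> a \<notin> \<Union>\<A> \<and> b \<notin> \<Union>\<A> \<and> l \<in> Vgen \<and> joined l a b"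
  unfolding valid_move_def joined_iff_transversal transversal_def using direction_iff by blast

lemma \<Gamma>_graph_simps [simp]:
  "verts (\<Gamma>_graph \<A> Vgen) = UNIV - \<Union>\<A>"
  "tail (\<Gamma>_graph \<A> Vgen) = edge_tail" "head (\<Gamma>_graph \<A> Vgen) = edge_head"
  "e \<in> arcs (\<Gamma>_graph \<A> Vgen) \<longleftrightarrow> (\<exists>a l b. e = Move a l b \<and> valid_move \<A> Vgen a l b)"
  by (auto simp: \<Gamma>_graph_def)

definition move_arrow :: "'v \<Rightarrow> 'v \<Rightarrow> 'v \<Rightarrow> ('v, 'v edge) word_arrow" where
  "move_arrow a l b = edge_arrow (\<Gamma>_graph \<A> Vgen) (\<Gamma>_rel \<A>) (Move a l b)"

interpretation \<Gamma>: groupoid "\<Gamma> \<A> Vgen"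
  unfolding \<Gamma>_def by (rule groupoid_presented)

lemma Obj_\<Gamma> [simp]: "Obj \<Gamma>V = UNIV - \<Union>\<A>"
  by (simp add: \<Gamma>_def)

lemma move_arrow_simps [simp]:
  "Dom \<Gamma>V (move_arrow a l b) = a" "Cod \<Gamma>V (move_arrow a l b) = b"
  "valid_move \<A> Vgen a l b \<Longrightarrow> move_arrow a l b \<in> Arr \<Gamma>V"
  unfolding \<Gamma>_def move_arrow_def by (auto simp: valid_move_iff)

lemma word_from_to_move: "valid_move \<A> Vgen a l b \<Longrightarrow> word_from_to (\<Gamma>_graph \<A> Vgen) a [(Move a l b, True)] b"
  by (auto simp: valid_move_iff)

lemma move_arrow_stay:
  assumes "valid_move \<A> Vgen a l a"
  shows "move_arrow a l a = Ident \<Gamma>V a"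
proof -
  have "word_cong (\<Gamma>_graph \<A> Vgen) (\<Gamma>_rel \<A>) a [(Move a l a, True)] [] a"
    by (rule cong_rel, rule \<Gamma>_rel.stay) (use assms in \<open>auto simp: valid_move_iff\<close>)
  from word_class_eqI[OF this] show ?thesis
    unfolding move_arrow_def edge_arrow_def \<Gamma>_def by simp
qed

lemma move_arrow_comp:
  assumes "valid_move \<A> Vgen a l b" "valid_move \<A> Vgen b l c" "valid_move \<A> Vgen a l c"
  shows "Comp \<Gamma>V (move_arrow a l b) (move_arrow b l c) = move_arrow a l c"
proof -
  have "word_cong (\<Gamma>_graph \<A> Vgen) (\<Gamma>_rel \<A>) a [(Move a l c, True)] [(Move a l b, True), (Move b l c, True)] c"
    by (rule cong_rel, rule \<Gamma>_rel.subdivide) (use assms in \<open>auto simp: valid_move_iff\<close>)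
  from word_class_eqI[OF this] show ?thesis
    using word_from_to_move[OF assms(1)] word_from_to_move[OF assms(2)]
    unfolding move_arrow_def edge_arrow_def \<Gamma>_def by simp
qed

lemma move_arrow_relabel:
  assumes "valid_move \<A> Vgen a l b" "valid_move \<A> Vgen a l' b" "cosided (closed_segment a b) l l'"
  shows "move_arrow a l b = move_arrow a l' b"
proof -
  have "\<forall>H\<in>\<A>. H \<inter> closed_segment a b \<noteq> {} \<longrightarrow> same_orientation H l l'"
    using same_orientation_iff_cosided cosided_transversal[OF assms(3)] assms(3) by blast
  then have "word_cong (\<Gamma>_graph \<A> Vgen) (\<Gamma>_rel \<A>) a [(Move a l b, True)] [(Move a l' b, True)] b"
    by (intro cong_rel word_from_to_move assms \<Gamma>_rel.relabel) blast
  from word_class_eqI[OF this] show ?thesis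
    unfolding move_arrow_def edge_arrow_def by simp
qed

text \<open>The move from \<open>a\<close> to \<open>b\<close> for an arbitrary direction \<open>y\<close>, which is approximated by a generic one. By the
  relabelling relation the choice of the latter is immaterial.\<close>

definition transition :: "'v \<Rightarrow> 'v \<Rightarrow> 'v \<Rightarrow> ('v, 'v edge) word_arrow" where
  "transition y a b = move_arrow a (SOME l. l \<in> Vgen \<and> cosided (closed_segment a b) y l) b"

lemma joined_cosided: "cosided (closed_segment a b) y y' \<Longrightarrow> joined y' a b"
  unfolding joined_iff_transversal using cosided_transversal by blast

lemma valid_move_cosided:
  assumes "a \<notin> \<Union>\<A>" "b \<notin> \<Union>\<A>" "l \<in> Vgen" "cosided (closed_segment a b) y l"
  shows "valid_move \<A> Vgen a l b"
  using assms joined_cosided unfolding valid_move_iff by blast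

lemma transition_eq:
  assumes "a \<notin> \<Union>\<A>" "b \<notin> \<Union>\<A>" "l \<in> Vgen" "cosided (closed_segment a b) y l"
  shows "transition y a b = move_arrow a l b"
proof -
  define k where "k = (SOME l. l \<in> Vgen \<and> cosided (closed_segment a b) y l)"
  have k: "k \<in> Vgen \<and> cosided (closed_segment a b) y k"
    unfolding k_def by (rule someI[of _ l]) (use assms in blast)
  have "cosided (closed_segment a b) k l"
    using cosided_trans[OF cosided_sym] k assms(4) by blast
  then show ?thesis
    unfolding transition_def k_def[symmetric]
    using k assms by (intro move_arrow_relabel valid_move_cosided) blast+
qed

lemma ex_transition_label:
  assumes "joined y a b"
  obtains l where "l \<in> Vgen" "cosided (closed_segment a b) y l"
  using generic_cosided[OF finite_meeting_segment] assms unfolding joined_iff_transversal by blast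

lemma transition_arr:
  assumes "a \<notin> \<Union>\<A>" "b \<notin> \<Union>\<A>" "joined y a b"
  shows "transition y a b \<in> Arr \<Gamma>V"
proof -
  obtain l where l: "l \<in> Vgen" "cosided (closed_segment a b) y l"
    by (rule ex_transition_label[OF assms(3)])
  show ?thesis unfolding transition_eq[OF assms(1,2) l]
    using valid_move_cosided[OF assms(1,2) l] by simp
qed

lemma transition_ends [simp]:
  "Dom \<Gamma>V (transition y a b) = a" "Cod \<Gamma>V (transition y a b) = b"
  by (simp_all add: transition_def)

lemma transition_cong:
  assumes "a \<notin> \<Union>\<A>" "b \<notin> \<Union>\<A>" "cosided (closed_segment a b) y y'"
  shows "transition y a b = transition y' a b"
proof -
  obtain l where l: "l \<in> Vgen" "cosided (closed_segment a b) y' l"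
    by (rule ex_transition_label[OF joined_cosided[OF assms(3)]])
  show ?thesis
    using transition_eq[OF assms(1,2) l] transition_eq[OF assms(1,2) l(1) cosided_trans[OF assms(3) l(2)]] by simp
qed

text \<open>One generic direction can be used for all three sides of the triangle.\<close>

lemma transition_comp:
  assumes v: "a \<notin> \<Union>\<A>" "b \<notin> \<Union>\<A>" "c \<notin> \<Union>\<A>" and j: "joined y a b" "joined y b c"
  shows "Comp \<Gamma>V (transition y a b) (transition y b c) = transition y a c"
proof -
  let ?T = "closed_segment a b \<union> closed_segment b c \<union> closed_segment a c"
  have "{H\<in>\<A>. H \<inter> ?T \<noteq> {}} = {H\<in>\<A>. H \<inter> closed_segment a b \<noteq> {}} \<union>
      {H\<in>\<A>. H \<inter> closed_segment b c \<noteq> {}} \<union> {H\<in>\<A>. H \<inter> closed_segment a c \<noteq> {}}" by blast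
  then have "finite {H\<in>\<A>. H \<inter> ?T \<noteq> {}}" using finite_meeting_segment by simp
  moreover have "transversal ?T y"
    using j joined_trans[OF j] unfolding joined_iff_transversal transversal_def by blast
  ultimately obtain l where l: "l \<in> Vgen" "cosided ?T y l" by (rule generic_cosided)
  have seg: "cosided (closed_segment a b) y l" "cosided (closed_segment b c) y l" "cosided (closed_segment a c) y l"
    by (rule cosided_subset[OF l(2)]; blast)+
  have "valid_move \<A> Vgen a l b" "valid_move \<A> Vgen b l c" "valid_move \<A> Vgen a l c"
    using valid_move_cosided v l(1) seg by blast+
  then show ?thesis
    unfolding transition_eq[OF v(1,2) l(1) seg(1)] transition_eq[OF v(2,3) l(1) seg(2)]
      transition_eq[OF v(1,3) l(1) seg(3)] by (rule move_arrow_comp)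
qed

lemma transition_refl:
  assumes "a \<notin> \<Union>\<A>"
  shows "transition y a a = Ident \<Gamma>V a"
proof -
  obtain l where l: "l \<in> Vgen" "cosided (closed_segment a a) y l"
    by (rule ex_transition_label[OF joined_vertex[OF assms]])
  show ?thesis unfolding transition_eq[OF assms assms l]
    by (rule move_arrow_stay[OF valid_move_cosided[OF assms assms l]])
qed

section \<open>Convex charts of the complement\<close>

definition chart :: "'v set \<Rightarrow> 'v \<Rightarrow> bool" where
  "chart B y0 \<longleftrightarrow> open B \<and> convex B \<and> finite {H\<in>\<A>. H \<inter> B \<noteq> {}} \<and> transversal B y0"

definition cell :: "'v set \<Rightarrow> 'v \<Rightarrow> ('v \<times> 'v) set" where
  "cell B y0 = B \<times> {y. cosided B y0 y}"

lemma mem_cell [simp]: "(x, y) \<in> cell B y0 \<longleftrightarrow> x \<in> B \<and> cosided B y0 y"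
  by (simp add: cell_def)

lemma open_cell: "chart B y0 \<Longrightarrow> open (cell B y0)"
  unfolding cell_def chart_def by (intro open_Times open_cosided) auto

lemma convex_cell: "chart B y0 \<Longrightarrow> convex (cell B y0)"
  unfolding cell_def chart_def by (intro convex_Times convex_cosided) auto

lemma cell_joined:
  assumes "chart B y0" "(x, y) \<in> cell B y0" "a \<in> B"
  shows "joined y x a"
proof -
  have "closed_segment x a \<subseteq> B" using assms by (intro closed_segment_subset) (auto simp: chart_def)
  moreover have "transversal B y" using assms(2) cosided_transversal by auto
  ultimately show ?thesis unfolding joined_iff_transversal by (rule transversal_subset[rotated])
qed

lemma cell_subset_M: "chart B y0 \<Longrightarrow> cell B y0 \<subseteq> M"
proof
  fix w assume c: "chart B y0" and w: "w \<in> cell B y0"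
  obtain x y where xy: "w = (x, y)" by (cases w)
  have "joined y x x" using cell_joined[OF c w[unfolded xy]] w xy by simp
  then show "w \<in> M" unfolding xy joined_refl .
qed

lemma ex_chart:
  assumes "compact T" "convex T" "transversal T y"
  obtains B where "chart B y" "T \<times> {y} \<subseteq> cell B y" "T \<subseteq> B" "{H\<in>\<A>. H \<inter> B \<noteq> {}} = {H\<in>\<A>. H \<inter> T \<noteq> {}}"
proof -
  obtain B where B: "open B" "convex B" "T \<subseteq> B" "{H\<in>\<A>. H \<inter> B \<noteq> {}} = {H\<in>\<A>. H \<inter> T \<noteq> {}}"
    "finite {H\<in>\<A>. H \<inter> B \<noteq> {}}"
    by (rule convex_neighbourhood[OF assms(1,2)])
  have t: "transversal B y" unfolding transversal_def
  proof (intro ballI impI)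
    fix H assume "H \<in> \<A>" "H \<inter> B \<noteq> {}"
    then have "H \<in> {H\<in>\<A>. H \<inter> T \<noteq> {}}" unfolding B(4)[symmetric] by simp
    then show "normal H y \<noteq> 0" using assms(3) unfolding transversal_def by blast
  qed
  have "T \<times> {y} \<subseteq> cell B y" using B(3) cosided_refl[OF t] by (auto simp: cell_def)
  moreover have "chart B y" using B(1,2,5) t by (simp add: chart_def)
  ultimately show thesis using that B(3,4) by blast
qed

definition charts :: "('v \<times> 'v) set set" where
  "charts = {cell B y0 | B y0. chart B y0}"

lemma charts_cover: "M \<subseteq> \<Union>charts"
proof
  fix w assume "w \<in> M"
  then obtain x y where w: "w = (x, y)" "transversal {x} y" by (cases w) (auto simp: mem_M)
  obtain B where B: "chart B y" "{x} \<times> {y} \<subseteq> cell B y"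
    by (rule ex_chart[OF compact_sing convex_singleton w(2)])
  then have "w \<in> cell B y" using w(1) by blast
  then show "w \<in> \<Union>charts" using B(1) unfolding charts_def by blast
qed

text \<open>The vertex to which a point is sent by the functor to \<open>\<Gamma>\<close>. Taking \<open>x\<close> itself whenever it is a vertex
  makes this functor a strict left inverse of \<open>\<Phi>\<close>.\<close>

definition base :: "'v \<times> 'v \<Rightarrow> 'v" where
  "base w = (if fst w \<notin> \<Union>\<A> then fst w else SOME a. a \<notin> \<Union>\<A> \<and> joined (snd w) (fst w) a)"

lemma base_vertex [simp]: "a \<notin> \<Union>\<A> \<Longrightarrow> base (a, y) = a"
  by (simp add: base_def)

lemma base_joined:
  assumes "(x, y) \<in> M"
  shows "base (x, y) \<notin> \<Union>\<A> \<and> joined y x (base (x, y))"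
proof (cases "x \<in> \<Union>\<A>")
  case True
  obtain B where B: "chart B y" "{x} \<times> {y} \<subseteq> cell B y" "{x} \<subseteq> B"
    using assms by (rule ex_chart[OF compact_sing convex_singleton, unfolded mem_M[symmetric]])
  obtain t where "x + t *\<^sub>R y \<in> B" "x + t *\<^sub>R y \<notin> \<Union>\<A>"
  proof -
    have "open B" "x \<in> B" using B by (simp_all add: chart_def)
    then show thesis using assms that by (rule vertex_near)
  qed
  moreover then have "joined y x (x + t *\<^sub>R y)" using cell_joined B by blast
  ultimately have "\<exists>a. a \<notin> \<Union>\<A> \<and> joined y x a" by blast
  then have "(SOME a. a \<notin> \<Union>\<A> \<and> joined y x a) \<notin> \<Union>\<A> \<and> joined y x (SOME a. a \<notin> \<Union>\<A> \<and> joined y x a)"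
    by (rule someI_ex)
  moreover have "base (x, y) = (SOME a. a \<notin> \<Union>\<A> \<and> joined y x a)" using True by (simp add: base_def)
  ultimately show ?thesis by metis
next
  case False
  then show ?thesis using joined_vertex by simp
qed

text \<open>The transport from \<open>w\<close> to \<open>w'\<close> by way of a vertex \<open>a\<close>: up to \<open>a\<close> in the direction of the first point,
  from there on in the direction of the second one.\<close>

definition hop :: "'v \<times> 'v \<Rightarrow> 'v \<times> 'v \<Rightarrow> 'v \<Rightarrow> ('v, 'v edge) word_arrow" where
  "hop w w' a = Comp \<Gamma>V (transition (snd w) (base w) a) (transition (snd w') a (base w'))"

lemma cell_base:
  assumes "chart B y0" "(x, y) \<in> cell B y0" "a \<in> B"
  shows "base (x, y) \<notin> \<Union>\<A>" "joined y (base (x, y)) a" "joined y a (base (x, y))"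
proof -
  have b: "base (x, y) \<notin> \<Union>\<A>" "joined y x (base (x, y))"
    using base_joined cell_subset_M assms by blast+
  have "joined y (base (x, y)) a"
    by (rule joined_trans[OF joined_sym[OF b(2)] cell_joined[OF assms]])
  then show "base (x, y) \<notin> \<Union>\<A>" "joined y (base (x, y)) a" "joined y a (base (x, y))"
    using b joined_sym by blast+
qed

lemma cell_transition_eq:
  assumes c: "chart B y0" and y: "cosided B y0 y" "cosided B y0 y'"
    and a: "a \<in> B" "a \<notin> \<Union>\<A>" and b: "b \<in> B" "b \<notin> \<Union>\<A>"
  shows "transition y a b = transition y' a b"
proof -
  have "closed_segment a b \<subseteq> B" using c a(1) b(1) by (intro closed_segment_subset) (auto simp: chart_def)
  then have "cosided (closed_segment a b) y y'"
    using cosided_trans[OF cosided_sym[OF y(1)] y(2)] cosided_subset by blast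
  then show ?thesis using transition_cong a(2) b(2) by blast
qed

text \<open>Between two vertices of the chart the directions of \<open>w\<close> and \<open>w'\<close> give the same transition, so it can
  be shifted from one half of the hop to the other.\<close>

lemma hop_independent:
  assumes c: "chart B y0" and w: "w \<in> cell B y0" "w' \<in> cell B y0"
    and a: "a \<in> B" "a \<notin> \<Union>\<A>" and b: "b \<in> B" "b \<notin> \<Union>\<A>"
  shows "hop w w' a = hop w w' b"
proof -
  obtain x y where xy: "w = (x, y)" by (cases w)
  obtain x' y' where xy': "w' = (x', y')" by (cases w')
  have sw: "snd w = y" "snd w' = y'" by (simp_all add: xy xy')
  have wc: "cosided B y0 y" "cosided B y0 y'" using w by (simp_all add: xy xy')
  note wa = cell_base[OF c w(1)[unfolded xy], folded xy] and wb = cell_base[OF c w(2)[unfolded xy'], folded xy']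
  have j: "joined y a b" "joined y' a b"
    by (rule joined_trans[OF wa(3)[OF a(1)] wa(2)[OF b(1)]], rule joined_trans[OF wb(3)[OF a(1)] wb(2)[OF b(1)]])
  have "hop w w' b = Comp \<Gamma>V (Comp \<Gamma>V (transition y (base w) a) (transition y a b)) (transition y' b (base w'))"
    unfolding hop_def sw transition_comp[OF wa(1)[OF a(1)] a(2) b(2) wa(2)[OF a(1)] j(1)] by (rule refl)
  also have "\<dots> = Comp \<Gamma>V (transition y (base w) a) (Comp \<Gamma>V (transition y a b) (transition y' b (base w')))"
    by (intro \<Gamma>.comp_assoc transition_arr wa(1)[OF a(1)] wb(1)[OF a(1)] wa(2)[OF a(1)] wb(3)[OF b(1)] a(2) b(2) j) simp_all
  also have "transition y a b = transition y' a b"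
    by (rule cell_transition_eq[OF c wc a b])
  also have "Comp \<Gamma>V (transition y' a b) (transition y' b (base w')) = transition y' a (base w')"
    by (rule transition_comp[OF a(2) b(2) wb(1)[OF a(1)] j(2) wb(3)[OF b(1)]])
  finally show ?thesis unfolding hop_def sw by (rule sym)
qed

definition local_arrow :: "'v \<times> 'v \<Rightarrow> 'v \<times> 'v \<Rightarrow> ('v, 'v edge) word_arrow" where
  "local_arrow w w' = hop w w' (SOME a. a \<notin> \<Union>\<A> \<and>
     (\<exists>B y0. chart B y0 \<and> w \<in> cell B y0 \<and> w' \<in> cell B y0 \<and> a \<in> B))"

text \<open>Two charts containing \<open>w\<close> have a common vertex near \<open>w\<close>, and the hops in both charts agree with the
  one by way of that vertex.\<close>

lemma local_arrow_eq:
  assumes c: "chart B y0" and w: "w \<in> cell B y0" "w' \<in> cell B y0" and a: "a \<in> B" "a \<notin> \<Union>\<A>"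
  shows "local_arrow w w' = hop w w' a"
proof -
  define b where "b = (SOME a. a \<notin> \<Union>\<A> \<and>
     (\<exists>B y0. chart B y0 \<and> w \<in> cell B y0 \<and> w' \<in> cell B y0 \<and> a \<in> B))"
  have "b \<notin> \<Union>\<A> \<and> (\<exists>B y0. chart B y0 \<and> w \<in> cell B y0 \<and> w' \<in> cell B y0 \<and> b \<in> B)"
    unfolding b_def by (rule someI[of _ a]) (use assms in blast)
  then obtain B' y0' where b: "b \<notin> \<Union>\<A>" "chart B' y0'" "w \<in> cell B' y0'" "w' \<in> cell B' y0'" "b \<in> B'"
    by blast
  obtain x y where xy: "w = (x, y)" by (cases w)
  have "open (B \<inter> B')" "x \<in> B \<inter> B'" "(x, y) \<in> M"
    using c b w cell_subset_M[OF c] unfolding xy by (auto simp: chart_def)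
  then obtain t where "x + t *\<^sub>R y \<in> B \<inter> B'" "x + t *\<^sub>R y \<notin> \<Union>\<A>"
    by (rule vertex_near)
  then obtain d where d: "d \<in> B" "d \<in> B'" "d \<notin> \<Union>\<A>" by blast
  have "hop w w' b = hop w w' d" by (rule hop_independent[OF b(2,3,4,5,1) d(2,3)])
  also have "\<dots> = hop w w' a" by (rule hop_independent[OF c w d(1,3) a])
  finally show ?thesis by (simp add: local_arrow_def b_def)
qed

lemma cell_vertex:
  assumes "chart B y0" "w \<in> cell B y0"
  obtains a where "a \<in> B" "a \<notin> \<Union>\<A>"
proof -
  obtain x y where xy: "w = (x, y)" by (cases w)
  have "open B" "x \<in> B" "(x, y) \<in> M"
    using assms cell_subset_M[OF assms(1)] unfolding xy by (auto simp: chart_def)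
  then obtain t where "x + t *\<^sub>R y \<in> B" "x + t *\<^sub>R y \<notin> \<Union>\<A>" by (rule vertex_near)
  then show thesis by (rule that)
qed

lemma local_transport_charts:
  "local_transport \<Gamma>V (top_of_set M) charts base local_arrow"
proof
  fix U assume "U \<in> charts"
  then obtain B y0 where U: "U = cell B y0" "chart B y0" unfolding charts_def by blast
  have "open U" "U \<subseteq> M" using U open_cell cell_subset_M by simp_all
  then show "openin (top_of_set M) U" by (simp add: open_subset)
  fix w w' assume w: "w \<in> U" "w' \<in> U"
  obtain a where a: "a \<in> B" "a \<notin> \<Union>\<A>" by (rule cell_vertex[OF U(2) w(1)[unfolded U(1)]])
  obtain x y x' y' where xy: "w = (x, y)" "w' = (x', y')" by (cases w, cases w') auto
  note wa = cell_base[OF U(2) w(1)[unfolded U(1) xy] a(1)] and wb = cell_base[OF U(2) w(2)[unfolded U(1) xy] a(1)]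
  have arr: "transition y (base w) a \<in> Arr \<Gamma>V" "transition y' a (base w') \<in> Arr \<Gamma>V"
    using wa wb a(2) unfolding xy by (intro transition_arr; blast)+
  have sw: "snd w = y" "snd w' = y'" by (simp_all add: xy)
  have eq: "local_arrow w w' = hop w w' a" using local_arrow_eq[OF U(2) _ _ a] w U(1) by blast
  show "local_arrow w w' \<in> Arr \<Gamma>V \<and> Dom \<Gamma>V (local_arrow w w') = base w \<and>
      Cod \<Gamma>V (local_arrow w w') = base w'"
    unfolding eq hop_def sw using arr by simp
  fix w'' assume w'': "w'' \<in> U"
  obtain x'' y'' where xy'': "w'' = (x'', y'')" by (cases w'')
  note wc = cell_base[OF U(2) w''[unfolded U(1) xy''] a(1)]
  have arr'': "transition y'' a (base w'') \<in> Arr \<Gamma>V" "transition y' (base w') a \<in> Arr \<Gamma>V"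
    using wc wb a(2) unfolding xy xy'' by (intro transition_arr; blast)+
  have eq': "local_arrow w' w'' = hop w' w'' a" "local_arrow w w'' = hop w w'' a"
    using local_arrow_eq[OF U(2) _ _ a] w w'' U(1) by blast+
  have cancel: "Comp \<Gamma>V (transition y' a (base w')) (transition y' (base w') a) = Ident \<Gamma>V a"
    using transition_comp[OF a(2) wb(1) a(2) wb(3,2)] transition_refl[OF a(2)] by (simp only: xy)
  have sw'': "snd w'' = y''" by (simp add: xy'')
  have "Comp \<Gamma>V (hop w w' a) (hop w' w'' a) = Comp \<Gamma>V (transition y (base w) a)
     (Comp \<Gamma>V (Comp \<Gamma>V (transition y' a (base w')) (transition y' (base w') a)) (transition y'' a (base w'')))"
    unfolding hop_def sw sw'' using arr arr'' by (simp add: \<Gamma>.comp_assoc del: \<Gamma>.comp_Inv_cancel)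
  also have "\<dots> = hop w w'' a" unfolding cancel hop_def sw sw'' using arr'' by simp
  finally show "Comp \<Gamma>V (local_arrow w w') (local_arrow w' w'') = local_arrow w w''"
    unfolding eq eq' .
qed (simp add: charts_cover)

interpretation T: local_transport "\<Gamma> \<A> Vgen" "top_of_set M" charts base local_arrow
  by (rule local_transport_charts)

end

section \<open>Straight paths in the complement\<close>

context lattice_arrangement
begin

interpretation \<Gamma>: groupoid "\<Gamma> \<A> Vgen"
  unfolding \<Gamma>_def by (rule groupoid_presented)

interpretation T: local_transport "\<Gamma> \<A> Vgen" "top_of_set M" charts base local_arrow
  by (rule local_transport_charts)

abbreviation PiM :: "('v \<times> 'v, ('v \<times> 'v) path_arrow) gpd" where
  "PiM \<equiv> fundamental_groupoid (top_of_set M)"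

interpretation P: groupoid PiM
  by (rule groupoid_fundamental)

declare fundamental_groupoid_simps(4) [simp del] presented_groupoid_simps(4) [simp del]

definition line :: "'v \<times> 'v \<Rightarrow> 'v \<times> 'v \<Rightarrow> ('v \<times> 'v) path_arrow" where
  "line u v = path_class (top_of_set M) (linepath u v)"

lemma pathin_M: "pathin (top_of_set M) p \<longleftrightarrow> continuous_on {0..1} p \<and> p ` {0..1} \<subseteq> M"
  unfolding pathin_def by auto

lemma pathin_linepath: "closed_segment u v \<subseteq> M \<Longrightarrow> pathin (top_of_set M) (linepath u v)"
  unfolding pathin_M linepath_image_01 by (simp add: continuous_on_linepath)

lemma line_ends [simp]: "Dom PiM (line u v) = u" "Cod PiM (line u v) = v"
  by (simp_all add: line_def linepath_def)

lemma line_arr: "closed_segment u v \<subseteq> M \<Longrightarrow> line u v \<in> Arr PiM"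
  unfolding line_def by (simp add: pathin_linepath)

lemma line_convex_arr: "\<lbrakk>convex K; K \<subseteq> M; u \<in> K; v \<in> K\<rbrakk> \<Longrightarrow> line u v \<in> Arr PiM"
  using closed_segment_subset[of u K v] by (intro line_arr) auto

lemma path_class_convex:
  assumes K: "convex K" "K \<subseteq> M"
    and p: "continuous_on {0..1} p" "p ` {0..1} \<subseteq> K" and q: "continuous_on {0..1} q" "q ` {0..1} \<subseteq> K"
    and ends: "p 0 = q 0" "p 1 = q 1"
  shows "path_class (top_of_set M) p = path_class (top_of_set M) q"
proof -
  have "continuous_map (top_of_set K) (top_of_set M) id" using K(2) by auto
  from path_homotopic_through_convex[OF K(1) this p q ends] show ?thesis
    by (intro path_class_eqI) simp
qed

lemma path_class_eq_line:
  assumes K: "convex K" "K \<subseteq> M" and p: "continuous_on {0..1} p" "p ` {0..1} \<subseteq> K"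
  shows "path_class (top_of_set M) p = line (p 0) (p 1)"
  unfolding line_def
proof (rule path_class_convex[OF K p])
  show "linepath (p 0) (p 1) ` {0..1} \<subseteq> K"
    unfolding linepath_image_01 using p(2) K(1) by (intro closed_segment_subset) auto
qed (rule continuous_on_linepath, simp_all add: linepath_def)

lemma line_comp:
  assumes K: "convex K" "K \<subseteq> M" and "u \<in> K" "v \<in> K" "w \<in> K"
  shows "Comp PiM (line u v) (line v w) = line u w"
proof -
  have seg: "closed_segment u v \<subseteq> K" "closed_segment v w \<subseteq> K"
    by (rule closed_segment_subset[OF assms(3,4) K(1)], rule closed_segment_subset[OF assms(4,5) K(1)])
  then have "pathin (top_of_set K) (linepath u v)" "pathin (top_of_set K) (linepath v w)"
    unfolding pathin_def by (simp_all add: continuous_on_linepath linepath_image_01 flip: image_subset_iff_funcset)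
  then have j: "pathin (top_of_set K) (path_join (linepath u v) (linepath v w))"
    by (rule pathin_path_join) (simp add: linepath_def)
  have "pathin (top_of_set M) (linepath u v)" "pathin (top_of_set M) (linepath v w)"
    using seg K(2) by (intro pathin_linepath; blast)+
  then have "Comp PiM (line u v) (line v w) = path_class (top_of_set M) (path_join (linepath u v) (linepath v w))"
    unfolding line_def by (rule fundamental_groupoid_Comp) (simp add: linepath_def)
  also have "\<dots> = line (path_join (linepath u v) (linepath v w) 0) (path_join (linepath u v) (linepath v w) 1)"
    using j by (intro path_class_eq_line[OF K]) (auto simp: pathin_def)
  finally show ?thesis by (simp add: linepath_def)
qed

lemma line_refl: "u \<in> M \<Longrightarrow> line u u = Ident PiM u"
  by (simp add: line_def linepath_refl fundamental_groupoid_simps(4))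

lemma fibre: "a \<notin> \<Union>\<A> \<Longrightarrow> {a} \<times> UNIV \<subseteq> M" "convex ({a::'v} \<times> (UNIV :: 'v set))"
  using real_point_mem_M by (blast, intro convex_Times) auto

lemma slab: "{b. joined y a b} \<times> {y} \<subseteq> M" "convex ({b. joined y a b} \<times> {y})"
proof -
  show "{b. joined y a b} \<times> {y} \<subseteq> M" using joined_M by blast
  show "convex ({b. joined y a b} \<times> {y})" by (intro convex_Times convex_joined) simp
qed

lemma vertical_arr: "a \<notin> \<Union>\<A> \<Longrightarrow> line (a, y) (a, y') \<in> Arr PiM"
  using fibre by (intro line_convex_arr[of "{a} \<times> UNIV"]) auto

lemma vertical_comp:
  "a \<notin> \<Union>\<A> \<Longrightarrow> Comp PiM (line (a, y) (a, y')) (line (a, y') (a, y'')) = line (a, y) (a, y'')"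
  using fibre by (intro line_comp[of "{a} \<times> UNIV"]) auto

lemma horizontal_arr: "joined y a b \<Longrightarrow> line (a, y) (b, y) \<in> Arr PiM"
  using joined_M joined_refl by (intro line_convex_arr[OF slab(2,1)[of y a]]) auto

lemma horizontal_comp:
  assumes "joined y a b" "joined y b c"
  shows "Comp PiM (line (a, y) (b, y)) (line (b, y) (c, y)) = line (a, y) (c, y)"
  using assms joined_M[OF assms(1)] joined_trans[OF assms] joined_refl
  by (intro line_comp[OF slab(2,1)[of y a]]) auto

lemma vertical_refl: "a \<notin> \<Union>\<A> \<Longrightarrow> line (a, y) (a, y) = Ident PiM (a, y)"
  by (intro line_refl real_point_mem_M)

text \<open>For generic \<open>y\<close> this is the path assigned to a move. It makes sense for every direction \<open>y\<close> in which \<open>a\<close>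
  and \<open>b\<close> are joined.\<close>

definition detour :: "'v \<Rightarrow> 'v \<Rightarrow> 'v \<Rightarrow> ('v \<times> 'v) path_arrow" where
  "detour y a b = Comp PiM (line (a, 0) (a, y)) (Comp PiM (line (a, y) (b, y)) (line (b, y) (b, 0)))"

lemma detour_arr:
  assumes "a \<notin> \<Union>\<A>" "b \<notin> \<Union>\<A>" "joined y a b"
  shows "detour y a b \<in> Arr PiM" "Dom PiM (detour y a b) = (a, 0)" "Cod PiM (detour y a b) = (b, 0)"
  unfolding detour_def using vertical_arr assms(1,2) horizontal_arr[OF assms(3)] by simp_all

lemma detour_refl:
  assumes "a \<notin> \<Union>\<A>"
  shows "detour y a a = Ident PiM (a, 0)"
  unfolding detour_def vertical_comp[OF assms] by (rule vertical_refl[OF assms])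

lemma detour_comp:
  assumes v: "a \<notin> \<Union>\<A>" "b \<notin> \<Union>\<A>" "c \<notin> \<Union>\<A>" and j: "joined y a b" "joined y b c"
  shows "Comp PiM (detour y a b) (detour y b c) = detour y a c"
proof -
  have "Comp PiM (line (b, y) (b, 0)) (Comp PiM (line (b, 0) (b, y)) (Comp PiM (line (b, y) (c, y)) (line (c, y) (c, 0))))
    = Comp PiM (line (b, y) (c, y)) (line (c, y) (c, 0))" (is "?l = ?r")
  proof -
    have "?l = Comp PiM (Comp PiM (line (b, y) (b, 0)) (line (b, 0) (b, y))) ?r"
      using vertical_arr v horizontal_arr[OF j(2)] by (intro P.comp_assoc[symmetric]) simp_all
    also have "\<dots> = ?r"
      unfolding vertical_comp[OF v(2)] vertical_refl[OF v(2)]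
      using vertical_arr v horizontal_arr[OF j(2)] by (intro P.comp_ident_left) simp_all
    finally show ?thesis .
  qed
  moreover have "Comp PiM (line (a, y) (b, y)) (Comp PiM (line (b, y) (c, y)) (line (c, y) (c, 0)))
     = Comp PiM (line (a, y) (c, y)) (line (c, y) (c, 0))"
    unfolding horizontal_comp[OF j, symmetric]
    using vertical_arr v horizontal_arr[OF j(1)] horizontal_arr[OF j(2)] by (intro P.comp_assoc[symmetric]) simp_all
  ultimately show ?thesis
    unfolding detour_def
    using vertical_arr v horizontal_arr[OF j(1)] horizontal_arr[OF j(2)] by (simp add: P.comp_assoc)
qed

text \<open>The product of the segment with the set of all directions on the same sides as \<open>y\<close> is a convex
  subset of the complement that contains both horizontal pieces.\<close>

lemma detour_cong:
  assumes v: "a \<notin> \<Union>\<A>" "b \<notin> \<Union>\<A>" and c: "cosided (closed_segment a b) y y'"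
  shows "detour y a b = detour y' a b"
proof -
  let ?K = "closed_segment a b \<times> {z. cosided (closed_segment a b) y z}"
  have K: "convex ?K" by (intro convex_Times convex_cosided convex_closed_segment)
  have KM: "?K \<subseteq> M"
  proof
    fix w assume w: "w \<in> ?K"
    obtain x z where xz: "w = (x, z)" by (cases w)
    then have "x \<in> closed_segment a b" "cosided (closed_segment a b) y z" using w by simp_all
    then have "transversal {x} z" using cosided_transversal transversal_subset by blast
    then show "w \<in> M" unfolding xz mem_M .
  qed
  have yy: "cosided (closed_segment a b) y y" using cosided_refl cosided_transversal[OF c] by blast
  have in_K: "(a, y) \<in> ?K" "(b, y) \<in> ?K" "(a, y') \<in> ?K" "(b, y') \<in> ?K" using yy c by simp_all
  have arr: "line (a, y) (b, y) \<in> Arr PiM" "line (a, y') (b, y') \<in> Arr PiM"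
    "line (a, y) (a, y') \<in> Arr PiM" "line (b, y) (b, y') \<in> Arr PiM"
    "line (b, y') (b, 0) \<in> Arr PiM" "line (b, y) (b, 0) \<in> Arr PiM" "line (a, 0) (a, y) \<in> Arr PiM"
    using line_convex_arr[OF K KM] in_K vertical_arr v by simp_all
  have square: "Comp PiM (line (a, y) (a, y')) (line (a, y') (b, y')) = Comp PiM (line (a, y) (b, y)) (line (b, y) (b, y'))"
    using line_comp[OF K KM in_K(1,3,4)] line_comp[OF K KM in_K(1,2,4)] by simp
  have "detour y' a b = Comp PiM (Comp PiM (line (a, 0) (a, y)) (line (a, y) (a, y')))
      (Comp PiM (line (a, y') (b, y')) (line (b, y') (b, 0)))"
    unfolding detour_def vertical_comp[OF v(1)] by (rule refl)
  also have "\<dots> = Comp PiM (line (a, 0) (a, y))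
      (Comp PiM (Comp PiM (line (a, y) (a, y')) (line (a, y') (b, y'))) (line (b, y') (b, 0)))"
    using arr by (simp add: P.comp_assoc)
  also have "\<dots> = Comp PiM (line (a, 0) (a, y))
      (Comp PiM (line (a, y) (b, y)) (Comp PiM (line (b, y) (b, y')) (line (b, y') (b, 0))))"
    unfolding square using arr by (simp add: P.comp_assoc)
  also have "\<dots> = detour y a b" unfolding detour_def vertical_comp[OF v(2)] by (rule refl)
  finally show ?thesis by (rule sym)
qed

lemma \<Gamma>_functors_agree:
  assumes "groupoid_functor \<Gamma>V D F" "groupoid_functor \<Gamma>V D F'"
    and obj: "\<And>a. a \<notin> \<Union>\<A> \<Longrightarrow> onObj F a = onObj F' a"
    and arr: "\<And>a l b. valid_move \<A> Vgen a l b \<Longrightarrow> onArr F (move_arrow a l b) = onArr F' (move_arrow a l b)"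
  shows "functor_eq \<Gamma>V F F'"
  unfolding \<Gamma>_def
proof (rule presented_functors_agree[OF assms(1,2)[unfolded \<Gamma>_def]])
  fix e assume "e \<in> arcs (\<Gamma>_graph \<A> Vgen)"
  then obtain a l b where "e = Move a l b" "valid_move \<A> Vgen a l b"
    unfolding \<Gamma>_graph_simps(4) by blast
  then show "onArr F (edge_arrow (\<Gamma>_graph \<A> Vgen) (\<Gamma>_rel \<A>) e) = onArr F' (edge_arrow (\<Gamma>_graph \<A> Vgen) (\<Gamma>_rel \<A>) e)"
    using arr unfolding move_arrow_def by blast
qed (use obj in simp)

section \<open>The functor to the fundamental groupoid\<close>

lemma path_class_\<Phi>_path:
  assumes v: "a \<notin> \<Union>\<A>" "b \<notin> \<Union>\<A>" and j: "joined y a b"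
  shows "pathin (top_of_set M) (\<Phi>_path (Move a y b))"
    "path_class (top_of_set M) (\<Phi>_path (Move a y b)) = detour y a b"
proof -
  have join: "p +++ q = path_join p q" for p q :: "real \<Rightarrow> 'v \<times> 'v"
    by (simp add: joinpaths_def path_join_def)
  have seg: "closed_segment (a, 0) (a, y) \<subseteq> M" "closed_segment (b, y) (b, 0) \<subseteq> M" "closed_segment (a, y) (b, y) \<subseteq> M"
  proof -
    show "closed_segment (a, 0) (a, y) \<subseteq> M" "closed_segment (b, y) (b, 0) \<subseteq> M"
      by (rule order_trans[OF closed_segment_subset[OF _ _ fibre(2)] fibre(1)]; use v in simp)+
    show "closed_segment (a, y) (b, y) \<subseteq> M"
      by (rule order_trans[OF closed_segment_subset[OF _ _ slab(2)[of y a]] slab(1)])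
        (use j joined_M[OF j] joined_refl in simp_all)
  qed
  note path = seg[THEN pathin_linepath]
  have tail: "pathin (top_of_set M) (path_join (linepath (a, y) (b, y)) (linepath (b, y) (b, 0)))"
    by (rule pathin_path_join[OF path(3,2)]) (simp add: linepath_def)
  show "pathin (top_of_set M) (\<Phi>_path (Move a y b))"
    unfolding \<Phi>_path.simps join
    by (rule pathin_path_join[OF path(1) tail]) (simp add: linepath_def)
  show "path_class (top_of_set M) (\<Phi>_path (Move a y b)) = detour y a b"
    unfolding \<Phi>_path.simps join detour_def line_def
    by (subst fundamental_groupoid_Comp[OF path(3,2)], simp add: linepath_def,
        subst fundamental_groupoid_Comp[OF path(1) tail], simp add: linepath_def, rule refl)
qed

text \<open>The three relations of \<open>\<Gamma>\<close> hold by \<open>detour_refl\<close>, \<open>detour_comp\<close> and \<open>detour_cong\<close>.\<close>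

lemma edge_assignment_\<Phi>:
  "edge_assignment (\<Gamma>_graph \<A> Vgen) (\<Gamma>_rel \<A>) PiM (\<lambda>\<delta>. (\<delta>, 0)) (\<lambda>e. path_class (top_of_set M) (\<Phi>_path e))"
proof
  let ?\<psi> = "\<lambda>e. path_class (top_of_set M) (\<Phi>_path e)"
  let ?e = "\<lambda>a w. eval_word PiM (\<lambda>\<delta>. (\<delta>, 0)) ?\<psi> a (\<Gamma>_graph \<A> Vgen) w"
  have move: "valid_move \<A> Vgen a l b \<Longrightarrow> ?\<psi> (Move a l b) = detour l a b" for a l b
    using path_class_\<Phi>_path unfolding valid_move_iff by blast
  fix a assume "a \<in> verts (\<Gamma>_graph \<A> Vgen)"
  then show "(a, 0) \<in> Obj PiM" by (simp add: real_point_mem_M)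
next
  fix e assume "e \<in> arcs (\<Gamma>_graph \<A> Vgen)"
  then obtain a l b where e: "e = Move a l b" "valid_move \<A> Vgen a l b" by auto
  then show "path_class (top_of_set M) (\<Phi>_path e) \<in> Arr PiM \<and>
      Dom PiM (path_class (top_of_set M) (\<Phi>_path e)) = (tail (\<Gamma>_graph \<A> Vgen) e, 0) \<and>
      Cod PiM (path_class (top_of_set M) (\<Phi>_path e)) = (head (\<Gamma>_graph \<A> Vgen) e, 0)"
    using path_class_\<Phi>_path detour_arr unfolding valid_move_iff by simp
next
  let ?\<psi> = "\<lambda>e. path_class (top_of_set M) (\<Phi>_path e)"
  let ?e = "\<lambda>a w. eval_word PiM (\<lambda>\<delta>. (\<delta>, 0)) ?\<psi> a (\<Gamma>_graph \<A> Vgen) w"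
  have move: "?\<psi> (Move a l b) = detour l a b" "detour l a b \<in> Arr PiM"
    "Dom PiM (detour l a b) = (a, 0)" "Cod PiM (detour l a b) = (b, 0)"
    if "valid_move \<A> Vgen a l b" for a l b
    using path_class_\<Phi>_path(2) detour_arr that unfolding valid_move_iff by blast+
  have one: "?e a [(Move a l b, True)] = detour l a b" if "valid_move \<A> Vgen a l b" for a l b
    using move[OF that] by (simp del: \<Phi>_path.simps)
  fix w w' a b
  assume "\<Gamma>_rel \<A> w w'" and w: "word_from_to (\<Gamma>_graph \<A> Vgen) a w b" "word_from_to (\<Gamma>_graph \<A> Vgen) a w' b"
  then show "?e a w = ?e a w'"
  proof cases
    case (stay \<delta> l)
    then have v: "valid_move \<A> Vgen \<delta> l \<delta>" "a = \<delta>" "\<delta> \<notin> \<Union>\<A>" using w by (auto simp: valid_move_iff)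
    have "?e a w = Ident PiM (\<delta>, 0)" unfolding stay v(2) one[OF v(1)] by (rule detour_refl[OF v(3)])
    then show ?thesis by (simp add: stay v(2))
  next
    case (subdivide \<delta> l \<delta>'' \<delta>')
    then have v: "valid_move \<A> Vgen \<delta> l \<delta>''" "valid_move \<A> Vgen \<delta> l \<delta>'" "valid_move \<A> Vgen \<delta>' l \<delta>''" "a = \<delta>"
      using w by auto
    have "?e a w' = Comp PiM (detour l \<delta> \<delta>') (detour l \<delta>' \<delta>'')"
      using move[OF v(2)] move[OF v(3)] unfolding subdivide v(4) by (simp del: \<Phi>_path.simps)
    also have "\<dots> = detour l \<delta> \<delta>''" using v(1-3) unfolding valid_move_iff by (intro detour_comp) blast+
    finally show ?thesis using one[OF v(1)] unfolding subdivide v(4) by simp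
  next
    case (relabel \<delta> \<delta>' l l')
    then have v: "valid_move \<A> Vgen \<delta> l \<delta>'" "valid_move \<A> Vgen \<delta> l' \<delta>'" "a = \<delta>" using w by auto
    have "cosided (closed_segment \<delta> \<delta>') l l'"
      using same_orientation_iff_cosided[of "closed_segment \<delta> \<delta>'" l l'] relabel(3) v(1)
      unfolding valid_move_iff joined_iff_transversal by blast
    then have "detour l \<delta> \<delta>' = detour l' \<delta> \<delta>'" using v(1) unfolding valid_move_iff by (intro detour_cong) blast+
    then show ?thesis unfolding relabel v(3) one[OF v(1)] one[OF v(2)] .
  qed
qed

interpretation E: edge_assignment "\<Gamma>_graph \<A> Vgen" "\<Gamma>_rel \<A>" PiM "\<lambda>\<delta>. (\<delta>, 0)"
    "\<lambda>e. path_class (top_of_set M) (\<Phi>_path e)"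
  by (rule edge_assignment_\<Phi>)

lemma \<Phi>_eq: "\<Phi> \<A> Vgen = functor_from_edges (\<Gamma>_graph \<A> Vgen) PiM (\<lambda>\<delta>. (\<delta>, 0)) (\<lambda>e. path_class (top_of_set M) (\<Phi>_path e))"
  unfolding \<Phi>_def arr_complement_eq ..

lemma groupoid_functor_\<Phi>: "groupoid_functor \<Gamma>V PiM (\<Phi> \<A> Vgen)"
  unfolding \<Phi>_eq \<Gamma>_def by (rule E.groupoid_functor_from_edges)

interpretation F: groupoid_functor "\<Gamma> \<A> Vgen" PiM "\<Phi> \<A> Vgen"
  by (rule groupoid_functor_\<Phi>)

lemma onObj_\<Phi> [simp]: "onObj (\<Phi> \<A> Vgen) a = (a, 0)"
  unfolding \<Phi>_eq by simp

lemma \<Phi>_move_arrow: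
  assumes "valid_move \<A> Vgen a l b"
  shows "onArr (\<Phi> \<A> Vgen) (move_arrow a l b) = detour l a b"
proof -
  have v: "a \<notin> \<Union>\<A>" "b \<notin> \<Union>\<A>" "joined l a b" using assms unfolding valid_move_iff by blast+
  have "onArr (\<Phi> \<A> Vgen) (move_arrow a l b) = path_class (top_of_set M) (\<Phi>_path (Move a l b))"
    unfolding \<Phi>_eq move_arrow_def using assms v(1,2) by (intro E.functor_from_edges_edge_arrow) auto
  then show ?thesis using path_class_\<Phi>_path(2)[OF v] by simp
qed

lemma \<Phi>_transition:
  assumes v: "a \<notin> \<Union>\<A>" "b \<notin> \<Union>\<A>" and j: "joined y a b"
  shows "onArr (\<Phi> \<A> Vgen) (transition y a b) = detour y a b"
proof -
  obtain l where l: "l \<in> Vgen" "cosided (closed_segment a b) y l"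
    by (rule ex_transition_label[OF j])
  show ?thesis
    unfolding transition_eq[OF v l] \<Phi>_move_arrow[OF valid_move_cosided[OF v l]]
    by (rule detour_cong[OF v l(2), symmetric])
qed

section \<open>The combinatorial and the topological groupoid are equivalent\<close>

text \<open>The two vertical pieces of a detour lie in charts which no hyperplane meets, so transport along them
  is trivial. The horizontal piece lies in one chart around the segment from \<open>a\<close> to \<open>b\<close>.\<close>

lemma transport_\<Phi>:
  assumes "f \<in> Arr \<Gamma>V"
  shows "onArr T.transport_functor (onArr (\<Phi> \<A> Vgen) f) = f"
proof -
  interpret TF: groupoid_functor PiM "\<Gamma> \<A> Vgen" T.transport_functor
    by (rule T.groupoid_functor_transport)
  have TFF: "groupoid_functor \<Gamma>V \<Gamma>V (functor_comp T.transport_functor (\<Phi> \<A> Vgen))"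
    by (rule groupoid_functor_comp[OF groupoid_functor_\<Phi> T.groupoid_functor_transport])
  have idf: "groupoid_functor \<Gamma>V \<Gamma>V functor_id"
    by unfold_locales (simp_all add: functor_id_def)
  have in_chart: "onArr T.transport_functor (line u v) = hop u v a"
    if "chart B y0" "u \<in> cell B y0" "v \<in> cell B y0" "a \<in> B" "a \<notin> \<Union>\<A>" for B y0 u v a
  proof -
    have "closed_segment u v \<subseteq> cell B y0" by (rule closed_segment_subset[OF that(2,3) convex_cell[OF that(1)]])
    moreover have "cell B y0 \<subseteq> M" by (rule cell_subset_M[OF that(1)])
    ultimately have "pathin (top_of_set M) (linepath u v)" by (intro pathin_linepath) blast
    moreover have "T.transport (linepath u v) = local_arrow (linepath u v 0) (linepath u v 1)"
      using \<open>closed_segment u v \<subseteq> cell B y0\<close> that(1)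
      by (intro T.transport_in_chart[of "cell B y0"]) (auto simp: charts_def linepath_image_01)
    ultimately show ?thesis
      using local_arrow_eq[OF that] by (simp add: line_def T.transport_functor_path_class linepath_def)
  qed
  have vertical: "onArr T.transport_functor (line (a, y) (a, y')) = Ident \<Gamma>V a" if a: "a \<notin> \<Union>\<A>" for a y y'
  proof -
    have none: "{H\<in>\<A>. H \<inter> {a} \<noteq> {}} = {}" using a by blast
    then have "transversal {a} 0" unfolding transversal_def by blast
    then obtain B where B: "chart B 0" "{a} \<subseteq> B" "{H\<in>\<A>. H \<inter> B \<noteq> {}} = {H\<in>\<A>. H \<inter> {a} \<noteq> {}}"
      by (rule ex_chart[OF compact_sing convex_singleton])
    have "cosided B 0 z" for z using B(3) none unfolding cosided_def by blast
    then have "onArr T.transport_functor (line (a, y) (a, y')) = hop (a, y) (a, y') a"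
      using B(1,2) a by (intro in_chart[of B 0]) auto
    then show ?thesis using a by (simp add: hop_def transition_refl)
  qed
  have horizontal: "onArr T.transport_functor (line (a, l) (b, l)) = move_arrow a l b"
    if m: "valid_move \<A> Vgen a l b" for a l b
  proof -
    have v: "a \<notin> \<Union>\<A>" "b \<notin> \<Union>\<A>" "l \<in> Vgen" and t: "transversal (closed_segment a b) l"
      using m unfolding valid_move_iff joined_iff_transversal by blast+
    obtain B where B: "chart B l" "closed_segment a b \<times> {l} \<subseteq> cell B l" "closed_segment a b \<subseteq> B"
      by (rule ex_chart[OF compact_segment convex_closed_segment t])
    have "(a, l) \<in> cell B l" "(b, l) \<in> cell B l" "a \<in> B"
      using B(2,3) ends_in_segment by blast+
    then have "onArr T.transport_functor (line (a, l) (b, l)) = hop (a, l) (b, l) a"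
      using v(1) by (intro in_chart[OF B(1)])
    also have "\<dots> = transition l a b"
    proof -
      have "transition l a b \<in> Arr \<Gamma>V"
        using v t by (intro transition_arr) (simp_all add: joined_iff_transversal)
      then show ?thesis using v by (simp add: hop_def transition_refl)
    qed
    also have "\<dots> = move_arrow a l b"
      by (rule transition_eq[OF v cosided_refl[OF t]])
    finally show ?thesis .
  qed
  have gen: "onArr T.transport_functor (detour l a b) = move_arrow a l b" if m: "valid_move \<A> Vgen a l b" for a l b
  proof -
    have v: "a \<notin> \<Union>\<A>" "b \<notin> \<Union>\<A>" "joined l a b"
      using m unfolding valid_move_iff by blast+
    show ?thesis
      unfolding detour_def
      using vertical_arr v(1,2) horizontal_arr[OF v(3)] m
      by (simp add: vertical horizontal)
  qed
  have "functor_eq \<Gamma>V (functor_comp T.transport_functor (\<Phi> \<A> Vgen)) functor_id"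
  proof (rule \<Gamma>_functors_agree[OF TFF idf])
    show "onObj (functor_comp T.transport_functor (\<Phi> \<A> Vgen)) a = onObj functor_id a" if "a \<notin> \<Union>\<A>" for a
      using that by (simp add: functor_comp_def functor_id_def)
    show "onArr (functor_comp T.transport_functor (\<Phi> \<A> Vgen)) (move_arrow a l b) = onArr functor_id (move_arrow a l b)"
      if m: "valid_move \<A> Vgen a l b" for a l b
      using gen[OF m] \<Phi>_move_arrow[OF m] by (simp add: functor_comp_def functor_id_def)
  qed
  then show ?thesis using assms by (simp add: functor_eq_def functor_comp_def functor_id_def)
qed

text \<open>The component at \<open>w\<close> of a natural transformation to \<open>\<Phi> \<circ> \<Psi>\<close>, if \<open>a\<close> is the base of \<open>w\<close>. Other vertices
  are needed to compare the descents from different points of a chart.\<close>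

definition descent :: "'v \<times> 'v \<Rightarrow> 'v \<Rightarrow> ('v \<times> 'v) path_arrow" where
  "descent w a = Comp PiM (line w (a, snd w)) (line (a, snd w) (a, 0))"

lemma descent_arr:
  assumes "a \<notin> \<Union>\<A>" "joined y x a"
  shows "descent (x, y) a \<in> Arr PiM" "Dom PiM (descent (x, y) a) = (x, y)" "Cod PiM (descent (x, y) a) = (a, 0)"
  unfolding descent_def using vertical_arr[OF assms(1)] horizontal_arr[OF assms(2)] by simp_all

lemma descent_vertex:
  assumes "a \<notin> \<Union>\<A>"
  shows "descent (a, 0) a = Ident PiM (a, 0)"
  unfolding descent_def snd_conv vertical_comp[OF assms] by (rule vertical_refl[OF assms])

lemma descent_detour:
  assumes v: "a \<notin> \<Union>\<A>" "b \<notin> \<Union>\<A>" and j: "joined y x a" "joined y a b"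
  shows "Comp PiM (descent (x, y) a) (detour y a b) = descent (x, y) b"
proof -
  note arr = vertical_arr[OF v(1)] vertical_arr[OF v(2)] horizontal_arr[OF j(1)] horizontal_arr[OF j(2)]
  have "Comp PiM (descent (x, y) a) (detour y a b) = Comp PiM (line (x, y) (a, y))
     (Comp PiM (Comp PiM (line (a, y) (a, 0)) (line (a, 0) (a, y))) (Comp PiM (line (a, y) (b, y)) (line (b, y) (b, 0))))"
    unfolding descent_def detour_def snd_conv using arr by (simp add: P.comp_assoc)
  also have "\<dots> = Comp PiM (Comp PiM (line (x, y) (a, y)) (line (a, y) (b, y))) (line (b, y) (b, 0))"
    unfolding vertical_comp[OF v(1)] vertical_refl[OF v(1)] using arr by (simp add: P.comp_assoc)
  also have "\<dots> = descent (x, y) b"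
    unfolding horizontal_comp[OF j] descent_def snd_conv by (rule refl)
  finally show ?thesis .
qed

text \<open>The naturality square of the descents, for the arrow \<open>g\<close>.\<close>

definition natural_at :: "('v \<times> 'v) path_arrow \<Rightarrow> bool" where
  "natural_at g \<longleftrightarrow> Comp PiM g (descent (Cod PiM g) (base (Cod PiM g)))
     = Comp PiM (descent (Dom PiM g) (base (Dom PiM g))) (onArr (\<Phi> \<A> Vgen) (onArr T.transport_functor g))"

lemma descent_base_arr:
  assumes "w \<in> M"
  shows "descent w (base w) \<in> Arr PiM" "Dom PiM (descent w (base w)) = w" "Cod PiM (descent w (base w)) = (base w, 0)"
proof -
  obtain x y where w: "w = (x, y)" by (cases w)
  have "base (x, y) \<notin> \<Union>\<A> \<and> joined y x (base (x, y))" using base_joined assms unfolding w by blast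
  then show "descent w (base w) \<in> Arr PiM" "Dom PiM (descent w (base w)) = w" "Cod PiM (descent w (base w)) = (base w, 0)"
    unfolding w using descent_arr by blast+
qed

text \<open>With a vertex \<open>a\<close> of the chart in the place of both bases, the square commutes as it lies in the convex
  chart and in the fibre over \<open>a\<close>. The transitions between \<open>a\<close> and the bases are accounted for by
  \<open>descent_detour\<close>.\<close>

lemma natural_at_chart:
  assumes U: "U \<in> charts" and p: "pathin (top_of_set M) p" "p ` {0..1} \<subseteq> U"
  shows "natural_at (path_class (top_of_set M) p)"
proof -
  obtain B y0 where c: "U = cell B y0" "chart B y0" using U unfolding charts_def by blast
  have K: "convex U" "U \<subseteq> M" unfolding c(1) by (rule convex_cell[OF c(2)], rule cell_subset_M[OF c(2)])
  obtain x y where w: "p 0 = (x, y)" by (cases "p 0")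
  obtain x' y' where w': "p 1 = (x', y')" by (cases "p 1")
  have wU: "(x, y) \<in> cell B y0" "(x', y') \<in> cell B y0"   proof -
    have "p 0 \<in> cell B y0" "p 1 \<in> cell B y0" using p(2) c(1) by (simp_all only: image_subset_iff) simp_all
    then show "(x, y) \<in> cell B y0" "(x', y') \<in> cell B y0" unfolding w w' .
  qed
  obtain a where a: "a \<in> B" "a \<notin> \<Union>\<A>" by (rule cell_vertex[OF c(2) wU(1)])
  let ?v = "base (x, y)" and ?v' = "base (x', y')"
  note b = cell_base[OF c(2) wU(1) a(1)] and b' = cell_base[OF c(2) wU(2) a(1)]
  have j: "joined y x a" "joined y' x' a" using cell_joined[OF c(2)] wU a(1) by blast+
  have bj: "joined y x ?v" "joined y' x' ?v'" using base_joined K(2) wU c(1) by blast+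
  have cosided: "cosided B y0 y" "cosided B y0 y'" "x \<in> B" "x' \<in> B" using wU by simp_all
  have transport: "onArr T.transport_functor (path_class (top_of_set M) p)
      = Comp \<Gamma>V (transition y ?v a) (transition y' a ?v')"
  proof -
    have "T.transport p = local_arrow (x, y) (x', y')" using T.transport_in_chart[OF U p(2)] w w' by simp
    also have "\<dots> = hop (x, y) (x', y') a" by (rule local_arrow_eq[OF c(2) wU a])
    finally show ?thesis by (simp add: T.transport_functor_path_class[OF p(1)] hop_def)
  qed
  have tarr: "transition y ?v a \<in> Arr \<Gamma>V" "transition y' a ?v' \<in> Arr \<Gamma>V"
    by (rule transition_arr[OF b(1) a(2) b(2)], rule transition_arr[OF a(2) b'(1,3)])
  have g: "path_class (top_of_set M) p = line (x, y) (x', y')"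
    using path_class_eq_line[OF K _ p(2)] p(1) w w' unfolding pathin_M by simp
  have garr: "line (x, y) (x', y') \<in> Arr PiM" using wU by (intro line_convex_arr[OF K]) (auto simp: c(1))
  note d = descent_arr[OF b(1) bj(1)] and d' = descent_arr[OF b'(1) bj(2)]
  have "Comp PiM (descent (x, y) ?v) (onArr (\<Phi> \<A> Vgen) (Comp \<Gamma>V (transition y ?v a) (transition y' a ?v')))
     = Comp PiM (Comp PiM (descent (x, y) ?v) (detour y ?v a)) (detour y' a ?v')"
    using tarr d detour_arr[OF b(1) a(2) b(2)] detour_arr[OF a(2) b'(1,3)]
    by (simp add: \<Phi>_transition[OF b(1) a(2) b(2)] \<Phi>_transition[OF a(2) b'(1,3)] P.comp_assoc)
  also have "\<dots> = Comp PiM (descent (x, y) a) (detour y' a ?v')"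
    unfolding descent_detour[OF b(1) a(2) bj(1) b(2)] by (rule refl)
  also have "descent (x, y) a = Comp PiM (line (x, y) (x', y')) (descent (x', y') a)"
  proof -
    have in_U: "(x, y) \<in> U" "(x', y') \<in> U" "(a, y) \<in> U" "(a, y') \<in> U"
      using cosided a(1) unfolding c(1) by simp_all
    note arr = line_convex_arr[OF K in_U(1,2)] line_convex_arr[OF K in_U(1,3)] line_convex_arr[OF K in_U(2,4)]
      line_convex_arr[OF K in_U(3,4)] vertical_arr[OF a(2)]
    have square: "Comp PiM (line (x, y) (x', y')) (line (x', y') (a, y')) = Comp PiM (line (x, y) (a, y)) (line (a, y) (a, y'))"
      unfolding line_comp[OF K in_U(1,2,4)] line_comp[OF K in_U(1,3,4)] by (rule refl)
    have "Comp PiM (line (x, y) (x', y')) (descent (x', y') a)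
        = Comp PiM (Comp PiM (line (x, y) (x', y')) (line (x', y') (a, y'))) (line (a, y') (a, 0))"
      unfolding descent_def snd_conv using arr by (simp add: P.comp_assoc)
    also have "\<dots> = Comp PiM (line (x, y) (a, y)) (Comp PiM (line (a, y) (a, y')) (line (a, y') (a, 0)))"
      unfolding square using arr by (simp add: P.comp_assoc)
    also have "\<dots> = descent (x, y) a" unfolding vertical_comp[OF a(2)] descent_def snd_conv by (rule refl)
    finally show ?thesis by (rule sym)
  qed
  also have "Comp PiM (Comp PiM (line (x, y) (x', y')) (descent (x', y') a)) (detour y' a ?v')
     = Comp PiM (line (x, y) (x', y')) (Comp PiM (descent (x', y') a) (detour y' a ?v'))"
    using garr descent_arr[OF a(2) j(2)] detour_arr[OF a(2) b'(1,3)] by (intro P.comp_assoc) simp_all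
  also have "Comp PiM (descent (x', y') a) (detour y' a ?v') = descent (x', y') ?v'"
    by (rule descent_detour[OF a(2) b'(1) j(2) b'(3)])
  finally show ?thesis
    unfolding natural_at_def transport unfolding g line_ends by (rule sym)
qed

lemma natural_at_all:
  assumes "g \<in> Arr PiM"
  shows "natural_at g"
proof -
  interpret TF: groupoid_functor PiM "\<Gamma> \<A> Vgen" T.transport_functor
    by (rule T.groupoid_functor_transport)
  obtain p where p: "pathin (top_of_set M) p" "g = path_class (top_of_set M) p"
    using assms by (rule fundamental_groupoid_ArrE)
  show ?thesis unfolding p(2)
  proof (rule T.path_class_induct[OF p(1)])
    fix f g assume f: "f \<in> Arr PiM" and g: "g \<in> Arr PiM" and fg: "Cod PiM f = Dom PiM g"
      and nf: "natural_at f" and ng: "natural_at g"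
    let ?d = "\<lambda>w. descent w (base w)" and ?F = "\<lambda>f. onArr (\<Phi> \<A> Vgen) (onArr T.transport_functor f)"
    have M: "Dom PiM f \<in> M" "Dom PiM g \<in> M" "Cod PiM g \<in> M"
      using P.dom_in_obj[OF f] P.dom_in_obj[OF g] P.cod_in_obj[OF g] by simp_all
    note d = descent_base_arr[OF M(1)] descent_base_arr[OF M(2)] descent_base_arr[OF M(3)]
    have F: "?F f \<in> Arr PiM" "?F g \<in> Arr PiM" "Dom PiM (?F f) = (base (Dom PiM f), 0)"
      "Cod PiM (?F f) = (base (Dom PiM g), 0)" "Dom PiM (?F g) = (base (Dom PiM g), 0)"
      "?F (Comp PiM f g) = Comp PiM (?F f) (?F g)"
      using f g fg by simp_all
    have "Comp PiM (Comp PiM f g) (?d (Cod PiM g)) = Comp PiM f (Comp PiM g (?d (Cod PiM g)))"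
      using f g fg d by (intro P.comp_assoc) simp_all
    also have "\<dots> = Comp PiM f (Comp PiM (?d (Dom PiM g)) (?F g))"
      using ng unfolding natural_at_def by simp
    also have "\<dots> = Comp PiM (Comp PiM f (?d (Dom PiM g))) (?F g)"
      using f fg d F by (intro P.comp_assoc[symmetric]) simp_all
    also have "\<dots> = Comp PiM (Comp PiM (?d (Dom PiM f)) (?F f)) (?F g)"
      using nf unfolding natural_at_def fg by simp
    also have "\<dots> = Comp PiM (?d (Dom PiM f)) (?F (Comp PiM f g))"
      unfolding F(6) using d F by (intro P.comp_assoc) simp_all
    finally show "natural_at (Comp PiM f g)"
      unfolding natural_at_def using f g fg by (simp only: P.comp_dom P.comp_cod)
  qed (rule natural_at_chart)
qed

text \<open>The descent from a vertex is trivial, so here naturality is an equation.\<close>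

lemma \<Phi>_transport:
  assumes g: "g \<in> Arr PiM" and v: "a \<notin> \<Union>\<A>" "b \<notin> \<Union>\<A>" and ends: "Dom PiM g = (a, 0)" "Cod PiM g = (b, 0)"
  shows "onArr (\<Phi> \<A> Vgen) (onArr T.transport_functor g) = g"
proof -
  interpret TF: groupoid_functor PiM "\<Gamma> \<A> Vgen" T.transport_functor
    by (rule T.groupoid_functor_transport)
  have "Comp PiM g (Ident PiM (b, 0)) = Comp PiM (Ident PiM (a, 0)) (onArr (\<Phi> \<A> Vgen) (onArr T.transport_functor g))"
    using natural_at_all[OF g] unfolding natural_at_def ends base_vertex[OF v(1)] base_vertex[OF v(2)]
      descent_vertex[OF v(1)] descent_vertex[OF v(2)] .
  then show ?thesis using g ends v(1) by simp
qed

lemma \<Phi>_faithful: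
  assumes "f \<in> Arr \<Gamma>V" "g \<in> Arr \<Gamma>V" "onArr (\<Phi> \<A> Vgen) f = onArr (\<Phi> \<A> Vgen) g"
  shows "f = g"
  by (rule trans[OF transport_\<Phi>[OF assms(1), symmetric] transport_\<Phi>[OF assms(2), folded assms(3)]])

lemma \<Phi>_full:
  assumes g: "g \<in> Arr PiM" and v: "a \<notin> \<Union>\<A>" "b \<notin> \<Union>\<A>" and ends: "Dom PiM g = (a, 0)" "Cod PiM g = (b, 0)"
  obtains f where "f \<in> Arr \<Gamma>V" "Dom \<Gamma>V f = a" "Cod \<Gamma>V f = b" "onArr (\<Phi> \<A> Vgen) f = g"
proof -
  interpret TF: groupoid_functor PiM "\<Gamma> \<A> Vgen" T.transport_functor
    by (rule T.groupoid_functor_transport)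
  have "Dom \<Gamma>V (onArr T.transport_functor g) = a" "Cod \<Gamma>V (onArr T.transport_functor g) = b"
    using g v by (simp_all add: ends)
  then show thesis
    by (rule that[OF TF.map_arr[OF g] _ _ \<Phi>_transport[OF assms]])
qed

lemma \<Phi>_essentially_surjective:
  assumes "w \<in> M"
  obtains a g where "a \<notin> \<Union>\<A>" "g \<in> Arr PiM" "Dom PiM g = w" "Cod PiM g = (a, 0)"
proof -
  obtain x y where w: "w = (x, y)" by (cases w)
  have "base w \<notin> \<Union>\<A>" using base_joined assms unfolding w by blast
  then show thesis using descent_base_arr[OF assms] by (rule that)
qed

lemma groupoid_equivalence_\<Phi>: "groupoid_equivalence \<Gamma>V PiM (\<Phi> \<A> Vgen)"
proof (rule groupoid_equivalenceI[OF groupoid_functor_\<Phi>])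
  fix f g assume "f \<in> Arr \<Gamma>V" "g \<in> Arr \<Gamma>V" "onArr (\<Phi> \<A> Vgen) f = onArr (\<Phi> \<A> Vgen) g"
  then show "f = g" by (rule \<Phi>_faithful)
next
  fix a b g
  assume "a \<in> Obj \<Gamma>V" "b \<in> Obj \<Gamma>V" "g \<in> Arr PiM"
    "Dom PiM g = onObj (\<Phi> \<A> Vgen) a" "Cod PiM g = onObj (\<Phi> \<A> Vgen) b"
  then have "g \<in> Arr PiM" "a \<notin> \<Union>\<A>" "b \<notin> \<Union>\<A>" "Dom PiM g = (a, 0)" "Cod PiM g = (b, 0)" by simp_all
  then obtain f where "f \<in> Arr \<Gamma>V" "Dom \<Gamma>V f = a" "Cod \<Gamma>V f = b" "onArr (\<Phi> \<A> Vgen) f = g"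
    by (rule \<Phi>_full)
  then show "\<exists>f\<in>Arr \<Gamma>V. Dom \<Gamma>V f = a \<and> Cod \<Gamma>V f = b \<and> onArr (\<Phi> \<A> Vgen) f = g"
    by blast
next
  fix w assume "w \<in> Obj PiM"
  then have "w \<in> M" by simp
  then obtain a g where a: "a \<notin> \<Union>\<A>" and g: "g \<in> Arr PiM" "Dom PiM g = w" "Cod PiM g = (a, 0)"
    by (rule \<Phi>_essentially_surjective)
  have "a \<in> Obj \<Gamma>V" using a by simp
  moreover have "Dom PiM g = w \<and> Cod PiM g = onObj (\<Phi> \<A> Vgen) a"
    unfolding onObj_\<Phi> using g(2,3) by (rule conjI)
  ultimately show "\<exists>a\<in>Obj \<Gamma>V. \<exists>e\<in>Arr PiM. Dom PiM e = w \<and> Cod PiM e = onObj (\<Phi> \<A> Vgen) a"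
    using g(1) by blast
qed

end

section \<open>The groupoid with deck transformations\<close>

context lattice_arrangement
begin

lemma add_in_lattice: "\<lbrakk>m \<in> L; m' \<in> L\<rbrakk> \<Longrightarrow> m + m' \<in> L"
  using lattice_subgroup(2)[of m "0 - m'"] lattice_subgroup(1) lattice_subgroup(2)[of 0 m'] by simp

lemma translate_valid_move:
  assumes v: "valid_move \<A> Vgen a l b" and m: "m \<in> L"
  shows "valid_move \<A> Vgen (a + m) l (b + m)"
  unfolding valid_move_def
proof (intro conjI ballI impI)
  show "a + m \<notin> \<Union>\<A>" "b + m \<notin> \<Union>\<A>" "l \<in> Vgen"
    using v translate_hyperplane[OF m] unfolding valid_move_def by blast+
  fix H assume H: "H \<in> \<A>" "H \<inter> closed_segment (a + m) (b + m) \<noteq> {}"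
  let ?K = "(+) (- m) ` H"
  have "- m \<in> L" using m lattice_subgroup(1) lattice_subgroup(2)[of 0 m] by simp
  then have K: "?K \<in> \<A>" using arrangement H(1) unfolding invariant_arrangement_def by blast
  obtain z where z: "z \<in> H" "z \<in> closed_segment (a + m) (b + m)" using H(2) by blast
  have "closed_segment (m + a) (m + b) = (+) m ` closed_segment a b"
    by (rule closed_segment_translation)
  then have "z \<in> (+) m ` closed_segment a b" using z(2) by (simp only: add.commute)
  then obtain x where x: "z = m + x" "x \<in> closed_segment a b" by blast
  have "x = - m + z" by (simp add: x(1))
  then have "x \<in> ?K" using z(1) by (rule image_eqI)
  then have "?K \<inter> closed_segment a b \<noteq> {}" using x(2) by (metis IntI empty_iff)
  moreover have "\<forall>H\<in>\<A>. H \<inter> closed_segment a b \<noteq> {} \<longrightarrow> l \<notin> direction H"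
    using v unfolding valid_move_def by (elim conjE)
  ultimately have nd: "l \<notin> direction ?K" using K by (metis (no_types))
  show "l \<notin> direction H"
  proof
    assume "l \<in> direction H"
    then obtain p q where pq: "l = p - q" "p \<in> H" "q \<in> H" unfolding direction_def by blast
    have "l = (- m + p) - (- m + q)" by (simp add: pq(1))
    moreover have "- m + p \<in> ?K" "- m + q \<in> ?K"
      by (rule imageI[OF pq(2)], rule imageI[OF pq(3)])
    ultimately have "l \<in> direction ?K"
      unfolding direction_def by (intro CollectI exI[of _ "- m + p"] exI[of _ "- m + q"] conjI)
    then show False using nd by (rule notE[rotated])
  qed
qed

lemma \<Gamma>t_graph_simps [simp]:
  "verts (\<Gamma>t_graph L \<A> Vgen) = UNIV - \<Union>\<A>"
  "tail (\<Gamma>t_graph L \<A> Vgen) = edge_tail" "head (\<Gamma>t_graph L \<A> Vgen) = edge_head"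
  by (simp_all add: \<Gamma>t_graph_def)

lemma Move_arc [simp]: "Move a l b \<in> arcs (\<Gamma>t_graph L \<A> Vgen) \<longleftrightarrow> valid_move \<A> Vgen a l b"
  by (auto simp: \<Gamma>t_graph_def)

lemma Deck_arc [simp]: "Deck a m \<in> arcs (\<Gamma>t_graph L \<A> Vgen) \<longleftrightarrow> a \<notin> \<Union>\<A> \<and> m \<in> L"
  by (auto simp: \<Gamma>t_graph_def \<Gamma>_graph_def)

abbreviation \<Gamma>T :: "('v, ('v, 'v edge) word_arrow) gpd" where
  "\<Gamma>T \<equiv> \<Gamma>t L \<A> Vgen"

interpretation \<Gamma>: groupoid "\<Gamma> \<A> Vgen"
  unfolding \<Gamma>_def by (rule groupoid_presented)

interpretation \<Gamma>T: groupoid \<Gamma>T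
  unfolding \<Gamma>t_def by (rule groupoid_presented)

lemma Obj_\<Gamma>T [simp]: "Obj \<Gamma>T = UNIV - \<Union>\<A>"
  by (simp add: \<Gamma>t_def)

definition moveT :: "'v \<Rightarrow> 'v \<Rightarrow> 'v \<Rightarrow> ('v, 'v edge) word_arrow" where
  "moveT a l b = edge_arrow (\<Gamma>t_graph L \<A> Vgen) (\<Gamma>t_rel \<A>) (Move a l b)"

abbreviation deck :: "'v \<Rightarrow> 'v \<Rightarrow> ('v, 'v edge) word_arrow" where
  "deck a m \<equiv> deck_arrow L \<A> Vgen a m"

lemma moveT_simps [simp]:
  "Dom \<Gamma>T (moveT a l b) = a" "Cod \<Gamma>T (moveT a l b) = b"
  "valid_move \<A> Vgen a l b \<Longrightarrow> moveT a l b \<in> Arr \<Gamma>T"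
  unfolding \<Gamma>t_def moveT_def by (auto simp: valid_move_iff)

lemma deck_simps [simp]:
  "Dom \<Gamma>T (deck a m) = a" "Cod \<Gamma>T (deck a m) = a + m"
  "\<lbrakk>a \<notin> \<Union>\<A>; m \<in> L\<rbrakk> \<Longrightarrow> deck a m \<in> Arr \<Gamma>T"
proof -
  show "Dom \<Gamma>T (deck a m) = a" "Cod \<Gamma>T (deck a m) = a + m"
    unfolding \<Gamma>t_def deck_arrow_def by simp_all
  assume a: "a \<notin> \<Union>\<A>" "m \<in> L"
  then have "a + m \<notin> \<Union>\<A>" using translate_hyperplane by blast
  then show "deck a m \<in> Arr \<Gamma>T" unfolding \<Gamma>t_def deck_arrow_def using a by (intro edge_arrow_simps) simp_all
qed

lemma word_from_to_moveT:
  "valid_move \<A> Vgen a l b \<Longrightarrow> word_from_to (\<Gamma>t_graph L \<A> Vgen) a [(Move a l b, True)] b"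
  by (simp add: valid_move_iff)

lemma word_from_to_deck:
  "\<lbrakk>a \<notin> \<Union>\<A>; m \<in> L\<rbrakk> \<Longrightarrow> word_from_to (\<Gamma>t_graph L \<A> Vgen) a [(Deck a m, True)] (a + m)"
  using translate_hyperplane[of m a] by simp

lemma moveT_eq: "moveT a l b = word_class (\<Gamma>t_graph L \<A> Vgen) (\<Gamma>t_rel \<A>) a [(Move a l b, True)] b"
  by (simp add: moveT_def edge_arrow_def)

lemma deck_eq: "deck a m = word_class (\<Gamma>t_graph L \<A> Vgen) (\<Gamma>t_rel \<A>) a [(Deck a m, True)] (a + m)"
  by (simp add: deck_arrow_def edge_arrow_def)

lemma \<Gamma>T_Comp:
  "\<lbrakk>word_from_to (\<Gamma>t_graph L \<A> Vgen) a w b; word_from_to (\<Gamma>t_graph L \<A> Vgen) b u c\<rbrakk>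
    \<Longrightarrow> Comp \<Gamma>T (word_class (\<Gamma>t_graph L \<A> Vgen) (\<Gamma>t_rel \<A>) a w b) (word_class (\<Gamma>t_graph L \<A> Vgen) (\<Gamma>t_rel \<A>) b u c)
      = word_class (\<Gamma>t_graph L \<A> Vgen) (\<Gamma>t_rel \<A>) a (w @ u) c"
  unfolding \<Gamma>t_def by (rule presented_groupoid_Comp)

lemma deck_move_commute:
  assumes v: "valid_move \<A> Vgen a l b" and m: "m \<in> L"
  shows "Comp \<Gamma>T (moveT a l b) (deck b m) = Comp \<Gamma>T (deck a m) (moveT (a + m) l (b + m))"
proof -
  have ab: "a \<notin> \<Union>\<A>" "b \<notin> \<Union>\<A>" using v unfolding valid_move_iff by blast+
  note w = word_from_to_moveT[OF v] word_from_to_deck[OF ab(2) m]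
    word_from_to_deck[OF ab(1) m] word_from_to_moveT[OF translate_valid_move[OF v m]]
  have "word_cong (\<Gamma>t_graph L \<A> Vgen) (\<Gamma>t_rel \<A>) a ([(Move a l b, True)] @ [(Deck b m, True)])
     ([(Deck a m, True)] @ [(Move (a + m) l (b + m), True)]) (b + m)"
    by (rule cong_rel[OF _ word_from_to_appendI[OF w(1,2)] word_from_to_appendI[OF w(3,4)]])
      (simp add: \<Gamma>t_rel.deck_move)
  then show ?thesis
    unfolding moveT_eq deck_eq \<Gamma>T_Comp[OF w(1,2)] \<Gamma>T_Comp[OF w(3,4)] by (rule word_class_eqI)
qed

lemma deck_deck:
  assumes a: "a \<notin> \<Union>\<A>" and m: "m \<in> L" "m' \<in> L"
  shows "Comp \<Gamma>T (deck a m) (deck (a + m) m') = deck a (m + m')"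
proof -
  have am: "a + m \<notin> \<Union>\<A>" using a translate_hyperplane[OF m(1)] by blast
  note w = word_from_to_deck[OF a m(1)] word_from_to_deck[OF am m(2)]
  have w': "word_from_to (\<Gamma>t_graph L \<A> Vgen) a [(Deck a (m + m'), True)] (a + m + m')"
    using word_from_to_deck[OF a add_in_lattice[OF m]] by (simp only: add.assoc)
  have "word_cong (\<Gamma>t_graph L \<A> Vgen) (\<Gamma>t_rel \<A>) a ([(Deck a m, True)] @ [(Deck (a + m) m', True)])
     [(Deck a (m + m'), True)] (a + m + m')"
    by (rule cong_rel[OF _ word_from_to_appendI[OF w] w']) (simp add: \<Gamma>t_rel.deck_deck)
  from word_class_eqI[OF this] show ?thesis
    unfolding deck_eq \<Gamma>T_Comp[OF w] by (simp only: add.assoc)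
qed

text \<open>An idempotent in a groupoid is an identity.\<close>

lemma deck_zero:
  assumes "a \<notin> \<Union>\<A>"
  shows "deck a 0 = Ident \<Gamma>T a"
proof -
  have "Comp \<Gamma>T (deck a 0) (deck a 0) = deck a 0"
    using deck_deck[OF assms lattice_subgroup(1) lattice_subgroup(1)] by simp
  from \<Gamma>T.idempotent_is_Ident[OF _ _ this] show ?thesis
    using assms lattice_subgroup(1) by simp
qed

subsection \<open>The inclusion of the groupoid without deck transformations\<close>

lemma edge_assignment_\<Gamma>_to_\<Gamma>t:
  "edge_assignment (\<Gamma>_graph \<A> Vgen) (\<Gamma>_rel \<A>) \<Gamma>T id (edge_arrow (\<Gamma>t_graph L \<A> Vgen) (\<Gamma>t_rel \<A>))"
proof
  fix a assume "a \<in> verts (\<Gamma>_graph \<A> Vgen)"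
  then show "id a \<in> Obj \<Gamma>T" by simp
next
  fix e assume "e \<in> arcs (\<Gamma>_graph \<A> Vgen)"
  then obtain a l b where e: "e = Move a l b" "valid_move \<A> Vgen a l b"
    unfolding \<Gamma>_graph_simps(4) by blast
  show "edge_arrow (\<Gamma>t_graph L \<A> Vgen) (\<Gamma>t_rel \<A>) e \<in> Arr \<Gamma>T \<and>
     Dom \<Gamma>T (edge_arrow (\<Gamma>t_graph L \<A> Vgen) (\<Gamma>t_rel \<A>) e) = id (tail (\<Gamma>_graph \<A> Vgen) e) \<and>
     Cod \<Gamma>T (edge_arrow (\<Gamma>t_graph L \<A> Vgen) (\<Gamma>t_rel \<A>) e) = id (head (\<Gamma>_graph \<A> Vgen) e)"
    unfolding e(1) moveT_def[symmetric] using e(2) by simp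
next
  let ?e = "\<lambda>a w. eval_word \<Gamma>T id (edge_arrow (\<Gamma>t_graph L \<A> Vgen) (\<Gamma>t_rel \<A>)) a (\<Gamma>_graph \<A> Vgen) w"
  have one: "?e a [(Move a l b, True)] = moveT a l b" if "valid_move \<A> Vgen a l b" for a l b
    using that by (simp add: moveT_def[symmetric])
  fix w w' a b
  assume rel: "\<Gamma>_rel \<A> w w'" and w: "word_from_to (\<Gamma>_graph \<A> Vgen) a w b" "word_from_to (\<Gamma>_graph \<A> Vgen) a w' b"
  have rel': "\<Gamma>t_rel \<A> w w'" using rel by (rule \<Gamma>t_rel.old)
  from rel show "?e a w = ?e a w'"
  proof cases
    case (stay \<delta> l)
    then have v: "valid_move \<A> Vgen \<delta> l \<delta>" "a = \<delta>" "b = \<delta>" using w by auto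
    have "word_cong (\<Gamma>t_graph L \<A> Vgen) (\<Gamma>t_rel \<A>) \<delta> w w' \<delta>"
      by (rule cong_rel, rule rel') (use v(1) stay in \<open>auto simp: valid_move_iff\<close>)
    from word_class_eqI[OF this] have "moveT \<delta> l \<delta> = Ident \<Gamma>T \<delta>"
      unfolding stay moveT_eq \<Gamma>t_def presented_groupoid_simps(4) .
    then show ?thesis unfolding stay v(2) one[OF v(1)] by simp
  next
    case (subdivide \<delta> l \<delta>'' \<delta>')
    then have v: "valid_move \<A> Vgen \<delta> l \<delta>''" "valid_move \<A> Vgen \<delta> l \<delta>'" "valid_move \<A> Vgen \<delta>' l \<delta>''" "a = \<delta>"
      using w by auto
    note wt = word_from_to_moveT[OF v(2)] word_from_to_moveT[OF v(3)]
    have "word_cong (\<Gamma>t_graph L \<A> Vgen) (\<Gamma>t_rel \<A>) \<delta> w w' \<delta>''"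
      by (rule cong_rel, rule rel')
        (use word_from_to_moveT[OF v(1)] word_from_to_appendI[OF wt] subdivide in simp_all)
    from word_class_eqI[OF this] have "moveT \<delta> l \<delta>'' = Comp \<Gamma>T (moveT \<delta> l \<delta>') (moveT \<delta>' l \<delta>'')"
      unfolding subdivide moveT_eq \<Gamma>T_Comp[OF wt] by simp
    moreover have "?e a w' = Comp \<Gamma>T (moveT \<delta> l \<delta>') (moveT \<delta>' l \<delta>'')"
      using v(2,3) unfolding subdivide v(4) by (simp add: moveT_def[symmetric])
    ultimately show ?thesis using one[OF v(1)] unfolding subdivide v(4) by simp
  next
    case (relabel \<delta> \<delta>' l l')
    then have v: "valid_move \<A> Vgen \<delta> l \<delta>'" "valid_move \<A> Vgen \<delta> l' \<delta>'" "a = \<delta>" using w by auto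
    have "word_cong (\<Gamma>t_graph L \<A> Vgen) (\<Gamma>t_rel \<A>) \<delta> w w' \<delta>'"
      by (rule cong_rel, rule rel') (use word_from_to_moveT[OF v(1)] word_from_to_moveT[OF v(2)] relabel(1,2) in simp_all)
    from word_class_eqI[OF this] have "moveT \<delta> l \<delta>' = moveT \<delta> l' \<delta>'"
      unfolding relabel(1,2) moveT_eq .
    then show ?thesis unfolding relabel(1,2) v(3) one[OF v(1)] one[OF v(2)] .
  qed
qed

interpretation J: edge_assignment "\<Gamma>_graph \<A> Vgen" "\<Gamma>_rel \<A>" \<Gamma>T id
    "edge_arrow (\<Gamma>t_graph L \<A> Vgen) (\<Gamma>t_rel \<A>)"
  by (rule edge_assignment_\<Gamma>_to_\<Gamma>t)

abbreviation "incl \<equiv> \<Gamma>_to_\<Gamma>t L \<A> Vgen"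

lemma groupoid_functor_incl: "groupoid_functor \<Gamma>V \<Gamma>T incl"
  unfolding \<Gamma>_to_\<Gamma>t_def \<Gamma>_def by (rule J.groupoid_functor_from_edges)

interpretation J: groupoid_functor "\<Gamma> \<A> Vgen" \<Gamma>T incl
  by (rule groupoid_functor_incl)

lemma onObj_incl [simp]: "onObj incl a = a"
  unfolding \<Gamma>_to_\<Gamma>t_def by simp

lemma incl_move_arrow:
  assumes "valid_move \<A> Vgen a l b"
  shows "onArr incl (move_arrow a l b) = moveT a l b"
  unfolding \<Gamma>_to_\<Gamma>t_def move_arrow_def moveT_def
  using assms by (intro J.functor_from_edges_edge_arrow) (auto simp: valid_move_iff)

lemma \<Gamma>T_induct [consumes 1, case_names Ident move inverse_move deck inverse_deck]:
  assumes "f \<in> Arr \<Gamma>T"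
    and "\<And>a. a \<notin> \<Union>\<A> \<Longrightarrow> P (Ident \<Gamma>T a)"
    and move: "\<And>f a l b. \<lbrakk>f \<in> Arr \<Gamma>T; P f; valid_move \<A> Vgen a l b; Cod \<Gamma>T f = a\<rbrakk>
      \<Longrightarrow> P (Comp \<Gamma>T f (moveT a l b))"
    and inverse_move: "\<And>f a l b. \<lbrakk>f \<in> Arr \<Gamma>T; P f; valid_move \<A> Vgen a l b; Cod \<Gamma>T f = b\<rbrakk>
      \<Longrightarrow> P (Comp \<Gamma>T f (Inv \<Gamma>T (moveT a l b)))"
    and deck: "\<And>f a m. \<lbrakk>f \<in> Arr \<Gamma>T; P f; a \<notin> \<Union>\<A>; m \<in> L; Cod \<Gamma>T f = a\<rbrakk>
      \<Longrightarrow> P (Comp \<Gamma>T f (deck a m))"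
    and inverse_deck: "\<And>f a m. \<lbrakk>f \<in> Arr \<Gamma>T; P f; a \<notin> \<Union>\<A>; m \<in> L; Cod \<Gamma>T f = a + m\<rbrakk>
      \<Longrightarrow> P (Comp \<Gamma>T f (Inv \<Gamma>T (deck a m)))"
  shows "P f"
  using assms(1) unfolding \<Gamma>t_def
proof (induction rule: presented_arrow_induct)
  case (Ident a)
  then show ?case using assms(2) unfolding \<Gamma>t_def by simp
next
  case (edge f e)
  show ?case
  proof (cases e)
    case (Move a l b)
    then show ?thesis using move[unfolded \<Gamma>t_def moveT_def, of f a l b] edge by simp
  next
    case (Deck a m)
    then show ?thesis using deck[unfolded \<Gamma>t_def deck_arrow_def, of f a m] edge by simp
  qed
next
  case (inverse_edge f e)
  show ?case
  proof (cases e)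
    case (Move a l b)
    then show ?thesis using inverse_move[unfolded \<Gamma>t_def moveT_def, of f a l b] inverse_edge by simp
  next
    case (Deck a m)
    then show ?thesis using inverse_deck[unfolded \<Gamma>t_def deck_arrow_def, of f a m] inverse_edge by simp
  qed
qed

text \<open>A deck arrow can be pushed to the right past a move or its inverse, which gets translated, and merges
  with other deck arrows.\<close>

lemma normal_form:
  assumes "f \<in> Arr \<Gamma>T"
  obtains g m where "g \<in> Arr \<Gamma>V" "m \<in> L" "Dom \<Gamma>V g = Dom \<Gamma>T f"
    "Cod \<Gamma>T f = Cod \<Gamma>V g + m" "f = Comp \<Gamma>T (onArr incl g) (deck (Cod \<Gamma>V g) m)"
proof -
  let ?N = "\<lambda>f. \<exists>g\<in>Arr \<Gamma>V. \<exists>m\<in>L. f = Comp \<Gamma>T (onArr incl g) (deck (Cod \<Gamma>V g) m)"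
  have vertex: "Cod \<Gamma>V g \<notin> \<Union>\<A>" if "g \<in> Arr \<Gamma>V" for g
    using \<Gamma>.cod_in_obj[OF that] by simp
  have ends: "Dom \<Gamma>T (Comp \<Gamma>T (onArr incl g) (deck (Cod \<Gamma>V g) m)) = Dom \<Gamma>V g"
    "Cod \<Gamma>T (Comp \<Gamma>T (onArr incl g) (deck (Cod \<Gamma>V g) m)) = Cod \<Gamma>V g + m"
    if "g \<in> Arr \<Gamma>V" "m \<in> L" for g m
    using that vertex[OF that(1)] by simp_all
  have deck_only: "\<exists>k\<in>Arr \<Gamma>V. \<exists>m'\<in>L. Dom \<Gamma>V k = Cod \<Gamma>V g \<and>
      h = Comp \<Gamma>T (onArr incl k) (deck (Cod \<Gamma>V k) m')"
    if g: "g \<in> Arr \<Gamma>V" and m: "m \<in> L" and h: "h = deck (Cod \<Gamma>V g) m" for g m h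
  proof -
    let ?k = "Ident \<Gamma>V (Cod \<Gamma>V g)"
    have "?k \<in> Arr \<Gamma>V" "Dom \<Gamma>V ?k = Cod \<Gamma>V g"
      "h = Comp \<Gamma>T (onArr incl ?k) (deck (Cod \<Gamma>V ?k) m)"
      using vertex[OF g] m by (simp_all add: h)
    then show ?thesis using m by blast
  qed
  \<comment> \<open>it suffices to push a deck arrow past the newly appended arrow\<close>
  have append: "?N (Comp \<Gamma>T f h)"
    if N: "?N f" and hh: "\<And>g m. \<lbrakk>g \<in> Arr \<Gamma>V; m \<in> L; Cod \<Gamma>V g + m = Cod \<Gamma>T f\<rbrakk> \<Longrightarrow>
        \<exists>k\<in>Arr \<Gamma>V. \<exists>m'\<in>L. Dom \<Gamma>V k = Cod \<Gamma>V g \<and>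
          Comp \<Gamma>T (deck (Cod \<Gamma>V g) m) h = Comp \<Gamma>T (onArr incl k) (deck (Cod \<Gamma>V k) m')"
      and h: "h \<in> Arr \<Gamma>T" "Cod \<Gamma>T f = Dom \<Gamma>T h" for f h
  proof -
    obtain g m where g: "g \<in> Arr \<Gamma>V" "m \<in> L" "f = Comp \<Gamma>T (onArr incl g) (deck (Cod \<Gamma>V g) m)"
      using N by blast
    have cod: "Cod \<Gamma>V g + m = Cod \<Gamma>T f" unfolding g(3) by (rule ends(2)[OF g(1,2), symmetric])
    obtain k m' where k: "k \<in> Arr \<Gamma>V" "m' \<in> L" "Dom \<Gamma>V k = Cod \<Gamma>V g"
      and eq: "Comp \<Gamma>T (deck (Cod \<Gamma>V g) m) h = Comp \<Gamma>T (onArr incl k) (deck (Cod \<Gamma>V k) m')"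
      using hh[OF g(1,2) cod] by blast
    have dh: "Dom \<Gamma>T h = Cod \<Gamma>V g + m" using cod h(2) by simp
    have "Comp \<Gamma>T f h = Comp \<Gamma>T (onArr incl g) (Comp \<Gamma>T (deck (Cod \<Gamma>V g) m) h)"
      unfolding g(3) using g(1,2) vertex[OF g(1)] h(1) dh by (intro \<Gamma>T.comp_assoc) simp_all
    also have "\<dots> = Comp \<Gamma>T (Comp \<Gamma>T (onArr incl g) (onArr incl k)) (deck (Cod \<Gamma>V k) m')"
      unfolding eq using g(1) k(1-3) vertex[OF k(1)] by (intro \<Gamma>T.comp_assoc[symmetric]) simp_all
    also have "\<dots> = Comp \<Gamma>T (onArr incl (Comp \<Gamma>V g k)) (deck (Cod \<Gamma>V (Comp \<Gamma>V g k)) m')"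
      using g(1) k(1,3) by simp
    finally show ?thesis using g(1) k(1-3) by (intro bexI[of _ "Comp \<Gamma>V g k"] bexI[of _ m']) simp_all
  qed
  have neg: "0 - m \<in> L" if "m \<in> L" for m using lattice_subgroup that by blast
  have "?N f" using assms
  proof (induction rule: \<Gamma>T_induct)
    case (Ident a)
    have "Ident \<Gamma>T a = Comp \<Gamma>T (onArr incl (Ident \<Gamma>V a)) (deck (Cod \<Gamma>V (Ident \<Gamma>V a)) 0)"
      using Ident by (simp add: deck_zero)
    moreover have "Ident \<Gamma>V a \<in> Arr \<Gamma>V" using Ident by simp
    ultimately show ?case using lattice_subgroup(1) by blast
  next
    case (move f a l b)
    show ?case
    proof (rule append[OF move.IH])
      fix g m assume g: "g \<in> Arr \<Gamma>V" and m: "m \<in> L" and cod: "Cod \<Gamma>V g + m = Cod \<Gamma>T f"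
      define c where "c = Cod \<Gamma>V g"
      have a: "c + m = a" using cod move.hyps(3) by (simp add: c_def)
      have v: "valid_move \<A> Vgen c l (b - m)"
        using translate_valid_move[OF move.hyps(2) neg[OF m]] by (simp add: a[symmetric])
      have "Comp \<Gamma>T (deck c m) (moveT a l b) = Comp \<Gamma>T (moveT c l (b - m)) (deck (b - m) m)"
        using deck_move_commute[OF v m] by (simp add: a)
      then show "\<exists>k\<in>Arr \<Gamma>V. \<exists>m'\<in>L. Dom \<Gamma>V k = Cod \<Gamma>V g \<and>
          Comp \<Gamma>T (deck (Cod \<Gamma>V g) m) (moveT a l b) = Comp \<Gamma>T (onArr incl k) (deck (Cod \<Gamma>V k) m')"
        unfolding c_def[symmetric] using v m
        by (intro bexI[of _ "move_arrow c l (b - m)"] bexI[of _ m]) (simp_all only: incl_move_arrow move_arrow_simps simp_thms)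
    qed (use move in simp_all)
  next
    case (inverse_move f a l b)
    show ?case
    proof (rule append[OF inverse_move.IH])
      fix g m assume g: "g \<in> Arr \<Gamma>V" and m: "m \<in> L" and cod: "Cod \<Gamma>V g + m = Cod \<Gamma>T f"
      define c where "c = Cod \<Gamma>V g"
      have cv: "c \<notin> \<Union>\<A>" unfolding c_def by (rule vertex[OF g])
      have b: "c + m = b" using cod inverse_move.hyps(3) by (simp add: c_def)
      have v: "valid_move \<A> Vgen (a - m) l c"
        using translate_valid_move[OF inverse_move.hyps(2) neg[OF m]] by (simp add: b[symmetric])
      then have am: "a - m \<notin> \<Union>\<A>" unfolding valid_move_iff by blast
      have comm: "Comp \<Gamma>T (moveT (a - m) l c) (deck c m) = Comp \<Gamma>T (deck (a - m) m) (moveT a l b)"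
        using deck_move_commute[OF v m] by (simp add: b)
      note arr = moveT_simps(3)[OF inverse_move.hyps(2)] moveT_simps(3)[OF v] deck_simps(3)[OF am m] deck_simps(3)[OF cv m]
      have "Comp \<Gamma>T (deck c m) (Inv \<Gamma>T (moveT a l b))
        = Comp \<Gamma>T (Inv \<Gamma>T (moveT (a - m) l c)) (Comp \<Gamma>T (Comp \<Gamma>T (moveT (a - m) l c) (deck c m)) (Inv \<Gamma>T (moveT a l b)))"
        using arr by (simp add: \<Gamma>T.comp_assoc b)
      also have "\<dots> = Comp \<Gamma>T (Inv \<Gamma>T (moveT (a - m) l c)) (deck (a - m) m)"
        unfolding comm using arr by (simp add: \<Gamma>T.comp_assoc)
      finally have eq: "Comp \<Gamma>T (deck c m) (Inv \<Gamma>T (moveT a l b))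
          = Comp \<Gamma>T (Inv \<Gamma>T (moveT (a - m) l c)) (deck (a - m) m)" .
      let ?k = "Inv \<Gamma>V (move_arrow (a - m) l c)"
      have "?k \<in> Arr \<Gamma>V" "Dom \<Gamma>V ?k = c" "Cod \<Gamma>V ?k = a - m"
        "onArr incl ?k = Inv \<Gamma>T (moveT (a - m) l c)"
        using move_arrow_simps(3)[OF v] by (simp_all add: incl_move_arrow[OF v])
      then show "\<exists>k\<in>Arr \<Gamma>V. \<exists>m'\<in>L. Dom \<Gamma>V k = Cod \<Gamma>V g \<and>
          Comp \<Gamma>T (deck (Cod \<Gamma>V g) m) (Inv \<Gamma>T (moveT a l b)) = Comp \<Gamma>T (onArr incl k) (deck (Cod \<Gamma>V k) m')"
        unfolding c_def[symmetric] using eq m by (intro bexI[of _ ?k] bexI[of _ m]) (simp_all only: simp_thms)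
    qed (use inverse_move in simp_all)
  next
    case (deck f a k)
    show ?case
    proof (rule append[OF deck.IH])
      fix g m assume g: "g \<in> Arr \<Gamma>V" and m: "m \<in> L" and cod: "Cod \<Gamma>V g + m = Cod \<Gamma>T f"
      have a: "Cod \<Gamma>V g + m = a" using cod deck.hyps(4) by simp
      show "\<exists>k'\<in>Arr \<Gamma>V. \<exists>m'\<in>L. Dom \<Gamma>V k' = Cod \<Gamma>V g \<and>
          Comp \<Gamma>T (deck (Cod \<Gamma>V g) m) (deck a k) = Comp \<Gamma>T (onArr incl k') (deck (Cod \<Gamma>V k') m')"
        by (rule deck_only[OF g add_in_lattice[OF m deck.hyps(3)]])
          (use deck_deck[OF vertex[OF g] m deck.hyps(3)] in \<open>simp only: a\<close>)
    qed (use deck in simp_all)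
  next
    case (inverse_deck f a k)
    note arr0 = deck_simps(3)[OF inverse_deck.hyps(2,3)]
    show ?case
    proof (rule append[OF inverse_deck.IH])
      fix g m assume g: "g \<in> Arr \<Gamma>V" and m: "m \<in> L" and cod: "Cod \<Gamma>V g + m = Cod \<Gamma>T f"
      define c where "c = Cod \<Gamma>V g"
      have cv: "c \<notin> \<Union>\<A>" unfolding c_def by (rule vertex[OF g])
      have mk: "m - k \<in> L" using lattice_subgroup(2) m inverse_deck.hyps(3) by blast
      have a: "c + (m - k) = a" using cod inverse_deck.hyps(4) by (simp add: c_def algebra_simps)
      have dd: "Comp \<Gamma>T (deck c (m - k)) (deck a k) = deck c m"
        using deck_deck[OF cv mk inverse_deck.hyps(3)] unfolding a by simp
      have "Comp \<Gamma>T (deck c m) (Inv \<Gamma>T (deck a k)) = deck c (m - k)"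
        unfolding dd[symmetric] using arr0 deck_simps(3)[OF cv mk] a by (simp add: \<Gamma>T.comp_assoc)
      then show "\<exists>k'\<in>Arr \<Gamma>V. \<exists>m'\<in>L. Dom \<Gamma>V k' = Cod \<Gamma>V g \<and>
          Comp \<Gamma>T (deck (Cod \<Gamma>V g) m) (Inv \<Gamma>T (deck a k)) = Comp \<Gamma>T (onArr incl k') (deck (Cod \<Gamma>V k') m')"
        unfolding c_def by (rule deck_only[OF g mk])
    qed (use inverse_deck arr0 in simp_all)
  qed
  then obtain g m where g: "g \<in> Arr \<Gamma>V" "m \<in> L" "f = Comp \<Gamma>T (onArr incl g) (deck (Cod \<Gamma>V g) m)"
    by blast
  show thesis
    by (rule that[OF g(1,2) _ _ g(3)]) (simp_all only: g(3) ends[OF g(1,2)])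
qed

section \<open>The fundamental groupoid of the quotient\<close>

abbreviation YQ :: "('v \<times> 'v) set topology" where
  "YQ \<equiv> arr_quotient L \<A>"

abbreviation PiY :: "(('v \<times> 'v) set, ('v \<times> 'v) set path_arrow) gpd" where
  "PiY \<equiv> fundamental_groupoid YQ"

abbreviation "push \<equiv> induced_functor YQ (orbit L)"

lemma ex_translation_quotient: "\<exists>\<rho>. translation_quotient L M \<rho>"
proof (rule lattice_separated)
  fix \<rho> :: real
  assume \<rho>: "0 < \<rho>" "\<And>m. \<lbrakk>m \<in> L; m \<noteq> 0\<rbrakk> \<Longrightarrow> \<rho> \<le> norm m"
  have "translation_quotient L M \<rho>"
    by unfold_locales (use lattice_subgroup \<rho> translate_M in blast)+
  then show ?thesis by blast
qed

definition gap :: real where "gap = (SOME \<rho>. translation_quotient L M \<rho>)"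

interpretation Q: translation_quotient L M gap
  unfolding gap_def by (rule someI_ex[OF ex_translation_quotient])

lemma YQ_eq: "YQ = quotient_topology (top_of_set M) (orbit L)"
  unfolding arr_quotient_def arr_complement_eq ..

lemma faithful_push: "faithful_functor PiM PiY push"
  unfolding YQ_eq by (rule Q.faithful_orbit)

interpretation P: groupoid PiM by (rule groupoid_fundamental)
interpretation PY: groupoid PiY by (rule groupoid_fundamental)
interpretation push: faithful_functor PiM PiY push by (rule faithful_push)
interpretation F: groupoid_functor "\<Gamma> \<A> Vgen" PiM "\<Phi> \<A> Vgen"
  by (rule groupoid_functor_\<Phi>)

lemma push_path_class: "pathin (top_of_set M) p \<Longrightarrow> onArr push (path_class (top_of_set M) p) = path_class YQ (orbit L \<circ> p)"
  unfolding YQ_eq by (rule induced_functor_path_class[OF Q.continuous_orbit])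

primrec quotient_edge :: "'v edge \<Rightarrow> ('v \<times> 'v) set path_arrow" where
  "quotient_edge (Move a l b) = onArr push (detour l a b)"
| "quotient_edge (Deck a m) = Ident PiY (orbit L (a, 0))"

lemma orbit_translate: "m \<in> L \<Longrightarrow> orbit L (z + (m, 0)) = orbit L z"
  using Q.orbit_eq_iff by blast

text \<open>The path assigned to a translated move is the translate of the path, and both have the same image in
  the quotient.\<close>

lemma push_detour_translate:
  assumes v: "a \<notin> \<Union>\<A>" "b \<notin> \<Union>\<A>" "joined l a b" "joined l (a + m) (b + m)" and m: "m \<in> L"
  shows "onArr push (detour l (a + m) (b + m)) = onArr push (detour l a b)"
proof -
  have v': "a + m \<notin> \<Union>\<A>" "b + m \<notin> \<Union>\<A>" using v(1,2) translate_hyperplane[OF m] by blast+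
  have "\<Phi>_path (Move (a + m) l (b + m)) t = \<Phi>_path (Move a l b) t + (m, 0)" for t
    by (simp add: joinpaths_def linepath_def algebra_simps)
  then have "orbit L \<circ> \<Phi>_path (Move (a + m) l (b + m)) = orbit L \<circ> \<Phi>_path (Move a l b)"
    by (intro ext) (simp only: comp_def orbit_translate[OF m])
  then show ?thesis
    using push_path_class[OF path_class_\<Phi>_path(1)[OF v(1-3)]] push_path_class[OF path_class_\<Phi>_path(1)[OF v' v(4)]]
    unfolding path_class_\<Phi>_path(2)[OF v(1-3)] path_class_\<Phi>_path(2)[OF v' v(4)] by simp
qed

lemma orbit_vertex: "a \<notin> \<Union>\<A> \<Longrightarrow> orbit L (a, 0) \<in> Obj PiY"
  using push.map_obj[of "(a, 0)"] by (simp add: real_point_mem_M)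

lemma edge_assignment_quotient:
  "edge_assignment (\<Gamma>t_graph L \<A> Vgen) (\<Gamma>t_rel \<A>) PiY (\<lambda>\<delta>. orbit L (\<delta>, 0)) quotient_edge"
proof
  fix a assume "a \<in> verts (\<Gamma>t_graph L \<A> Vgen)"
  then show "orbit L (a, 0) \<in> Obj PiY" by (simp add: orbit_vertex del: fundamental_groupoid_simps)
next
  fix e assume e: "e \<in> arcs (\<Gamma>t_graph L \<A> Vgen)"
  show "quotient_edge e \<in> Arr PiY \<and> Dom PiY (quotient_edge e) = orbit L (tail (\<Gamma>t_graph L \<A> Vgen) e, 0) \<and>
      Cod PiY (quotient_edge e) = orbit L (head (\<Gamma>t_graph L \<A> Vgen) e, 0)"
  proof (cases e)
    case (Move a l b)
    then have "a \<notin> \<Union>\<A>" "b \<notin> \<Union>\<A>" "joined l a b" using e by (simp_all add: valid_move_iff)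
    note d = detour_arr[OF this]
    show ?thesis unfolding Move using d(1) by (simp add: d)
  next
    case (Deck a m)
    then have a: "a \<notin> \<Union>\<A>" "m \<in> L" using e by simp_all
    have "orbit L (a + m, 0) = orbit L (a, 0)" using orbit_translate[OF a(2), of "(a, 0)"] by simp
    then show ?thesis unfolding Deck using PY.ident_arr[OF orbit_vertex[OF a(1)]]
        PY.ident_dom[OF orbit_vertex[OF a(1)]] PY.ident_cod[OF orbit_vertex[OF a(1)]] by simp
  qed
next
  let ?e = "\<lambda>a w. eval_word PiY (\<lambda>\<delta>. orbit L (\<delta>, 0)) quotient_edge a (\<Gamma>t_graph L \<A> Vgen) w"
  have d: "onArr push (detour l a b) \<in> Arr PiY" "Dom PiY (onArr push (detour l a b)) = orbit L (a, 0)"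
    "Cod PiY (onArr push (detour l a b)) = orbit L (b, 0)"
    if "valid_move \<A> Vgen a l b" for a l b
  proof -
    have "a \<notin> \<Union>\<A>" "b \<notin> \<Union>\<A>" "joined l a b" using that by (simp_all add: valid_move_iff)
    note d = detour_arr[OF this]
    show "onArr push (detour l a b) \<in> Arr PiY" "Dom PiY (onArr push (detour l a b)) = orbit L (a, 0)"
      "Cod PiY (onArr push (detour l a b)) = orbit L (b, 0)" using d(1) by (simp_all add: d)
  qed
  have one: "?e a [(Move a l b, True)] = onArr push (detour l a b)" if "valid_move \<A> Vgen a l b" for a l b
    using d[OF that] by simp
  fix w w' a b
  assume rel: "\<Gamma>t_rel \<A> w w'" and w: "word_from_to (\<Gamma>t_graph L \<A> Vgen) a w b" "word_from_to (\<Gamma>t_graph L \<A> Vgen) a w' b"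
  from rel show "?e a w = ?e a w'"
  proof cases
    case old
    then show ?thesis
    proof cases
      case (stay \<delta> l)
      then have v: "valid_move \<A> Vgen \<delta> l \<delta>" "a = \<delta>" "\<delta> \<notin> \<Union>\<A>" using w by (auto simp: valid_move_iff)
      have "Ident PiM (\<delta>, 0) = detour l \<delta> \<delta>" by (rule detour_refl[OF v(3), symmetric])
      moreover have "onArr push (Ident PiM (\<delta>, 0)) = Ident PiY (orbit L (\<delta>, 0))"
        using push.map_ident[of "(\<delta>, 0)"] v(3) by (simp add: real_point_mem_M)
      ultimately show ?thesis unfolding stay v(2) one[OF v(1)] by simp
    next
      case (subdivide \<delta> l \<delta>'' \<delta>')
      then have v: "valid_move \<A> Vgen \<delta> l \<delta>''" "valid_move \<A> Vgen \<delta> l \<delta>'" "valid_move \<A> Vgen \<delta>' l \<delta>''" "a = \<delta>"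
        using w by auto
      have j: "\<delta> \<notin> \<Union>\<A>" "\<delta>' \<notin> \<Union>\<A>" "\<delta>'' \<notin> \<Union>\<A>" "joined l \<delta> \<delta>'" "joined l \<delta>' \<delta>''"
        using v(2,3) by (simp_all add: valid_move_iff)
      have "?e a w' = Comp PiY (onArr push (detour l \<delta> \<delta>')) (onArr push (detour l \<delta>' \<delta>''))"
        using d[OF v(2)] d[OF v(3)] unfolding subdivide v(4) by simp
      also have "\<dots> = onArr push (Comp PiM (detour l \<delta> \<delta>') (detour l \<delta>' \<delta>''))"
        using detour_arr[OF j(1,2,4)] detour_arr[OF j(2,3,5)] by (intro push.map_comp[symmetric]) simp_all
      also have "\<dots> = onArr push (detour l \<delta> \<delta>'')" unfolding detour_comp[OF j] ..
      finally show ?thesis using one[OF v(1)] unfolding subdivide v(4) by simp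
    next
      case (relabel \<delta> \<delta>' l l')
      then have v: "valid_move \<A> Vgen \<delta> l \<delta>'" "valid_move \<A> Vgen \<delta> l' \<delta>'" "a = \<delta>" using w by auto
      have j: "\<delta> \<notin> \<Union>\<A>" "\<delta>' \<notin> \<Union>\<A>" "transversal (closed_segment \<delta> \<delta>') l"
        using v(1) by (simp_all add: valid_move_iff joined_iff_transversal)
      have "cosided (closed_segment \<delta> \<delta>') l l'"
        using same_orientation_iff_cosided[OF j(3), of l'] relabel(3) by blast
      then have "detour l \<delta> \<delta>' = detour l' \<delta> \<delta>'" by (rule detour_cong[OF j(1,2)])
      then show ?thesis unfolding relabel(1,2) v(3) one[OF v(1)] one[OF v(2)] by simp
    qed
  next
    case (deck_move \<delta> l \<delta>' m)
    then have v: "valid_move \<A> Vgen \<delta> l \<delta>'" "m \<in> L" "a = \<delta>" using w by auto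
    note v' = translate_valid_move[OF v(1,2)]
    have j: "\<delta> \<notin> \<Union>\<A>" "\<delta>' \<notin> \<Union>\<A>" "joined l \<delta> \<delta>'" "joined l (\<delta> + m) (\<delta>' + m)"
      using v(1) v' by (simp_all add: valid_move_iff)
    have o: "orbit L (\<delta> + m, 0) = orbit L (\<delta>, 0)" "orbit L (\<delta>' + m, 0) = orbit L (\<delta>', 0)"
      using orbit_translate[OF v(2), of "(\<delta>, 0)"] orbit_translate[OF v(2), of "(\<delta>', 0)"] by simp_all
    have i: "Ident PiY (orbit L (\<delta>', 0)) \<in> Arr PiY" "Dom PiY (Ident PiY (orbit L (\<delta>', 0))) = orbit L (\<delta>', 0)"
      "Cod PiY (Ident PiY (orbit L (\<delta>', 0))) = orbit L (\<delta>', 0)"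
      by (rule PY.ident_arr[OF orbit_vertex[OF j(2)]], rule PY.ident_dom[OF orbit_vertex[OF j(2)]],
          rule PY.ident_cod[OF orbit_vertex[OF j(2)]])
    have "?e a w = onArr push (detour l \<delta> \<delta>')"
      using d[OF v(1)] i unfolding deck_move v(3) by (simp add: o)
    also have "\<dots> = onArr push (detour l (\<delta> + m) (\<delta>' + m))"
      by (rule push_detour_translate[OF j v(2), symmetric])
    also have "\<dots> = ?e a w'"
      using d[OF v'] unfolding deck_move v(3) by (simp add: o)
    finally show ?thesis .
  next
    case (deck_deck \<delta> m m')
    then have v: "\<delta> \<notin> \<Union>\<A>" "m \<in> L" "m' \<in> L" "a = \<delta>" using w by auto
    have o: "orbit L (\<delta> + m, 0) = orbit L (\<delta>, 0)" "orbit L (\<delta> + m + m', 0) = orbit L (\<delta>, 0)"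
      using orbit_translate[OF v(2), of "(\<delta>, 0)"] orbit_translate[OF v(3), of "(\<delta> + m, 0)"] by simp_all
    have o': "orbit L (\<delta> + (m + m'), 0) = orbit L (\<delta>, 0)" using o(2) by (simp only: add.assoc)
    note i = PY.ident_arr[OF orbit_vertex[OF v(1)]] PY.ident_dom[OF orbit_vertex[OF v(1)]]
      PY.ident_cod[OF orbit_vertex[OF v(1)]]
    show ?thesis unfolding deck_deck v(4) using i by (simp add: o o')
  qed
qed

interpretation E: edge_assignment "\<Gamma>t_graph L \<A> Vgen" "\<Gamma>t_rel \<A>" PiY "\<lambda>\<delta>. orbit L (\<delta>, 0)" quotient_edge
  by (rule edge_assignment_quotient)

definition \<Phi>t :: "('v, ('v, 'v edge) word_arrow, ('v \<times> 'v) set, ('v \<times> 'v) set path_arrow) gpd_map" where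
  "\<Phi>t = functor_from_edges (\<Gamma>t_graph L \<A> Vgen) PiY (\<lambda>\<delta>. orbit L (\<delta>, 0)) quotient_edge"

lemma groupoid_functor_\<Phi>t: "groupoid_functor \<Gamma>T PiY \<Phi>t"
  unfolding \<Phi>t_def \<Gamma>t_def by (rule E.groupoid_functor_from_edges)

interpretation Ft: groupoid_functor \<Gamma>T PiY \<Phi>t
  by (rule groupoid_functor_\<Phi>t)

lemma onObj_\<Phi>t [simp]: "onObj \<Phi>t a = orbit L (a, 0)"
  unfolding \<Phi>t_def by simp

lemma \<Phi>t_moveT:
  assumes "valid_move \<A> Vgen a l b"
  shows "onArr \<Phi>t (moveT a l b) = onArr push (detour l a b)"
proof -
  have "onArr \<Phi>t (moveT a l b) = quotient_edge (Move a l b)"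
    unfolding \<Phi>t_def moveT_def using assms by (intro E.functor_from_edges_edge_arrow) (simp_all add: valid_move_iff)
  then show ?thesis by simp
qed

lemma \<Phi>t_deck:
  assumes "a \<notin> \<Union>\<A>" "m \<in> L"
  shows "onArr \<Phi>t (deck a m) = Ident PiY (orbit L (a, 0))"
proof -
  have "a + m \<notin> \<Union>\<A>" using assms translate_hyperplane by blast
  then have "onArr \<Phi>t (deck a m) = quotient_edge (Deck a m)"
    unfolding \<Phi>t_def deck_arrow_def using assms by (intro E.functor_from_edges_edge_arrow) simp_all
  then show ?thesis by simp
qed

lemma \<Phi>t_incl: "functor_eq \<Gamma>V (functor_comp \<Phi>t incl) (functor_comp push (\<Phi> \<A> Vgen))"
proof (rule \<Gamma>_functors_agree)
  show "groupoid_functor \<Gamma>V PiY (functor_comp \<Phi>t incl)"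
    by (rule groupoid_functor_comp[OF groupoid_functor_incl groupoid_functor_\<Phi>t])
  show "groupoid_functor \<Gamma>V PiY (functor_comp push (\<Phi> \<A> Vgen))"
    by (rule groupoid_functor_comp[OF groupoid_functor_\<Phi> push.groupoid_functor_axioms])
  show "onObj (functor_comp \<Phi>t incl) a = onObj (functor_comp push (\<Phi> \<A> Vgen)) a" if "a \<notin> \<Union>\<A>" for a
    by (simp add: functor_comp_def)
  show "onArr (functor_comp \<Phi>t incl) (move_arrow a l b) = onArr (functor_comp push (\<Phi> \<A> Vgen)) (move_arrow a l b)"
    if v: "valid_move \<A> Vgen a l b" for a l b
    by (simp add: functor_comp_def incl_move_arrow[OF v] \<Phi>t_moveT[OF v] \<Phi>_move_arrow[OF v])
qed

lemma \<Phi>t_normal_form: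
  assumes "g \<in> Arr \<Gamma>V" "m \<in> L"
  shows "onArr \<Phi>t (Comp \<Gamma>T (onArr incl g) (deck (Cod \<Gamma>V g) m)) = onArr push (onArr (\<Phi> \<A> Vgen) g)"
proof -
  have c: "Cod \<Gamma>V g \<notin> \<Union>\<A>" using \<Gamma>.cod_in_obj[OF assms(1)] by simp
  have eq: "onArr \<Phi>t (onArr incl g) = onArr push (onArr (\<Phi> \<A> Vgen) g)"
    using \<Phi>t_incl assms(1) by (simp add: functor_eq_def functor_comp_def)
  have "onArr \<Phi>t (Comp \<Gamma>T (onArr incl g) (deck (Cod \<Gamma>V g) m))
     = Comp PiY (onArr \<Phi>t (onArr incl g)) (Ident PiY (orbit L (Cod \<Gamma>V g, 0)))"
    using assms c by (simp add: \<Phi>t_deck)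
  also have "\<dots> = onArr \<Phi>t (onArr incl g)"
    using assms(1) by (intro PY.comp_ident_right) simp_all
  finally show ?thesis unfolding eq .
qed

text \<open>Stronger than faithfulness: that the codomains agree is part of the conclusion, and this is what
  determines the deck transformation from its image.\<close>

lemma push_eq_imp_eq:
  assumes f: "f \<in> Arr PiM" and g: "g \<in> Arr PiM" and dom: "Dom PiM f = Dom PiM g"
    and eq: "onArr push f = onArr push g"
  shows "f = g"
proof -
  obtain p where p: "pathin (top_of_set M) p" "f = path_class (top_of_set M) p"
    using f by (rule fundamental_groupoid_ArrE)
  obtain q where q: "pathin (top_of_set M) q" "g = path_class (top_of_set M) q"
    using g by (rule fundamental_groupoid_ArrE)
  have start: "p 0 = q 0" using dom unfolding p(2) q(2) by simp
  have "pathin YQ (orbit L \<circ> p)" unfolding YQ_eq by (rule pathin_compose[OF p(1) Q.continuous_orbit])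
  moreover have "path_class YQ (orbit L \<circ> p) = path_class YQ (orbit L \<circ> q)"
    using eq unfolding p(2) q(2) push_path_class[OF p(1)] push_path_class[OF q(1)] .
  ultimately have "path_homotopic YQ (orbit L \<circ> p) (orbit L \<circ> q)" by (simp only: path_class_eq_iff)
  then have "path_homotopic (top_of_set M) p q"
    using Q.path_homotopic_lift[OF p(1) q(1) start] unfolding YQ_eq by blast
  then show ?thesis unfolding p(2) q(2) by (rule path_class_eqI)
qed

text \<open>The normal form of an arrow is sent to the image of a path in the complement. That path is recovered
  by lifting, its end point gives the deck arrow, and \<open>\<Phi>\<close> recovers the rest. For fullness a path in
  the quotient is lifted; the end of the lift differs from the wanted vertex by an element of the
  lattice, which is compensated by a deck arrow.\<close>

lemma groupoid_equivalence_\<Phi>t: "groupoid_equivalence \<Gamma>T PiY \<Phi>t"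
proof (rule groupoid_equivalenceI[OF groupoid_functor_\<Phi>t])
  fix f f'
  assume f: "f \<in> Arr \<Gamma>T" "f' \<in> Arr \<Gamma>T" and dom: "Dom \<Gamma>T f = Dom \<Gamma>T f'" and cod: "Cod \<Gamma>T f = Cod \<Gamma>T f'"
    and eq: "onArr \<Phi>t f = onArr \<Phi>t f'"
  obtain g m where g: "g \<in> Arr \<Gamma>V" "m \<in> L" "Dom \<Gamma>V g = Dom \<Gamma>T f"
    "Cod \<Gamma>T f = Cod \<Gamma>V g + m" "f = Comp \<Gamma>T (onArr incl g) (deck (Cod \<Gamma>V g) m)"
    by (rule normal_form[OF f(1)])
  obtain g' m' where g': "g' \<in> Arr \<Gamma>V" "m' \<in> L" "Dom \<Gamma>V g' = Dom \<Gamma>T f'"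
    "Cod \<Gamma>T f' = Cod \<Gamma>V g' + m'" "f' = Comp \<Gamma>T (onArr incl g') (deck (Cod \<Gamma>V g') m')"
    by (rule normal_form[OF f(2)])
  have e1: "onArr \<Phi>t f = onArr push (onArr (\<Phi> \<A> Vgen) g)" by (subst g(5)) (rule \<Phi>t_normal_form[OF g(1,2)])
  have e2: "onArr \<Phi>t f' = onArr push (onArr (\<Phi> \<A> Vgen) g')" by (subst g'(5)) (rule \<Phi>t_normal_form[OF g'(1,2)])
  have "onArr push (onArr (\<Phi> \<A> Vgen) g) = onArr push (onArr (\<Phi> \<A> Vgen) g')"
    unfolding e1[symmetric] e2[symmetric] by (rule eq)
  moreover have "Dom PiM (onArr (\<Phi> \<A> Vgen) g) = Dom PiM (onArr (\<Phi> \<A> Vgen) g')"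
    using g(1,3) g'(1,3) dom by simp
  ultimately have "onArr (\<Phi> \<A> Vgen) g = onArr (\<Phi> \<A> Vgen) g'"
    using F.map_arr[OF g(1)] F.map_arr[OF g'(1)] by (intro push_eq_imp_eq)
  then have gg: "g = g'" by (rule \<Phi>_faithful[OF g(1) g'(1)])
  have "Cod \<Gamma>V g + m = Cod \<Gamma>V g + m'" using cod unfolding g(4) g'(4) gg .
  then have "m = m'" by simp
  then show "f = f'" by (subst g(5), subst g'(5)) (simp only: gg)
next
  fix a b h
  assume "a \<in> Obj \<Gamma>T" "b \<in> Obj \<Gamma>T" and h: "h \<in> Arr PiY" "Dom PiY h = onObj \<Phi>t a" "Cod PiY h = onObj \<Phi>t b"
  then have a: "a \<notin> \<Union>\<A>" and b: "b \<notin> \<Union>\<A>" by simp_all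
  obtain q where q: "pathin YQ q" "h = path_class YQ q" using h(1) by (rule fundamental_groupoid_ArrE)
  have q0: "orbit L (a, 0) = q 0" and q1: "q 1 = orbit L (b, 0)" using h(2,3) unfolding q(2) by simp_all
  obtain p where p: "pathin (top_of_set M) p" "p 0 = (a, 0)" "path_class YQ (orbit L \<circ> p) = path_class YQ q"
    "\<And>t. t \<in> {0..1} \<Longrightarrow> orbit L (p t) = q t"
    using Q.path_lift[OF q(1)[unfolded YQ_eq] real_point_mem_M[OF a] q0] unfolding YQ_eq by blast
  have "orbit L (b, 0) = orbit L (p 1)" using p(4)[of 1] q1 by simp
  then obtain k where k: "k \<in> L" "p 1 = (b, 0) + (k, 0)" using Q.orbit_eq_iff by blast
  have bk: "b + k \<notin> \<Union>\<A>" using b translate_hyperplane[OF k(1)] by blast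
  have pM: "path_class (top_of_set M) p \<in> Arr PiM" "Dom PiM (path_class (top_of_set M) p) = (a, 0)"
    "Cod PiM (path_class (top_of_set M) p) = (b + k, 0)"
    using p(1,2) k(2) by simp_all
  obtain g where g: "g \<in> Arr \<Gamma>V" "Dom \<Gamma>V g = a" "Cod \<Gamma>V g = b + k"
    "onArr (\<Phi> \<A> Vgen) g = path_class (top_of_set M) p"
    by (rule \<Phi>_full[OF pM(1) a bk pM(2,3)])
  have m: "0 - k \<in> L" using lattice_subgroup k(1) by blast
  let ?f = "Comp \<Gamma>T (onArr incl g) (deck (Cod \<Gamma>V g) (0 - k))"
  have "onArr \<Phi>t ?f = h"
    unfolding \<Phi>t_normal_form[OF g(1) m] g(4) push_path_class[OF p(1)] p(3) q(2) by (rule refl)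
  moreover have "?f \<in> Arr \<Gamma>T" "Dom \<Gamma>T ?f = a" "Cod \<Gamma>T ?f = b"
    using g(1-3) m bk by simp_all
  ultimately show "\<exists>f\<in>Arr \<Gamma>T. Dom \<Gamma>T f = a \<and> Cod \<Gamma>T f = b \<and> onArr \<Phi>t f = h" by blast
next
  fix y assume "y \<in> Obj PiY"
  then have "y \<in> orbit L ` M" by (simp add: YQ_eq Q.topspace_Y)
  then obtain w where w: "w \<in> M" "y = orbit L w" by blast
  obtain a g where a: "a \<notin> \<Union>\<A>" and g: "g \<in> Arr PiM" "Dom PiM g = w" "Cod PiM g = (a, 0)"
    by (rule \<Phi>_essentially_surjective[OF w(1)])
  have "a \<in> Obj \<Gamma>T" using a by simp
  moreover have "onArr push g \<in> Arr PiY" by (rule push.map_arr[OF g(1)])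
  moreover have "Dom PiY (onArr push g) = y" "Cod PiY (onArr push g) = onObj \<Phi>t a"
    using push.map_dom[OF g(1)] push.map_cod[OF g(1)] g(2,3) w(2) by simp_all
  ultimately show "\<exists>a\<in>Obj \<Gamma>T. \<exists>e\<in>Arr PiY. Dom PiY e = y \<and> Cod PiY e = onObj \<Phi>t a" by blast
qed

end

theorem proposition6p5:
  fixes L :: "'v::real_normed_vector set" and \<A> :: "'v set set" and Vgen :: "'v set"
  assumes "is_lattice L"
    and "invariant_arrangement L \<A>"
    and "generic_directions \<A> Vgen"
  shows "groupoid_equivalence (\<Gamma> \<A> Vgen) (fundamental_groupoid (arr_complement \<A>)) (\<Phi> \<A> Vgen) \<and>
    faithful_functor (fundamental_groupoid (arr_complement \<A>))
      (fundamental_groupoid (arr_quotient L \<A>)) (induced_functor (arr_quotient L \<A>) (orbit L)) \<and>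
    (\<exists>\<Phi>t. groupoid_equivalence (\<Gamma>t L \<A> Vgen) (fundamental_groupoid (arr_quotient L \<A>)) \<Phi>t \<and>
      functor_eq (\<Gamma> \<A> Vgen)
        (functor_comp \<Phi>t (\<Gamma>_to_\<Gamma>t L \<A> Vgen))
        (functor_comp (induced_functor (arr_quotient L \<A>) (orbit L)) (\<Phi> \<A> Vgen)) \<and>
      (\<forall>\<delta> m. \<delta> \<notin> \<Union>\<A> \<and> m \<in> L \<longrightarrow>
        onArr \<Phi>t (deck_arrow L \<A> Vgen \<delta> m) =
          Ident (fundamental_groupoid (arr_quotient L \<A>)) (orbit L (\<delta>, 0))))"
proof -
  interpret lattice_arrangement L \<A> Vgen
    using assms by unfold_locales
  show ?thesis
    unfolding arr_complement_eq
    using groupoid_equivalence_\<Phi> faithful_push groupoid_equivalence_\<Phi>t \<Phi>t_incl \<Phi>t_deck by blast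
qed

end
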